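(* Let $\pi=\{p_1,\ldots,p_n\}$ be a finite set of primes, let $G$ be a finite group, and let $P_i$ be a Sylow $p_i$-subgroup of $G$ for all $p_i\in\pi$. If the normalizer of every $\pi$-special non-subnormal subgroup of $G$ is $\pi$-special, then: (i) $G$ has a Hall $\pi'$-subgroup $H$, and at least one of the subgroups $P_1,\ldots,P_n,H$ is normal in $G$. (ii) $O_{p_1}(G)\times\cdots\times O_{p_n}(G)\times O_{\pi'}(G)$ is a maximal $\pi$-special subgroup of $G$. (iii) $G/F(G)$ is $\pi$-special.
   Context: All groups are finite. $\pi'$ is the complement of $\pi$ in the set of all primes. $O_{p}(G)$ and $O_{\pi'}(G)$ are the largest normal $p$-subgroup and the largest normal $\pi'$-subgroup of $G$. A group $G$ is $\pi$-special, for $\pi=\{p_1,\ldots,p_n\}$, if $G=O_{p_1}(G)\times\cdots\times O_{p_n}(G)\times O_{\pi'}(G)$. $F(G)$ is the Fitting subgroup. A maximal $\pi$-special subgroup is one maximal under inclusion among $\pi$-special subgroups of $G$. *)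

theory Defs
  imports "HOL-Algebra.Algebra" "HOL-Computational_Algebra.Primes"
begin

(* All groups are meant to be finite; the definitions below are stated for arbitrary groups, but
   are only the intended notions when "finite (carrier G)" holds (card of an infinite set is 0).
   The name "Factorial_Ring.prime" is qualified because Divisibility declares another "prime". *)

section \<open>Sets of primes and the cores of a finite group\<close>

definition prime_compl :: "nat set \<Rightarrow> nat set" where
  "prime_compl \<pi> = {p. Factorial_Ring.prime p \<and> p \<notin> \<pi>}"

definition pi_subgroup :: "nat set \<Rightarrow> 'a set \<Rightarrow> ('a, 'b) monoid_scheme \<Rightarrow> bool" where
  "pi_subgroup \<sigma> H G \<longleftrightarrow>
     subgroup H G \<and> (\<forall>p. Factorial_Ring.prime p \<and> p dvd card H \<longrightarrow> p \<in> \<sigma>)"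

(* The largest normal \<sigma>-subgroup with respect to inclusion; for \<sigma> = {p} it is O_p(G).  It exists for
   every finite G, see pi_core_largest below. *)
definition pi_core :: "nat set \<Rightarrow> ('a, 'b) monoid_scheme \<Rightarrow> 'a set" where
  "pi_core \<sigma> G = (GREATEST N. N \<lhd> G \<and> pi_subgroup \<sigma> N G)"


section \<open>Special groups\<close>

definition internal_direct_product ::
    "('a, 'b) monoid_scheme \<Rightarrow> 'i set \<Rightarrow> ('i \<Rightarrow> 'a set) \<Rightarrow> bool" where
  "internal_direct_product G I N \<longleftrightarrow>
     (\<forall>i\<in>I. N i \<lhd> G) \<and>
     generate G (\<Union>i\<in>I. N i) = carrier G \<and>
     (\<forall>i\<in>I. N i \<inter> generate G (\<Union>j\<in>I - {i}. N j) = {\<one>\<^bsub>G\<^esub>})"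

(* The direct factors are indexed by the sets of primes {p_1}, ..., {p_n}, \<pi>' themselves.  These are
   pairwise distinct when \<pi> is a set of primes, since \<pi>' is disjoint from \<pi>. *)
definition pi_blocks :: "nat set \<Rightarrow> nat set set" where
  "pi_blocks \<pi> = insert (prime_compl \<pi>) ((\<lambda>p. {p}) ` \<pi>)"

definition pi_special :: "nat set \<Rightarrow> ('a, 'b) monoid_scheme \<Rightarrow> bool" where
  "pi_special \<pi> G \<longleftrightarrow> internal_direct_product G (pi_blocks \<pi>) (\<lambda>\<sigma>. pi_core \<sigma> G)"

(* O_{p_1}(G) \<times> ... \<times> O_{p_n}(G) \<times> O_{\<pi>'}(G); the product is direct by special_core_direct below. *)
definition special_core :: "nat set \<Rightarrow> ('a, 'b) monoid_scheme \<Rightarrow> 'a set" where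
  "special_core \<pi> G = generate G (\<Union>\<sigma>\<in>pi_blocks \<pi>. pi_core \<sigma> G)"

definition maximal_pi_special :: "nat set \<Rightarrow> 'a set \<Rightarrow> ('a, 'b) monoid_scheme \<Rightarrow> bool" where
  "maximal_pi_special \<pi> M G \<longleftrightarrow>
     subgroup M G \<and> pi_special \<pi> (G\<lparr>carrier := M\<rparr>) \<and>
     (\<forall>K. subgroup K G \<and> pi_special \<pi> (G\<lparr>carrier := K\<rparr>) \<and> M \<subseteq> K \<longrightarrow> K = M)"


section \<open>Subnormal, Sylow and Hall subgroups\<close>

inductive subnormal :: "('a, 'b) monoid_scheme \<Rightarrow> 'a set \<Rightarrow> bool" for G where
  whole: "subnormal G (carrier G)"
| step: "subnormal G K \<Longrightarrow> H \<lhd> G\<lparr>carrier := K\<rparr> \<Longrightarrow> subnormal G H"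

definition sylow_subgroup :: "nat \<Rightarrow> 'a set \<Rightarrow> ('a, 'b) monoid_scheme \<Rightarrow> bool" where
  "sylow_subgroup p P G \<longleftrightarrow> subgroup P G \<and> card P = p ^ multiplicity p (order G)"

definition hall_subgroup :: "nat set \<Rightarrow> 'a set \<Rightarrow> ('a, 'b) monoid_scheme \<Rightarrow> bool" where
  "hall_subgroup \<sigma> H G \<longleftrightarrow>
     pi_subgroup \<sigma> H G \<and>
     (\<forall>p. Factorial_Ring.prime p \<and> p dvd card (rcosets\<^bsub>G\<^esub> H) \<longrightarrow> p \<notin> \<sigma>)"


section \<open>The Fitting subgroup\<close>

primrec lower_central :: "('a, 'b) monoid_scheme \<Rightarrow> nat \<Rightarrow> 'a set" where
  "lower_central G 0 = carrier G"
| "lower_central G (Suc n) =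
     generate G (\<Union>x\<in>lower_central G n. \<Union>y\<in>carrier G.
       {x \<otimes>\<^bsub>G\<^esub> y \<otimes>\<^bsub>G\<^esub> inv\<^bsub>G\<^esub> x \<otimes>\<^bsub>G\<^esub> inv\<^bsub>G\<^esub> y})"

definition nilpotent_group :: "('a, 'b) monoid_scheme \<Rightarrow> bool" where
  "nilpotent_group G \<longleftrightarrow> group G \<and> (\<exists>n. lower_central G n = {\<one>\<^bsub>G\<^esub>})"

(* The subgroup generated by all nilpotent normal subgroups; for finite G it is itself nilpotent
   (Fitting's theorem), hence the largest nilpotent normal subgroup. *)
definition fitting :: "('a, 'b) monoid_scheme \<Rightarrow> 'a set" where
  "fitting G = generate G (\<Union>{N. N \<lhd> G \<and> nilpotent_group (G\<lparr>carrier := N\<rparr>)})"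


section \<open>The cores are well-defined and their product is direct\<close>

lemma (in group) pi_subgroup_set_mult:
  assumes fin: "finite (carrier G)"
    and M: "M \<lhd> G" "pi_subgroup \<sigma> M G" and N: "N \<lhd> G" "pi_subgroup \<sigma> N G"
  shows "pi_subgroup \<sigma> (M <#> N) G"
proof -
  interpret second_isomorphism_grp M G N
    using M N by (simp add: second_isomorphism_grp_def second_isomorphism_grp_axioms_def
        normal_imp_subgroup)
  have subN: "subgroup N G" using N normal_imp_subgroup by blast
  have subMN: "subgroup (M <#> N) G" by (rule normal_set_mult_subgroup)
  interpret gN: group "G\<lparr>carrier := N\<rparr>" using subN subgroup_imp_group by blast
  interpret gMN: group "G\<lparr>carrier := M <#> N\<rparr>" using subMN subgroup_imp_group by blast
  have finMN: "finite (M <#> N)" and finN: "finite N"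
    using fin subMN subN finite_subset subgroup.subset by blast+
  have sM: "subgroup M (G\<lparr>carrier := M <#> N\<rparr>)"
    using H_contained_in_set_mult subMN subgroup_incl subgroup_axioms by blast
  have sI: "subgroup (M \<inter> N) (G\<lparr>carrier := N\<rparr>)"
    using subN subgroup_axioms by (metis Int_lower2 subgroup_incl subgroups_Inter_pair)
  have "card (carrier ((G\<lparr>carrier := N\<rparr>) Mod (M \<inter> N)))
      = card (carrier ((G\<lparr>carrier := M <#> N\<rparr>) Mod M))"
    using normal_intersection_quotient_isom by (auto simp: iso_def intro: bij_betw_same_card)
  then have idx: "card (rcosets\<^bsub>G\<lparr>carrier := N\<rparr>\<^esub> (M \<inter> N)) = card (rcosets\<^bsub>G\<lparr>carrier := M <#> N\<rparr>\<^esub> M)"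
    by (simp add: FactGroup_def)
  have 1: "card (rcosets\<^bsub>G\<lparr>carrier := N\<rparr>\<^esub> (M \<inter> N)) * card (M \<inter> N) = card N"
    using gN.lagrange[OF sI] by (simp add: order_def)
  have 2: "card (rcosets\<^bsub>G\<lparr>carrier := M <#> N\<rparr>\<^esub> M) * card M = card (M <#> N)"
    using gMN.lagrange[OF sM] by (simp add: order_def)
  have "card (rcosets\<^bsub>G\<lparr>carrier := M <#> N\<rparr>\<^esub> M) dvd card N"
    using 1 idx dvd_triv_left by metis
  then have dvdMN: "card (M <#> N) dvd card N * card M"
    unfolding 2[symmetric] by (rule mult_dvd_mono) (rule dvd_refl)
  then show ?thesis
    unfolding pi_subgroup_def
  proof (intro conjI allI impI)
    fix p assume p: "Factorial_Ring.prime p \<and> p dvd card (M <#> N)"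
    then have "p dvd card N \<or> p dvd card M"
      using dvdMN dvd_trans prime_dvd_multD by blast
    then show "p \<in> \<sigma>"
      using p M(2) N(2) unfolding pi_subgroup_def by blast
  qed (rule subMN)
qed

lemma (in group) pi_core_exists:
  assumes fin: "finite (carrier G)"
  shows "\<exists>N. (N \<lhd> G \<and> pi_subgroup \<sigma> N G) \<and> (\<forall>M. M \<lhd> G \<and> pi_subgroup \<sigma> M G \<longrightarrow> M \<subseteq> N)"
proof -
  let ?A = "{N. N \<lhd> G \<and> pi_subgroup \<sigma> N G}"
  have "?A \<subseteq> Pow (carrier G)" by (auto simp: pi_subgroup_def dest: subgroup.subset)
  then have finA: "finite ?A" using fin by (meson finite_Pow_iff finite_subset)
  have "{\<one>} \<in> ?A"
    using one_is_normal by (auto simp: pi_subgroup_def normal_imp_subgroup)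
  then have "?A \<noteq> {}" by blast
  from finite_has_maximal[OF finA this]
  obtain N where N: "N \<in> ?A" and max: "\<And>M. M \<in> ?A \<Longrightarrow> N \<subseteq> M \<Longrightarrow> M = N"
    by auto
  have "M \<subseteq> N" if M: "M \<in> ?A" for M
  proof -
    interpret second_isomorphism_grp M G N
      using M N by (simp add: second_isomorphism_grp_def second_isomorphism_grp_axioms_def
          normal_imp_subgroup)
    have "M <#> N \<in> ?A"
      using M N normal_subgroup_set_mult_closed pi_subgroup_set_mult fin by blast
    then show ?thesis
      using max S_contained_in_set_mult H_contained_in_set_mult by blast
  qed
  then show ?thesis using N by blast
qed

lemma (in group) pi_core_largest:
  assumes "finite (carrier G)"
  shows "pi_core \<sigma> G \<lhd> G" "pi_subgroup \<sigma> (pi_core \<sigma> G) G"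
    and "\<And>M. M \<lhd> G \<Longrightarrow> pi_subgroup \<sigma> M G \<Longrightarrow> M \<subseteq> pi_core \<sigma> G"
proof -
  obtain N where N: "N \<lhd> G \<and> pi_subgroup \<sigma> N G"
      "\<And>M. M \<lhd> G \<and> pi_subgroup \<sigma> M G \<Longrightarrow> M \<subseteq> N"
    using pi_core_exists[OF assms] by blast
  have "pi_core \<sigma> G = N"
    unfolding pi_core_def by (rule Greatest_equality) (use N in auto)
  then show "pi_core \<sigma> G \<lhd> G" "pi_subgroup \<sigma> (pi_core \<sigma> G) G"
    "\<And>M. M \<lhd> G \<Longrightarrow> pi_subgroup \<sigma> M G \<Longrightarrow> M \<subseteq> pi_core \<sigma> G"
    using N by auto
qed

lemma (in group) pi_core_Int:
  assumes fin: "finite (carrier G)" and disj: "\<sigma> \<inter> \<tau> = {}"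
  shows "pi_core \<sigma> G \<inter> pi_core \<tau> G = {\<one>}"
proof -
  let ?A = "pi_core \<sigma> G" and ?B = "pi_core \<tau> G"
  have sA: "subgroup ?A G" and sB: "subgroup ?B G"
    using pi_core_largest[OF fin] normal_imp_subgroup by blast+
  have sI: "subgroup (?A \<inter> ?B) G" using sA sB subgroups_Inter_pair by blast
  have dvd: "card (?A \<inter> ?B) dvd card U" if "U \<in> {?A, ?B}" for U
  proof -
    have sU: "subgroup U G" using that sA sB by blast
    interpret gU: group "G\<lparr>carrier := U\<rparr>" using sU subgroup_imp_group by blast
    have "subgroup (?A \<inter> ?B) (G\<lparr>carrier := U\<rparr>)"
      using sI sU that by (intro subgroup_incl) auto
    from gU.lagrange[OF this] have "card (rcosets\<^bsub>G\<lparr>carrier := U\<rparr>\<^esub> (?A \<inter> ?B)) * card (?A \<inter> ?B) = card U"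
      by (simp add: order_def)
    from this[symmetric] show ?thesis by (rule dvdI[OF trans]) (rule mult.commute)
  qed
  have "card (?A \<inter> ?B) = 1"
  proof (rule ccontr)
    assume "card (?A \<inter> ?B) \<noteq> 1"
    then obtain p where p: "Factorial_Ring.prime p" "p dvd card (?A \<inter> ?B)"
      using prime_factor_nat by blast
    have "p dvd card ?A" "p dvd card ?B"
      using dvd_trans[OF p(2) dvd] by blast+
    then have "p \<in> \<sigma>" "p \<in> \<tau>"
      using p(1) pi_core_largest(2)[OF fin, of \<sigma>] pi_core_largest(2)[OF fin, of \<tau>]
      unfolding pi_subgroup_def by blast+
    then show False using disj by blast
  qed
  then show ?thesis
    using subgroup.one_closed[OF sI] by (metis card_1_singletonE singletonD)
qed

lemma (in group) generate_pi_core_subset: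
  assumes fin: "finite (carrier G)" and "\<And>\<sigma>. \<sigma> \<in> S \<Longrightarrow> \<sigma> \<subseteq> \<tau>"
  shows "generate G (\<Union>\<sigma>\<in>S. pi_core \<sigma> G) \<subseteq> pi_core \<tau> G"
proof (rule generate_subgroup_incl)
  show "subgroup (pi_core \<tau> G) G"
    using pi_core_largest[OF fin] normal_imp_subgroup by blast
  show "(\<Union>\<sigma>\<in>S. pi_core \<sigma> G) \<subseteq> pi_core \<tau> G"
  proof (rule UN_least)
    fix \<sigma> assume "\<sigma> \<in> S"
    then have "pi_subgroup \<tau> (pi_core \<sigma> G) G"
      using pi_core_largest(2)[OF fin, of \<sigma>] assms(2) unfolding pi_subgroup_def by blast
    then show "pi_core \<sigma> G \<subseteq> pi_core \<tau> G"
      using pi_core_largest[OF fin] by blast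
  qed
qed

lemma (in group) special_core_direct:
  assumes fin: "finite (carrier G)"
  shows "subgroup (special_core \<pi> G) G"
    and "internal_direct_product (G\<lparr>carrier := special_core \<pi> G\<rparr>) (pi_blocks \<pi>) (\<lambda>\<sigma>. pi_core \<sigma> G)"
proof -
  let ?D = "special_core \<pi> G"
  have sub: "(\<Union>\<sigma>\<in>S. pi_core \<sigma> G) \<subseteq> carrier G" for S
    by (intro UN_least subgroup.subset normal_imp_subgroup pi_core_largest(1)[OF fin])
  show sD: "subgroup ?D G"
    unfolding special_core_def by (rule generate_is_subgroup[OF sub])
  have inD: "pi_core \<sigma> G \<subseteq> ?D" if "\<sigma> \<in> pi_blocks \<pi>" for \<sigma>
    unfolding special_core_def using that by (auto intro: generate.incl)
  have gen: "generate (G\<lparr>carrier := ?D\<rparr>) (\<Union>\<sigma>\<in>S. pi_core \<sigma> G) = generate G (\<Union>\<sigma>\<in>S. pi_core \<sigma> G)"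
    if "S \<subseteq> pi_blocks \<pi>" for S
    by (rule generate_consistent) (use that inD sD in auto)
  have triv: "pi_core \<sigma> G \<inter> generate G (\<Union>\<tau>\<in>pi_blocks \<pi> - {\<sigma>}. pi_core \<tau> G) = {\<one>}"
    if \<sigma>: "\<sigma> \<in> pi_blocks \<pi>" for \<sigma>
  proof -
    have "\<tau> \<subseteq> - \<sigma>" if "\<tau> \<in> pi_blocks \<pi> - {\<sigma>}" for \<tau>
      using that \<sigma> by (auto simp: pi_blocks_def prime_compl_def)
    then have "generate G (\<Union>\<tau>\<in>pi_blocks \<pi> - {\<sigma>}. pi_core \<tau> G) \<subseteq> pi_core (- \<sigma>) G"
      by (intro generate_pi_core_subset[OF fin])
    moreover have "pi_core \<sigma> G \<inter> pi_core (- \<sigma>) G = {\<one>}"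
      by (rule pi_core_Int[OF fin]) auto
    moreover have "\<one> \<in> pi_core \<sigma> G"
      by (intro subgroup.one_closed normal_imp_subgroup pi_core_largest(1)[OF fin])
    ultimately show ?thesis using generate.one by blast
  qed
  show "internal_direct_product (G\<lparr>carrier := ?D\<rparr>) (pi_blocks \<pi>) (\<lambda>\<sigma>. pi_core \<sigma> G)"
    unfolding internal_direct_product_def
  proof (intro conjI ballI)
    fix \<sigma> assume \<sigma>: "\<sigma> \<in> pi_blocks \<pi>"
    show "pi_core \<sigma> G \<lhd> G\<lparr>carrier := ?D\<rparr>"
      using normal_restrict_supergroup[OF sD pi_core_largest(1)[OF fin] inD[OF \<sigma>]] .
    show "pi_core \<sigma> G \<inter> generate (G\<lparr>carrier := ?D\<rparr>) (\<Union>\<tau>\<in>pi_blocks \<pi> - {\<sigma>}. pi_core \<tau> G)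
        = {\<one>\<^bsub>G\<lparr>carrier := ?D\<rparr>\<^esub>}"
      using triv[OF \<sigma>] gen[of "pi_blocks \<pi> - {\<sigma>}"] by auto
  qed (use gen[of "pi_blocks \<pi>"] in \<open>simp add: special_core_def\<close>)
qed

end

(* Write O_p for O_p(G).  For p in pi, two Sylow p-subgroups whose intersection D is not contained in O_p
   coincide: take D maximal; D is not subnormal, so N(D) is special and its unique Sylow p-subgroup
   contains the (strictly larger) normalizers of D in both.  Hence the Sylow p-subgroups of G / O_p
   intersect trivially, and if P is not normal, then N(P) = P x C.  By a transfer argument G / O_p has a
   normal p-complement L_p / O_p.

   Let P be a non-normal Sylow p-subgroup and r a prime other than p.  A Sylow r-subgroup R of G lies in
   L_p.  If R is not normal, then N(R) is special, G = L_p N(R) by the Frattini argument, and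
   O_p O_p(N(R)) is a Sylow p-subgroup of G which is normalized, hence centralized, by R.  So for every
   r other than p either G has a normal Sylow r-subgroup, or P centralizes some Sylow r-subgroup.

   Consequently P F(G) is normal in G, which gives (iii).  If P moreover centralizes all O_r with r other
   than p, then P is normal; this gives the p-part of (ii): if K is special and contains the special
   core, then an O_p(K) not contained in O_p can be enlarged to such a P.  Finally, the intersection M of the L_p has
   normal Sylow p-subgroups for p in pi, so Schur-Zassenhaus provides a Hall pi'-subgroup H of M, and H
   is one of G.  If no P_i is normal, then H centralizes all O_p, whence H is normal.  Applied to the
   centralizer in M of all O_p, the same argument gives the pi'-part of (ii). *)

theory Submission
  imports Defs "HOL-Number_Theory.Cong"
begin

section \<open>Finite groups and coprime orders\<close>

text \<open>The assumption on normalizers is only applied to r-subgroups Q, where r is any prime, in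
  \<pi> or not. Such a Q is special, and if it is subnormal, it lies in O_r. So N(Q) is special as
  soon as Q is not contained in O_r; and in a special group p-subgroups and p'-subgroups centralize
  each other for p in \<pi>. The transfer goes from G into P / W, where W is maximal among the
  proper subgroups of P containing O_p. A coset outside N(P) contributes an element of O_p, because
  distinct Sylow p-subgroups meet inside O_p. A coset in N(P) contributes x itself modulo W, because
  N(P) = P x C acts trivially on the abelian group P / W. So x in P is sent to x^k with k = |N(P) :
  P| prime to p, and the kernel meets P in W. Repeating this inside the kernel reaches O_p, which is
  carried along as a fixed subgroup V rather than factored out.\<close>

hide_const (open) Divisibility.prime

text \<open>Only primes are tested against \<sigma>, so \<open>-{p}\<close>, which also contains
  numbers that are not prime, serves as p'. Positivity excludes 0, which would otherwise count when
  \<sigma> contains every prime.\<close>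

definition pi_number :: "nat set \<Rightarrow> nat \<Rightarrow> bool" where
  "pi_number \<sigma> n \<longleftrightarrow> n > 0 \<and> (\<forall>p. prime p \<and> p dvd n \<longrightarrow> p \<in> \<sigma>)"

lemma pi_number_mult: "pi_number \<sigma> a \<Longrightarrow> pi_number \<sigma> b \<Longrightarrow> pi_number \<sigma> (a * b)"
  unfolding pi_number_def by (auto simp: prime_dvd_mult_iff)

lemma pi_number_dvd: "pi_number \<sigma> b \<Longrightarrow> a dvd b \<Longrightarrow> pi_number \<sigma> a"
  unfolding pi_number_def by (meson dvd_pos_nat dvd_trans)

lemma pi_number_mono: "pi_number \<sigma> a \<Longrightarrow> \<sigma> \<subseteq> \<tau> \<Longrightarrow> pi_number \<tau> a"
  unfolding pi_number_def by auto

lemma pi_number_1 [simp]: "pi_number \<sigma> (Suc 0)" "pi_number \<sigma> 1"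
  unfolding pi_number_def by auto

lemma pi_number_coprime:
  assumes "pi_number \<sigma> a" "pi_number \<tau> b" "\<sigma> \<inter> \<tau> = {}"
  shows "coprime a b"
proof (rule ccontr)
  assume "\<not> coprime a b"
  then obtain p where "prime p" "p dvd gcd a b"
    using prime_factor_nat coprime_iff_gcd_eq_1 by blast
  then have "prime p" "p dvd a" "p dvd b" by auto
  then show False using assms unfolding pi_number_def by blast
qed

lemma pi_number_compl_iff: "prime p \<Longrightarrow> pi_number (-{p}) n \<longleftrightarrow> n > 0 \<and> \<not> p dvd n"
  unfolding pi_number_def by (auto dest: primes_dvd_imp_eq)

lemma pi_number_prime_power: "prime p \<Longrightarrow> pi_number {p} (p ^ k)"
  unfolding pi_number_def by (metis insertI1 prime_dvd_power prime_gt_0_nat primes_dvd_imp_eq zero_less_power)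

lemma pi_number_primeE:
  assumes "prime p" "pi_number {p} n"
  obtains k where "n = p ^ k"
proof -
  obtain m where m: "n = p ^ multiplicity p n * m" "\<not> p dvd m"
    using assms multiplicity_decompose'[of n p] unfolding pi_number_def
    by (metis less_numeral_extra(3) not_prime_unit)
  moreover have "pi_number {p} m" by (rule pi_number_dvd[OF assms(2)]) (use m(1) dvd_triv_right in metis)
  ultimately have "m = 1" using prime_factor_nat unfolding pi_number_def by blast
  then show thesis using that m(1) by simp
qed

lemma pi_number_both: "pi_number \<sigma> n \<Longrightarrow> pi_number \<tau> n \<Longrightarrow> \<sigma> \<inter> \<tau> = {} \<Longrightarrow> n = 1"
  using prime_factor_nat unfolding pi_number_def by blast

section \<open>Products of subgroups, their orders, and membership through coprime powers\<close>

locale finite_group = group +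
  assumes fin_carrier [simp, intro]: "finite (carrier G)"

definition (in group) conj_set :: "'a \<Rightarrow> 'a set \<Rightarrow> 'a set" where
  "conj_set g A = (\<lambda>a. g \<otimes> a \<otimes> inv g) ` A"

definition (in group) normalizes :: "'a set \<Rightarrow> 'a set \<Rightarrow> bool" where
  "normalizes K A \<longleftrightarrow> (\<forall>x\<in>K. \<forall>a\<in>A. x \<otimes> a \<otimes> inv x \<in> A)"

definition (in group) commutes :: "'a set \<Rightarrow> 'a set \<Rightarrow> bool" where
  "commutes A B \<longleftrightarrow> (\<forall>a\<in>A. \<forall>b\<in>B. a \<otimes> b = b \<otimes> a)"

context group
begin

lemma l_inv_cancel: "x \<in> carrier G \<Longrightarrow> y \<in> carrier G \<Longrightarrow> inv x \<otimes> (x \<otimes> y) = y"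
  by (simp add: m_assoc[symmetric])

lemma r_inv_cancel: "x \<in> carrier G \<Longrightarrow> y \<in> carrier G \<Longrightarrow> x \<otimes> (inv x \<otimes> y) = y"
  by (simp add: m_assoc[symmetric])

text \<open>A normal form for words: brackets to the right, inverses moved onto the letters,
  neighbours \<open>x\<close> and \<open>inv x\<close> cancelled. Most identities between conjugates
  and commutators below are settled by it.\<close>

lemmas group_word_simps = m_assoc inv_mult_group l_inv_cancel r_inv_cancel

end

context finite_group
begin

lemma order_pos [simp]: "order G > 0"
  using fin_carrier by (simp add: order_gt_0_iff_finite)

lemma finite_sub [intro]: "subgroup H G \<Longrightarrow> finite H"
  using fin_carrier finite_subset subgroup.subset by blast

lemma card_sub_pos: "subgroup H G \<Longrightarrow> card H > 0"
  using finite_sub subgroup.one_closed by (metis card_gt_0_iff empty_iff)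

lemma finite_group_sub: "subgroup H G \<Longrightarrow> finite_group (G\<lparr>carrier := H\<rparr>)"
  by (simp add: finite_group_def finite_group_axioms_def subgroup_imp_group finite_sub)

lemma card_sub_dvd:
  assumes "subgroup A G" "subgroup B G" "A \<subseteq> B"
  shows "card A dvd card B"
proof -
  interpret B: finite_group "G\<lparr>carrier := B\<rparr>" using assms finite_group_sub by blast
  have "subgroup A (G\<lparr>carrier := B\<rparr>)" using assms subgroup_incl by blast
  have "card (rcosets\<^bsub>G\<lparr>carrier := B\<rparr>\<^esub> A) * card A = card B"
    using B.lagrange[OF \<open>subgroup A (G\<lparr>carrier := B\<rparr>)\<close>] by (simp add: order_def)
  then show ?thesis by (metis dvd_triv_right)
qed

lemma card_dvd_order: "subgroup A G \<Longrightarrow> card A dvd order G"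
  unfolding order_def by (rule card_sub_dvd[OF _ subgroup_self]) (auto dest: subgroup.subset)

lemma sub_Int: "subgroup A G \<Longrightarrow> subgroup B G \<Longrightarrow> subgroup (A \<inter> B) G"
  using subgroups_Inter_pair by blast

lemma sub_eqI:
  assumes "subgroup A G" "subgroup B G" "A \<subseteq> B" "card A = card B"
  shows "A = B"
  using assms by (simp add: card_subset_eq finite_sub)

lemma sub_mem: "subgroup A G \<Longrightarrow> a \<in> A \<Longrightarrow> a \<in> carrier G"
  by (rule subgroup.mem_carrier)

lemma sub_restrict_iff:
  assumes "subgroup K G"
  shows "subgroup A (G\<lparr>carrier := K\<rparr>) \<longleftrightarrow> subgroup A G \<and> A \<subseteq> K"
proof
  assume "subgroup A (G\<lparr>carrier := K\<rparr>)"
  then show "subgroup A G \<and> A \<subseteq> K" using assms incl_subgroup subgroup.subset by force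
next
  assume "subgroup A G \<and> A \<subseteq> K"
  then show "subgroup A (G\<lparr>carrier := K\<rparr>)" using assms subgroup_incl by simp
qed

lemma normal_iff: "N \<lhd> G \<longleftrightarrow> subgroup N G \<and> normalizes (carrier G) N"
  unfolding normalizes_def normal_inv_iff by auto

lemma normal_restrict_iff:
  assumes "subgroup K G"
  shows "N \<lhd> G\<lparr>carrier := K\<rparr> \<longleftrightarrow> subgroup N G \<and> N \<subseteq> K \<and> normalizes K N"
proof -
  interpret K: group "G\<lparr>carrier := K\<rparr>" using assms subgroup_imp_group by blast
  show ?thesis
    unfolding K.normal_inv_iff sub_restrict_iff[OF assms] normalizes_def
    using assms by auto
qed

lemma normalizesD: "normalizes K A \<Longrightarrow> x \<in> K \<Longrightarrow> a \<in> A \<Longrightarrow> x \<otimes> a \<otimes> inv x \<in> A"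
  unfolding normalizes_def by blast

lemma normalizesD':
  assumes "subgroup K G" "normalizes K A" "x \<in> K" "a \<in> A"
  shows "inv x \<otimes> a \<otimes> x \<in> A"
  using normalizesD[OF assms(2), of "inv x" a] assms subgroup.m_inv_closed sub_mem by fastforce

lemma normal_conj: "N \<lhd> G \<Longrightarrow> x \<in> carrier G \<Longrightarrow> a \<in> N \<Longrightarrow> x \<otimes> a \<otimes> inv x \<in> N"
  using normal_iff normalizesD by blast

lemma normalizes_mono: "normalizes K A \<Longrightarrow> K' \<subseteq> K \<Longrightarrow> normalizes K' A"
  unfolding normalizes_def by blast

lemma normalizes_self: "subgroup A G \<Longrightarrow> normalizes A A"
  unfolding normalizes_def by (simp add: subgroup.m_closed subgroup.m_inv_closed)

lemma commutes_sym: "commutes A B \<Longrightarrow> commutes B A"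
  unfolding commutes_def by metis

lemma commutes_mono: "commutes A B \<Longrightarrow> A' \<subseteq> A \<Longrightarrow> B' \<subseteq> B \<Longrightarrow> commutes A' B'"
  unfolding commutes_def by blast

lemma commutes_normalizes:
  assumes "commutes A B" "A \<subseteq> carrier G" "B \<subseteq> carrier G"
  shows "normalizes A B"
  unfolding normalizes_def
proof (intro ballI)
  fix a b assume "a \<in> A" "b \<in> B"
  then have "a \<otimes> b \<otimes> inv a = b"
    using assms unfolding commutes_def by (metis inv_solve_right' m_closed subsetD)
  then show "a \<otimes> b \<otimes> inv a \<in> B" using \<open>b \<in> B\<close> by simp
qed

lemma prod_mem_set_mult: "a \<in> A \<Longrightarrow> b \<in> B \<Longrightarrow> a \<otimes> b \<in> A <#> B"
  unfolding set_mult_def by auto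

lemma sub_set_mult:
  assumes "subgroup A G" "subgroup B G" "normalizes B A"
  shows "subgroup (A <#> B) G"
proof (rule subgroupI)
  show "A <#> B \<subseteq> carrier G" using assms subgroup.subset set_mult_closed by metis
  show "A <#> B \<noteq> {}" using assms prod_mem_set_mult subgroup.one_closed by (metis empty_iff)
next
  fix x assume "x \<in> A <#> B"
  then obtain a b where x: "a \<in> A" "b \<in> B" "x = a \<otimes> b" unfolding set_mult_def by auto
  have "inv x = (inv b \<otimes> inv a \<otimes> b) \<otimes> inv b"
    using x sub_mem assms by (simp add: inv_mult_group m_assoc)
  moreover have "inv b \<otimes> inv a \<otimes> b \<in> A"
    using normalizesD'[OF assms(2,3)] x assms subgroup.m_inv_closed by metis
  ultimately show "inv x \<in> A <#> B" using prod_mem_set_mult x assms subgroup.m_inv_closed by metis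
next
  fix x y assume "x \<in> A <#> B" "y \<in> A <#> B"
  then obtain a b c d where x: "a \<in> A" "b \<in> B" "x = a \<otimes> b" "c \<in> A" "d \<in> B" "y = c \<otimes> d"
    unfolding set_mult_def by auto
  have "x \<otimes> y = (a \<otimes> (b \<otimes> c \<otimes> inv b)) \<otimes> (b \<otimes> d)"
    using x sub_mem[OF assms(1)] sub_mem[OF assms(2)] by (simp add: group_word_simps)
  moreover have "b \<otimes> c \<otimes> inv b \<in> A" using normalizesD assms x by blast
  ultimately show "x \<otimes> y \<in> A <#> B"
    using x prod_mem_set_mult subgroup.m_closed assms by metis
qed

lemma set_mult_upper:
  assumes "subgroup A G" "subgroup B G"
  shows "A \<subseteq> A <#> B" "B \<subseteq> A <#> B"
proof -
  have "a \<in> A <#> B" if "a \<in> A" for a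
    using prod_mem_set_mult[OF that subgroup.one_closed[OF assms(2)]] sub_mem assms that by simp
  then show "A \<subseteq> A <#> B" by blast
  have "b \<in> A <#> B" if "b \<in> B" for b
    using prod_mem_set_mult[OF subgroup.one_closed[OF assms(1)] that] sub_mem assms that by simp
  then show "B \<subseteq> A <#> B" by blast
qed

lemma set_mult_least: "subgroup C G \<Longrightarrow> A \<subseteq> C \<Longrightarrow> B \<subseteq> C \<Longrightarrow> A <#> B \<subseteq> C"
  by (auto simp: set_mult_def intro!: subgroup.m_closed)

text \<open>All fibres of the map (a, b) to a b over \<open>A <#> B\<close> have the same size: the
  pairs with the same product as (a, b) are the (a c, c^-1 b) with c in \<open>A \<inter> B\<close>.
  The product may be a mere set, as happens for double cosets later.\<close>

lemma card_set_mult: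
  assumes "subgroup A G" "subgroup B G"
  shows "card (A <#> B) * card (A \<inter> B) = card A * card B"
proof -
  let ?m = "\<lambda>(a, b). a \<otimes> b"
  have im: "A <#> B = ?m ` (A \<times> B)" unfolding set_mult_def by force
  have fib: "card {z \<in> A \<times> B. ?m z = y} = card (A \<inter> B)" if y: "y \<in> A <#> B" for y
  proof -
    obtain a b where ab: "a \<in> A" "b \<in> B" "y = a \<otimes> b" using y unfolding set_mult_def by auto
    note mem = sub_mem[OF assms(1)] sub_mem[OF assms(2)]
    have "bij_betw (\<lambda>c. (a \<otimes> c, inv c \<otimes> b)) (A \<inter> B) {z \<in> A \<times> B. ?m z = y}"
    proof (rule bij_betwI')
      fix c d assume "c \<in> A \<inter> B" "d \<in> A \<inter> B"
      then show "((a \<otimes> c, inv c \<otimes> b) = (a \<otimes> d, inv d \<otimes> b)) = (c = d)"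
        using ab mem by auto
    next
      fix c assume c: "c \<in> A \<inter> B"
      then have "a \<otimes> c \<otimes> (inv c \<otimes> b) = a \<otimes> b"
        using ab mem by (simp add: group_word_simps)
      then show "(a \<otimes> c, inv c \<otimes> b) \<in> {z \<in> A \<times> B. ?m z = y}"
        using ab assms subgroup.m_closed subgroup.m_inv_closed c by fastforce
    next
      fix z assume "z \<in> {z \<in> A \<times> B. ?m z = y}"
      then obtain a' b' where z: "z = (a', b')" "a' \<in> A" "b' \<in> B" "a' \<otimes> b' = a \<otimes> b"
        using ab by auto
      have "inv a \<otimes> a' = inv a \<otimes> (a' \<otimes> b') \<otimes> inv b'"
        using z(2,3) ab mem by (simp add: group_word_simps)
      also have "\<dots> = b \<otimes> inv b'"
        unfolding z(4) using z(2,3) ab mem by (simp add: group_word_simps)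
      finally have e: "inv a \<otimes> a' = b \<otimes> inv b'" .
      have 1: "inv a \<otimes> a' \<in> A" using z ab assms subgroup.m_closed subgroup.m_inv_closed by metis
      have 2: "inv a \<otimes> a' \<in> B" unfolding e using z ab assms subgroup.m_closed subgroup.m_inv_closed by metis
      have 3: "a' = a \<otimes> (inv a \<otimes> a')" using z ab mem by (simp add: group_word_simps)
      have 4: "b' = inv (inv a \<otimes> a') \<otimes> b" unfolding e
        using z ab mem by (simp add: group_word_simps)
      show "\<exists>c\<in>A \<inter> B. z = (a \<otimes> c, inv c \<otimes> b)"
        using 1 2 3 4 z by blast
    qed
    then show ?thesis by (rule bij_betw_same_card[symmetric])
  qed
  have fAB: "finite (A \<times> B)" using assms by blast
  have "card (A \<times> B) = (\<Sum>y\<in>?m ` (A \<times> B). card {z \<in> A \<times> B. ?m z = y})"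
    unfolding card_eq_sum by (rule sum.image_gen[OF fAB])
  also have "\<dots> = card (A <#> B) * card (A \<inter> B)" using fib im by (simp cong: sum.cong)
  finally show ?thesis by (simp add: card_cartesian_product)
qed

lemma pow_sub: "subgroup N G \<Longrightarrow> x \<in> N \<Longrightarrow> x [^] (k::nat) \<in> N"
  by (induction k) (auto simp: subgroup.one_closed subgroup.m_closed)

lemma pow_coprime_mem:
  assumes N: "subgroup N G" and x: "x \<in> carrier G" "x [^] (a::nat) \<in> N" "x [^] (b::nat) \<in> N"
    and "coprime a b"
  shows "x \<in> N"
proof (cases "b = 0")
  case True
  \<comment> \<open>Being coprime to 0 forces \<open>a\<close> to be 1.\<close>
  then show ?thesis using assms by auto
next
  case False
  \<comment> \<open>Bezout's relation is kept in the form 1 + b v = a u + b w, since the exponents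
    are natural numbers.\<close>
  obtain u where "[a * u = Suc 0] (mod b)" using cong_solve_coprime_nat assms(5) by blast
  then obtain v w where vw: "Suc 0 + b * v = a * u + b * w"
    by (metis cong_iff_lin_nat cong_sym mult.commute)
  let ?r = "(x [^] a) [^] u \<otimes> (x [^] b) [^] w \<otimes> inv ((x [^] b) [^] v)"
  have "x [^] Suc 0 \<otimes> x [^] (b * v) = x [^] (a * u) \<otimes> x [^] (b * w)"
    using vw x(1) by (simp only: nat_pow_mult)
  then have "x \<otimes> (x [^] b) [^] v = (x [^] a) [^] u \<otimes> (x [^] b) [^] w"
    using x(1) by (simp add: nat_pow_pow)
  then have "x = ?r"
    using x(1) inv_solve_right[of x "(x [^] a) [^] u \<otimes> (x [^] b) [^] w" "(x [^] b) [^] v"] by simp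
  moreover have "?r \<in> N"
    by (intro subgroup.m_closed[OF N] subgroup.m_inv_closed[OF N] pow_sub[OF N] x)
  ultimately show ?thesis by simp
qed

lemma pow_index_mem:
  assumes "subgroup N G" "subgroup S G" "N \<subseteq> S" "normalizes S N" "x \<in> S"
  shows "x [^] (card S div card N) \<in> N"
proof -
  interpret S: finite_group "G\<lparr>carrier := S\<rparr>" using assms finite_group_sub by blast
  interpret N: normal N "G\<lparr>carrier := S\<rparr>" using assms normal_restrict_iff by blast
  interpret Q: group "(G\<lparr>carrier := S\<rparr>) Mod N" by (rule N.factorgroup_is_group)
  have "order ((G\<lparr>carrier := S\<rparr>) Mod N) * card N = card S"
    using S.lagrange[OF N.subgroup_axioms] by (simp add: order_def FactGroup_def)
  then have o: "order ((G\<lparr>carrier := S\<rparr>) Mod N) = card S div card N"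
    using card_sub_pos[OF assms(1)] by (metis nonzero_mult_div_cancel_right less_numeral_extra(3))
  have c: "N #> x \<in> carrier ((G\<lparr>carrier := S\<rparr>) Mod N)"
    using assms(5) by (auto simp: carrier_FactGroup)
  have "N #> (x [^] (card S div card N)) = N"
    using Q.pow_order_eq_1[OF c] N.FactGroup_pow[of x] assms(5)
    by (simp add: o nat_pow_consistent[symmetric])
  then show ?thesis
    using coset_join1[OF _ nat_pow_closed[OF sub_mem[OF assms(2,5)]] assms(1)] by blast
qed

lemma pow_card_eq_one: "subgroup S G \<Longrightarrow> x \<in> S \<Longrightarrow> x [^] card S = \<one>"
  using group.pow_order_eq_1[OF subgroup_imp_group, of S x]
  by (simp add: order_def nat_pow_consistent[symmetric])

text \<open>In \<open>S / N\<close> the order of the image of \<open>x\<close> divides both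
  \<open>k\<close> and the index. Many computations in quotient groups are replaced by this.\<close>

lemma coprime_index_mem:
  assumes "subgroup N G" "subgroup S G" "N \<subseteq> S" "normalizes S N" "x \<in> S" "x [^] (k::nat) \<in> N"
    "coprime k (card S div card N)"
  shows "x \<in> N"
  using pow_coprime_mem[OF assms(1) _ assms(6) pow_index_mem[OF assms(1-5)] assms(7)] sub_mem assms
  by blast

end

section \<open>Sylow subgroups\<close>

context finite_group
begin

lemma pi_subgroup_iff: "pi_subgroup \<sigma> H G \<longleftrightarrow> subgroup H G \<and> pi_number \<sigma> (card H)"
  unfolding pi_subgroup_def pi_number_def using card_sub_pos by blast

text \<open>In a finite group inverses are positive powers, so closure under products
  suffices.\<close>

lemma sub_finiteI:
  assumes "A \<subseteq> carrier G" "a \<in> A" "\<And>x y. x \<in> A \<Longrightarrow> y \<in> A \<Longrightarrow> x \<otimes> y \<in> A"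
  shows "subgroup A G"
proof (rule subgroupI)
  fix x assume x: "x \<in> A"
  then have xc: "x \<in> carrier G" using assms by blast
  have pw: "x [^] Suc k \<in> A" for k
    using x assms(3) xc by (induction k) auto
  \<comment> \<open>Doubling the order keeps the exponent at least 2 even in the trivial group, so
    the power that equals \<open>inv x\<close> has a positive exponent and lies in \<open>A\<close>
    by closure alone.\<close>
  obtain k where k: "2 * order G = Suc (Suc k)"
    using order_pos by (metis Suc_pred add_Suc_right add_Suc mult_2)
  have "x [^] (2 * order G) = \<one>"
    using xc pow_order_eq_1 by (metis mult.commute nat_pow_one nat_pow_pow)
  then have "x [^] Suc k \<otimes> x = \<one>" unfolding k by (simp add: xc)
  then have "inv x = x [^] Suc k" using xc inv_equality nat_pow_closed by metis
  then show "inv x \<in> A" using pw by simp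
qed (use assms in auto)

section \<open>Conjugates and normalizers\<close>

lemma conj_conj:
  assumes "g \<in> carrier G" "h \<in> carrier G" "A \<subseteq> carrier G"
  shows "conj_set g (conj_set h A) = conj_set (g \<otimes> h) A"
  unfolding conj_set_def image_image
  by (rule image_cong) (use assms in \<open>auto simp: group_word_simps subset_iff\<close>)

lemma conj_one: "A \<subseteq> carrier G \<Longrightarrow> conj_set \<one> A = A"
  unfolding conj_set_def by (auto simp: subset_iff image_iff)

lemma conj_inv_conj:
  assumes "g \<in> carrier G" "A \<subseteq> carrier G"
  shows "conj_set (inv g) (conj_set g A) = A" "conj_set g (conj_set (inv g) A) = A"
  using assms by (auto simp: conj_conj conj_one)

lemma conj_mono: "A \<subseteq> B \<Longrightarrow> conj_set g A \<subseteq> conj_set g B"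
  unfolding conj_set_def by blast

lemma card_conj:
  assumes "g \<in> carrier G" "A \<subseteq> carrier G"
  shows "card (conj_set g A) = card A"
  unfolding conj_set_def
proof (rule card_image, rule inj_onI)
  fix x y assume xy: "x \<in> A" "y \<in> A" "g \<otimes> x \<otimes> inv g = g \<otimes> y \<otimes> inv g"
  then have "x \<in> carrier G" "y \<in> carrier G" using assms by auto
  then show "x = y" using xy assms by simp
qed

lemma conj_eq_lr: "A \<subseteq> carrier G \<Longrightarrow> g \<in> carrier G \<Longrightarrow> g <# A #> inv g = conj_set g A"
  unfolding conj_set_def l_coset_def r_coset_def by auto

lemma sub_conj:
  assumes "g \<in> carrier G" "subgroup A G"
  shows "subgroup (conj_set g A) G"
  using subgroup_conjugation_is_surj2[OF assms] assms by (simp add: conj_eq_lr subgroup.subset)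

lemma pi_sub_conj: "g \<in> carrier G \<Longrightarrow> pi_subgroup \<sigma> A G \<Longrightarrow> pi_subgroup \<sigma> (conj_set g A) G"
  unfolding pi_subgroup_iff by (simp add: sub_conj card_conj subgroup.subset)

lemma conj_sub_eq:
  assumes "g \<in> carrier G" "A \<subseteq> carrier G" "B \<subseteq> carrier G" "card A = card B" "conj_set g A \<subseteq> B"
  shows "conj_set g A = B"
  using assms by (simp add: card_conj card_subset_eq finite_subset[OF _ fin_carrier])

text \<open>\<open>normalizer\<close> is the stabilizer of \<open>A\<close> under conjugation and
  asks for equality of sets; finiteness reduces this to an inclusion.\<close>

lemma mem_normalizer:
  assumes "subgroup A G"
  shows "g \<in> normalizer G A \<longleftrightarrow> g \<in> carrier G \<and> (\<forall>a\<in>A. g \<otimes> a \<otimes> inv g \<in> A)"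
proof -
  have sub: "A \<subseteq> carrier G" using assms subgroup.subset by blast
  have "conj_set g A = A \<longleftrightarrow> (\<forall>a\<in>A. g \<otimes> a \<otimes> inv g \<in> A)" if "g \<in> carrier G"
  proof
    assume "\<forall>a\<in>A. g \<otimes> a \<otimes> inv g \<in> A"
    then have "conj_set g A \<subseteq> A" unfolding conj_set_def by blast
    then show "conj_set g A = A" using conj_sub_eq that sub by blast
  qed (auto simp: conj_set_def)
  moreover have "g \<in> normalizer G A \<longleftrightarrow> g \<in> carrier G \<and> g <# A #> inv g = A"
    unfolding normalizer_def stabilizer_def using sub by simp
  ultimately show ?thesis using conj_eq_lr[OF sub] by (cases "g \<in> carrier G") simp_all
qed

lemma mem_normalizer_conj:
  assumes "subgroup A G"
  shows "g \<in> normalizer G A \<longleftrightarrow> g \<in> carrier G \<and> conj_set g A = A"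
  unfolding mem_normalizer[OF assms] using conj_sub_eq[of g A A] subgroup.subset[OF assms]
  by (auto simp: conj_set_def)

lemma sub_normalizer: "subgroup A G \<Longrightarrow> subgroup (normalizer G A) G"
  using normalizer_imp_subgroup subgroup.subset by blast

lemma normalizer_normalizes: "subgroup A G \<Longrightarrow> normalizes (normalizer G A) A"
  unfolding normalizes_def by (simp add: mem_normalizer)

lemma normalizes_le_normalizer:
  "subgroup A G \<Longrightarrow> B \<subseteq> carrier G \<Longrightarrow> normalizes B A \<Longrightarrow> B \<subseteq> normalizer G A"
  unfolding normalizes_def by (auto simp: mem_normalizer)

lemma le_normalizer: "subgroup A G \<Longrightarrow> A \<subseteq> normalizer G A"
  by (simp add: normalizes_le_normalizer normalizes_self subgroup.subset)

lemma normal_iff_normalizer: "subgroup A G \<Longrightarrow> A \<lhd> G \<longleftrightarrow> normalizer G A = carrier G"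
  unfolding normal_iff normalizes_def using mem_normalizer[of A] by blast

text \<open>The elements \<open>g\<close> with \<open>g S g\<^sup>-\<^sup>1 \<subseteq> P\<close> are the fixed points of \<open>S\<close> on the cosets \<open>P g\<close>; the
  other double cosets \<open>P g S\<close> have order divisible by \<open>p |P|\<close>.\<close>
lemma dvd_card_nonfixed:
  assumes p: "prime p" and P: "subgroup P G" and S: "pi_subgroup {p} S G" and K: "subgroup K G"
    and PK: "P \<subseteq> K" and SK: "S \<subseteq> K"
  shows "p * card P dvd card {g \<in> K. \<not> conj_set g S \<subseteq> P}"
proof -
  let ?N = "{g \<in> K. \<not> conj_set g S \<subseteq> P}"
  define D where "D g = (\<lambda>(a, b). a \<otimes> g \<otimes> b) ` (P \<times> S)" for g
  have sS: "subgroup S G" using S pi_subgroup_iff by blast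
  note mem = sub_mem[OF P] sub_mem[OF sS] sub_mem[OF K]
  have DI: "a \<otimes> g \<otimes> b \<in> D g" if "a \<in> P" "b \<in> S" for a b g unfolding D_def using that by force
  have D_self: "g \<in> D g" if "g \<in> carrier G" for g
    using DI[of \<one> \<one> g] subgroup.one_closed[OF P] subgroup.one_closed[OF sS] that by simp
  have D_sub: "D z \<subseteq> D g" if z: "z \<in> D g" and g: "g \<in> carrier G" for z g
  proof
    fix y assume "y \<in> D z"
    then obtain c d where y: "y = c \<otimes> z \<otimes> d" "c \<in> P" "d \<in> S" unfolding D_def by auto
    obtain a b where z: "z = a \<otimes> g \<otimes> b" "a \<in> P" "b \<in> S" using z unfolding D_def by auto
    have "y = (c \<otimes> a) \<otimes> g \<otimes> (b \<otimes> d)" using y z g mem by (simp add: group_word_simps)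
    then show "y \<in> D g" using DI y z subgroup.m_closed[OF P] subgroup.m_closed[OF sS] by simp
  qed
  have D_sym: "g \<in> D z" if z: "z \<in> D g" and g: "g \<in> carrier G" for z g
  proof -
    obtain a b where z: "z = a \<otimes> g \<otimes> b" "a \<in> P" "b \<in> S" using z unfolding D_def by auto
    have "g = inv a \<otimes> z \<otimes> inv b" using z g mem by (simp add: group_word_simps)
    then show ?thesis
      using DI[OF subgroup.m_inv_closed[OF P z(2)] subgroup.m_inv_closed[OF sS z(3)], of z] by simp
  qed
  have D_car: "D g \<subseteq> carrier G" if "g \<in> carrier G" for g unfolding D_def using that mem by auto
  have D_K: "D g \<subseteq> K" if "g \<in> K" for g
    unfolding D_def using that PK SK by (auto intro!: subgroup.m_closed[OF K])
  have D_N: "D g \<subseteq> ?N" if g: "g \<in> ?N" for g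
  proof (intro subsetI CollectI conjI notI)
    fix z assume z: "z \<in> D g"
    then show "z \<in> K" using D_K g by blast
    assume c: "conj_set z S \<subseteq> P"
    obtain a b where ab: "z = a \<otimes> g \<otimes> b" "a \<in> P" "b \<in> S" using z unfolding D_def by auto
    have "g \<otimes> s \<otimes> inv g \<in> P" if s: "s \<in> S" for s
    proof -
      have "inv b \<otimes> s \<otimes> b \<in> S"
        using s ab by (intro subgroup.m_closed[OF sS] subgroup.m_inv_closed[OF sS])
      then have "z \<otimes> (inv b \<otimes> s \<otimes> b) \<otimes> inv z \<in> P" using c unfolding conj_set_def by blast
      from subgroup.m_closed[OF P subgroup.m_closed[OF P subgroup.m_inv_closed[OF P ab(2)] this] ab(2)]
      have "inv a \<otimes> (z \<otimes> (inv b \<otimes> s \<otimes> b) \<otimes> inv z) \<otimes> a \<in> P" .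
      moreover have "inv a \<otimes> (z \<otimes> (inv b \<otimes> s \<otimes> b) \<otimes> inv z) \<otimes> a = g \<otimes> s \<otimes> inv g"
        using ab s g mem by (simp add: group_word_simps)
      ultimately show ?thesis by simp
    qed
    then have "conj_set g S \<subseteq> P" unfolding conj_set_def by blast
    then show False using g by blast
  qed
  have D_card: "p * card P dvd card (D g)" if g: "g \<in> ?N" for g
  proof -
    have gc: "g \<in> carrier G" using g mem by blast
    let ?S = "conj_set g S"
    have s': "subgroup ?S G" using sub_conj gc sS by blast
    \<comment> \<open>A double coset is a translate of the product of \<open>P\<close> with the
      conjugate of \<open>S\<close>, so the product formula gives its size as \<open>card P\<close>
      times the index of \<open>P \<inter> ?S\<close> in \<open>?S\<close>. That index is a power of
      p other than 1.\<close>
    have "D g = (\<lambda>x. x \<otimes> g) ` (P <#> ?S)"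
    proof -
      have "D g = (\<lambda>(a, b). (a \<otimes> (g \<otimes> b \<otimes> inv g)) \<otimes> g) ` (P \<times> S)"
        unfolding D_def by (rule image_cong) (use gc mem in \<open>auto simp: group_word_simps\<close>)
      also have "\<dots> = (\<lambda>x. x \<otimes> g) ` (P <#> ?S)"
        unfolding set_mult_def conj_set_def by force
      finally show ?thesis .
    qed
    moreover have "inj_on (\<lambda>x. x \<otimes> g) (P <#> ?S)"
      using setmult_subset_G[OF subgroup.subset[OF P] subgroup.subset[OF s']] gc
      by (intro inj_onI) (metis r_cancel subsetD)
    ultimately have c1: "card (D g) = card (P <#> ?S)" by (simp add: card_image)
    have c2: "card (P <#> ?S) * card (P \<inter> ?S) = card P * card S"
      using card_set_mult[OF P s'] card_conj[OF gc subgroup.subset[OF sS]] by simp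
    have i: "subgroup (P \<inter> ?S) G" using P s' sub_Int by blast
    have "card (P \<inter> ?S) dvd card S"
      using card_sub_dvd[OF i s'] card_conj[OF gc subgroup.subset[OF sS]] by simp
    then obtain m where m: "card S = card (P \<inter> ?S) * m" by (metis dvdE)
    have "m \<noteq> 1"
    proof
      assume "m = 1"
      then have "P \<inter> ?S = ?S"
        using sub_eqI[OF i s'] m card_conj[OF gc subgroup.subset[OF sS]] by simp
      then show False using g by blast
    qed
    moreover have "pi_number {p} m" using S m unfolding pi_subgroup_iff by (metis dvd_triv_right pi_number_dvd)
    ultimately have "p dvd m" using prime_factor_nat unfolding pi_number_def by blast
    then obtain m' where m': "m = p * m'" by (metis dvdE)
    have "card (P \<inter> ?S) > 0" using card_sub_pos i by blast
    moreover have "card (D g) * card (P \<inter> ?S) = (p * card P * m') * card (P \<inter> ?S)"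
      using c1 c2 m m' by (simp add: algebra_simps)
    ultimately have "card (D g) = p * card P * m'" by simp
    then show ?thesis by simp
  qed
  have un: "?N = \<Union>(D ` ?N)"
  proof (rule subset_antisym)
    show "\<Union>(D ` ?N) \<subseteq> ?N" by (rule UN_least) (rule D_N)
    show "?N \<subseteq> \<Union>(D ` ?N)" using D_self mem(3) by (intro subsetI UN_I) auto
  qed
  have finN: "finite ?N" using finite_sub[OF K] by simp
  have "p * card P dvd card (\<Union>(D ` ?N))"
  proof (rule dvd_partition)
    show "finite (\<Union>(D ` ?N))" unfolding un[symmetric] by (rule finN)
    show "\<forall>c\<in>D ` ?N. p * card P dvd card c" using D_card by blast
    show "\<forall>c1\<in>D ` ?N. \<forall>c2\<in>D ` ?N. c1 \<noteq> c2 \<longrightarrow> c1 \<inter> c2 = {}"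
    proof (intro ballI impI)
      fix c1 c2 assume c: "c1 \<in> D ` ?N" "c2 \<in> D ` ?N" "c1 \<noteq> c2"
      then obtain g h where gh: "c1 = D g" "c2 = D h" "g \<in> carrier G" "h \<in> carrier G" using mem by blast
      show "c1 \<inter> c2 = {}"
      proof (rule ccontr)
        assume "c1 \<inter> c2 \<noteq> {}"
        then obtain z where z: "z \<in> D g" "z \<in> D h" using gh by blast
        then have zc: "z \<in> carrier G" using D_car[OF gh(3)] by blast
        have "D g = D z"
          by (rule subset_antisym[OF D_sub[OF D_sym[OF z(1) gh(3)] zc] D_sub[OF z(1) gh(3)]])
        moreover have "D h = D z"
          by (rule subset_antisym[OF D_sub[OF D_sym[OF z(2) gh(4)] zc] D_sub[OF z(2) gh(4)]])
        ultimately have "D g = D h" by simp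
        then show False using c gh by simp
      qed
    qed
  qed
  then show ?thesis unfolding un[symmetric] .
qed

section \<open>Sylow's theorems and growth of normalizers in p-groups\<close>

lemma sylow_iff:
  assumes "prime p"
  shows "sylow_subgroup p P G \<longleftrightarrow>
    subgroup P G \<and> pi_number {p} (card P) \<and> \<not> p dvd order G div card P"
proof -
  let ?k = "multiplicity p (order G)"
  have nu: "\<not> is_unit p" using assms not_prime_unit by blast
  obtain m where m: "order G = p ^ ?k * m" "\<not> p dvd m"
    using multiplicity_decompose'[of "order G" p] order_pos nu by (metis less_numeral_extra(3))
  have p0: "p ^ n > 0" for n using assms prime_gt_0_nat by simp
  show ?thesis
  proof
    assume s: "sylow_subgroup p P G"
    then have c: "card P = p ^ ?k" unfolding sylow_subgroup_def by blast
    have "order G div card P = m" using m(1) c p0 by (metis nonzero_mult_div_cancel_left less_numeral_extra(3))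
    then show "subgroup P G \<and> pi_number {p} (card P) \<and> \<not> p dvd order G div card P"
      using s m(2) c pi_number_prime_power[OF assms] unfolding sylow_subgroup_def by metis
  next
    assume a: "subgroup P G \<and> pi_number {p} (card P) \<and> \<not> p dvd order G div card P"
    then obtain j where j: "card P = p ^ j" using pi_number_primeE[OF assms] by blast
    have "order G = p ^ j * (order G div card P)"
      using card_dvd_order[of P] a j by simp
    then obtain q where q: "order G = p ^ j * q" "\<not> p dvd q" using a by blast
    have "multiplicity p (p ^ j * q) = j"
    proof (rule multiplicity_eqI)
      show "\<not> p ^ Suc j dvd p ^ j * q" using q(2) p0[of j] by (simp add: mult.commute[of p])
    qed simp
    then have "?k = j" using q by simp
    then show "sylow_subgroup p P G" unfolding sylow_subgroup_def using a j by simp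
  qed
qed

lemma sylow_exists:
  assumes "prime p"
  obtains P where "sylow_subgroup p P G"
proof -
  obtain m where "order G = p ^ multiplicity p (order G) * m" using multiplicity_dvd by (metis dvdE)
  from sylow_thm[OF assms is_group this fin_carrier] show thesis
    using that unfolding sylow_subgroup_def by blast
qed

lemma sylowD:
  assumes "prime p" "sylow_subgroup p P G"
  shows "subgroup P G" "pi_subgroup {p} P G" "\<not> p dvd order G div card P"
  using assms by (auto simp: sylow_iff pi_subgroup_iff)

text \<open>If no conjugate of \<open>S\<close> lay in \<open>P\<close>, every element of
  \<open>G\<close> would be non-fixed, and p times \<open>card P\<close> would divide the order of
  \<open>G\<close>.\<close>

lemma sylow_contains_conj:
  assumes p: "prime p" and P: "sylow_subgroup p P G" and S: "pi_subgroup {p} S G"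
  obtains g where "g \<in> carrier G" "conj_set g S \<subseteq> P"
proof -
  have sP: "subgroup P G" and sS: "subgroup S G" using sylowD[OF p P] S pi_subgroup_iff by auto
  have "\<exists>g\<in>carrier G. conj_set g S \<subseteq> P"
  proof (rule ccontr)
    assume "\<not> ?thesis"
    then have "{g \<in> carrier G. \<not> conj_set g S \<subseteq> P} = carrier G" by blast
    then have "p * card P dvd order G"
      using dvd_card_nonfixed[OF p sP S subgroup_self] sP sS subgroup.subset unfolding order_def by metis
    then have "p dvd order G div card P"
      using card_sub_pos[OF sP] card_dvd_order[OF sP]
      by (metis dvd_div_iff_mult less_numeral_extra(3))
    then show False using sylowD[OF p P] by blast
  qed
  then show thesis using that by blast
qed

lemma card_sylow:
  "sylow_subgroup p P G \<Longrightarrow> sylow_subgroup p Q G \<Longrightarrow> card P = card Q"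
  unfolding sylow_subgroup_def by simp

lemma sylow_conj: "g \<in> carrier G \<Longrightarrow> sylow_subgroup p P G \<Longrightarrow> sylow_subgroup p (conj_set g P) G"
  unfolding sylow_subgroup_def by (simp add: sub_conj card_conj subgroup.subset)

lemma sylow_conjugate:
  assumes p: "prime p" and P: "sylow_subgroup p P G" and Q: "sylow_subgroup p Q G"
  obtains g where "g \<in> carrier G" "conj_set g Q = P"
proof -
  obtain g where g: "g \<in> carrier G" "conj_set g Q \<subseteq> P"
    using sylow_contains_conj[OF p P] sylowD[OF p Q] by blast
  then have "conj_set g Q = P"
    using conj_sub_eq card_sylow[OF P Q] sylowD[OF p P] sylowD[OF p Q] subgroup.subset by metis
  then show thesis using that g by blast
qed

lemma sylow_above:
  assumes p: "prime p" and S: "pi_subgroup {p} S G"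
  obtains P where "sylow_subgroup p P G" "S \<subseteq> P"
proof -
  obtain P where P: "sylow_subgroup p P G" using sylow_exists p by blast
  obtain g where g: "g \<in> carrier G" "conj_set g S \<subseteq> P" using sylow_contains_conj[OF p P S] by blast
  have "S \<subseteq> carrier G" using S subgroup.subset unfolding pi_subgroup_iff by blast
  then have "S \<subseteq> conj_set (inv g) P" using conj_mono[OF g(2), of "inv g"] conj_inv_conj g by simp
  then show thesis using that sylow_conj[OF _ P] g by blast
qed

lemma normal_le_sylow:
  assumes p: "prime p" and P: "sylow_subgroup p P G" and N: "pi_subgroup {p} N G" "N \<lhd> G"
  shows "N \<subseteq> P"
proof -
  obtain g where g: "g \<in> carrier G" "conj_set g N \<subseteq> P" using sylow_contains_conj[OF p P N(1)] by blast
  have sN: "subgroup N G" using N pi_subgroup_iff by blast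
  have "conj_set g N = N" using N g mem_normalizer_conj[OF sN] normal_iff_normalizer[OF sN] by blast
  then show ?thesis using g by simp
qed

text \<open>The same count inside \<open>R\<close>, with \<open>Q\<close> in both roles: the fixed
  elements form \<open>R \<inter> normalizer G Q\<close>, and their number, like that of all
  elements of \<open>R\<close>, is divisible by p times \<open>card Q\<close>.\<close>

lemma normalizer_grows:
  assumes p: "prime p" and R: "pi_subgroup {p} R G" and Q: "subgroup Q G" "Q \<subset> R"
  shows "Q \<subset> R \<inter> normalizer G Q"
proof -
  have sR: "subgroup R G" using R pi_subgroup_iff by blast
  have "card Q dvd card R" using card_sub_dvd Q sR by blast
  then obtain m where m: "card R = card Q * m" by (metis dvdE)
  have pm: "pi_number {p} m" "pi_number {p} (card Q)"
    using R m unfolding pi_subgroup_iff by (metis dvd_triv_right dvd_triv_left pi_number_dvd)+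
  have "m \<noteq> 1" using sub_eqI[OF Q(1) sR] Q m by auto
  then have "p dvd m" using pm(1) prime_factor_nat unfolding pi_number_def by blast
  then have 1: "p * card Q dvd card R" using m by (metis mult.commute mult_dvd_mono dvd_refl)
  have 2: "p * card Q dvd card {g \<in> R. \<not> conj_set g Q \<subseteq> Q}"
    using dvd_card_nonfixed[OF p Q(1) _ sR] pm Q pi_subgroup_iff by blast
  have N: "R \<inter> normalizer G Q = {g \<in> R. conj_set g Q \<subseteq> Q}"
    using sub_mem[OF sR] by (auto simp: mem_normalizer[OF Q(1)] conj_set_def image_subset_iff)
  have "card R = card (R \<inter> normalizer G Q) + card {g \<in> R. \<not> conj_set g Q \<subseteq> Q}"
    unfolding N using finite_sub[OF sR]
    by (subst card_Un_disjoint[symmetric]) (auto intro!: arg_cong[where f = card])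
  then have "card (R \<inter> normalizer G Q) = card R - card {g \<in> R. \<not> conj_set g Q \<subseteq> Q}" by simp
  then have "p * card Q dvd card (R \<inter> normalizer G Q)" using dvd_diff_nat[OF 1 2] by simp
  moreover have "\<not> p * card Q dvd card Q"
    using card_sub_pos[OF Q(1)] p prime_gt_1_nat[OF p] by (auto dest!: dvd_imp_le)
  ultimately have "R \<inter> normalizer G Q \<noteq> Q" by auto
  then show ?thesis using le_normalizer[OF Q(1)] Q by blast
qed

text \<open>\<open>W\<close> is chosen maximal among the proper subgroups of \<open>P\<close> above
  \<open>V\<close>. Growth of normalizers makes it normal in \<open>P\<close>, and a quotient
  without proper nontrivial subgroups is abelian.\<close>

lemma abelian_quotient_above:
  assumes p: "prime p" and P: "pi_subgroup {p} P G" and V: "subgroup V G" "V \<subset> P"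
  obtains W where "subgroup W G" "V \<subseteq> W" "W \<subset> P" "normalizes P W"
    "\<forall>x\<in>P. \<forall>y\<in>P. x \<otimes> y \<otimes> inv x \<otimes> inv y \<in> W"
proof -
  have sP: "subgroup P G" using P pi_subgroup_iff by blast
  let ?A = "{W. subgroup W G \<and> V \<subseteq> W \<and> W \<subset> P}"
  have "finite ?A" by (rule finite_subset[of _ "Pow P"]) (use finite_sub[OF sP] in auto)
  moreover have "V \<in> ?A" using V by blast
  ultimately obtain W where W: "W \<in> ?A" and max: "\<And>U. U \<in> ?A \<Longrightarrow> W \<subseteq> U \<Longrightarrow> W = U"
    using finite_has_maximal[of ?A] by (metis (no_types, lifting) empty_iff)
  have sW: "subgroup W G" using W by blast
  have top: "U = P" if "subgroup U G" "W \<subset> U" "U \<subseteq> P" for U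
    using max[of U] that W by blast
  have "P \<inter> normalizer G W = P"
    using top[of "P \<inter> normalizer G W"] normalizer_grows[OF p P sW] W sub_Int sP sub_normalizer[OF sW] by blast
  then have nrm: "normalizes P W" using normalizer_normalizes[OF sW] normalizes_mono by blast
  note mem = sub_mem[OF sP] sub_mem[OF sW]
  have "x \<otimes> y \<otimes> inv x \<otimes> inv y \<in> W" if x: "x \<in> P" and y: "y \<in> P" for x y
  proof (cases "x \<in> W")
    case True
    have "y \<otimes> inv x \<otimes> inv y \<in> W"
      using normalizesD[OF nrm y] True subgroup.m_inv_closed[OF sW] by blast
    then have "x \<otimes> (y \<otimes> inv x \<otimes> inv y) \<in> W" using True subgroup.m_closed[OF sW] by blast
    then show ?thesis using x y mem by (simp add: group_word_simps)
  next
    case False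
    \<comment> \<open>The centralizer of \<open>x\<close> modulo \<open>W\<close>. It contains
      \<open>W\<close> and also \<open>x\<close>, which lies outside \<open>W\<close>; by maximality
      it is all of \<open>P\<close>.\<close>
    let ?T = "{t \<in> P. x \<otimes> t \<otimes> inv x \<otimes> inv t \<in> W}"
    have "subgroup ?T G"
    proof (rule sub_finiteI)
      show "?T \<subseteq> carrier G" using mem by blast
      show "\<one> \<in> ?T" using x mem subgroup.one_closed[OF sP] subgroup.one_closed[OF sW] by simp
      fix t u assume "t \<in> ?T" "u \<in> ?T"
      then have t: "t \<in> P" "x \<otimes> t \<otimes> inv x \<otimes> inv t \<in> W" and u: "u \<in> P" "x \<otimes> u \<otimes> inv x \<otimes> inv u \<in> W"
        by auto
      have "t \<otimes> (x \<otimes> u \<otimes> inv x \<otimes> inv u) \<otimes> inv t \<in> W" using normalizesD[OF nrm] t u by blast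
      then have "(x \<otimes> t \<otimes> inv x \<otimes> inv t) \<otimes> (t \<otimes> (x \<otimes> u \<otimes> inv x \<otimes> inv u) \<otimes> inv t) \<in> W"
        using t subgroup.m_closed[OF sW] by blast
      moreover have "(x \<otimes> t \<otimes> inv x \<otimes> inv t) \<otimes> (t \<otimes> (x \<otimes> u \<otimes> inv x \<otimes> inv u) \<otimes> inv t)
          = x \<otimes> (t \<otimes> u) \<otimes> inv x \<otimes> inv (t \<otimes> u)"
        using x t(1) u(1) mem by (simp add: group_word_simps)
      ultimately show "t \<otimes> u \<in> ?T" using t u subgroup.m_closed[OF sP] by simp
    qed
    moreover have "W \<subseteq> ?T"
    proof
      fix w assume w: "w \<in> W"
      then have "x \<otimes> w \<otimes> inv x \<in> W" using normalizesD[OF nrm x] by blast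
      then have "x \<otimes> w \<otimes> inv x \<otimes> inv w \<in> W"
        using subgroup.m_closed[OF sW] subgroup.m_inv_closed[OF sW] w by blast
      then show "w \<in> ?T" using w W by blast
    qed
    moreover have "x \<in> ?T" using x mem subgroup.one_closed[OF sW] by (simp add: group_word_simps)
    ultimately have "?T = P" using top[of ?T] False by blast
    then show ?thesis using y by blast
  qed
  then show thesis using that W nrm by blast
qed

end

section \<open>Subnormal subgroups and special groups\<close>

context finite_group
begin

lemma
  shows pi_core_normal: "pi_core \<sigma> G \<lhd> G"
    and pi_core_pi: "pi_subgroup \<sigma> (pi_core \<sigma> G) G"
    and pi_core_sub: "subgroup (pi_core \<sigma> G) G"
    and pi_core_max: "\<And>M. M \<lhd> G \<Longrightarrow> pi_subgroup \<sigma> M G \<Longrightarrow> M \<subseteq> pi_core \<sigma> G"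
  using pi_core_largest[OF fin_carrier] normal_imp_subgroup by blast+

lemma pi_subgroup_mono: "pi_subgroup \<sigma> A G \<Longrightarrow> \<sigma> \<subseteq> \<tau> \<Longrightarrow> pi_subgroup \<tau> A G"
  unfolding pi_subgroup_def by blast

lemma pi_core_mono: "\<sigma> \<subseteq> \<tau> \<Longrightarrow> pi_core \<sigma> G \<subseteq> pi_core \<tau> G"
  using pi_core_max pi_core_normal pi_core_pi pi_subgroup_mono by metis

lemma pi_subgroup_subset:
  "pi_subgroup \<sigma> A G \<Longrightarrow> subgroup B G \<Longrightarrow> B \<subseteq> A \<Longrightarrow> pi_subgroup \<sigma> B G"
  unfolding pi_subgroup_iff using card_sub_dvd pi_number_dvd by metis

lemma pi_subgroup_restrict:
  "subgroup K G \<Longrightarrow> pi_subgroup \<sigma> A (G\<lparr>carrier := K\<rparr>) \<longleftrightarrow> pi_subgroup \<sigma> A G \<and> A \<subseteq> K"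
  unfolding pi_subgroup_def by (auto simp: sub_restrict_iff)

lemma pi_Int_trivial:
  assumes "pi_subgroup \<sigma> A G" "pi_subgroup \<tau> B G" "\<sigma> \<inter> \<tau> = {}"
  shows "A \<inter> B = {\<one>}"
proof -
  have i: "subgroup (A \<inter> B) G" using assms sub_Int pi_subgroup_iff by blast
  have "pi_subgroup \<sigma> (A \<inter> B) G" "pi_subgroup \<tau> (A \<inter> B) G"
    using pi_subgroup_subset[OF _ i] assms by blast+
  then have "card (A \<inter> B) = 1" using pi_number_both assms(3) unfolding pi_subgroup_iff by blast
  then show ?thesis using subgroup.one_closed[OF i] by (metis card_1_singletonE singletonD)
qed

lemma trivial_Int_commutes:
  assumes A: "subgroup A G" and B: "subgroup B G" and "normalizes A B" "normalizes B A" "A \<inter> B \<subseteq> {\<one>}"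
  shows "commutes A B"
  unfolding commutes_def
proof (intro ballI)
  fix a b assume a: "a \<in> A" and b: "b \<in> B"
  note mem = sub_mem[OF A a] sub_mem[OF B b]
  have "a \<otimes> b \<otimes> inv a \<in> B" "b \<otimes> inv a \<otimes> inv b \<in> A"
    using normalizesD[OF assms(3) a b] normalizesD[OF assms(4) b] subgroup.m_inv_closed[OF A a] by auto
  then have "(a \<otimes> b \<otimes> inv a) \<otimes> inv b \<in> B" "a \<otimes> (b \<otimes> inv a \<otimes> inv b) \<in> A"
    using subgroup.m_closed[OF B] subgroup.m_inv_closed[OF B b] subgroup.m_closed[OF A a] by auto
  moreover have "a \<otimes> (b \<otimes> inv a \<otimes> inv b) = (a \<otimes> b \<otimes> inv a) \<otimes> inv b" using mem by (simp add: m_assoc)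
  ultimately have "a \<otimes> b \<otimes> inv a \<otimes> inv b = \<one>" using assms(5) by auto
  then have "a \<otimes> b \<otimes> inv a = b" using mem inv_equality[of "a \<otimes> b \<otimes> inv a" "inv b"] by simp
  then show "a \<otimes> b = b \<otimes> a" using mem by (metis inv_solve_right' m_closed)
qed

text \<open>The \<sigma>-core of \<open>H\<close> is characteristic in \<open>H\<close>: each of its
  conjugates under \<open>G\<close> is again a normal \<sigma>-subgroup of \<open>H\<close>. So it
  is normal in \<open>G\<close>.\<close>

lemma normal_pi_core_mono:
  assumes H: "H \<lhd> G"
  shows "pi_core \<sigma> (G\<lparr>carrier := H\<rparr>) \<subseteq> pi_core \<sigma> G"
proof -
  have sH: "subgroup H G" using H normal_imp_subgroup by blast
  interpret H: finite_group "G\<lparr>carrier := H\<rparr>" using finite_group_sub[OF sH] .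
  let ?C = "pi_core \<sigma> (G\<lparr>carrier := H\<rparr>)"
  have C: "pi_subgroup \<sigma> ?C G" "?C \<subseteq> H" using H.pi_core_pi pi_subgroup_restrict[OF sH] by blast+
  have sC: "subgroup ?C G" using C pi_subgroup_iff by blast
  have nC: "normalizes H ?C" using H.pi_core_normal normal_restrict_iff[OF sH] by blast
  have "conj_set g ?C \<subseteq> ?C" if g: "g \<in> carrier G" for g
  proof (rule H.pi_core_max)
    have "conj_set g ?C \<subseteq> H" using C(2) normal_conj[OF H g] unfolding conj_set_def by blast
    then show "pi_subgroup \<sigma> (conj_set g ?C) (G\<lparr>carrier := H\<rparr>)"
      using pi_sub_conj[OF g C(1)] pi_subgroup_restrict[OF sH] by blast
    have "normalizes H (conj_set g ?C)"
      unfolding normalizes_def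
    proof (intro ballI)
      fix x a assume x: "x \<in> H" and "a \<in> conj_set g ?C"
      then obtain c where c: "c \<in> ?C" "a = g \<otimes> c \<otimes> inv g" unfolding conj_set_def by blast
      have y: "inv g \<otimes> x \<otimes> g \<in> H" using normal_conj[OF H, of "inv g" x] g x by simp
      have "x \<otimes> a \<otimes> inv x = g \<otimes> ((inv g \<otimes> x \<otimes> g) \<otimes> c \<otimes> inv (inv g \<otimes> x \<otimes> g)) \<otimes> inv g"
        using c g sub_mem[OF sH x] sub_mem[OF sC] by (simp add: group_word_simps)
      then show "x \<otimes> a \<otimes> inv x \<in> conj_set g ?C"
        using normalizesD[OF nC y c(1)] unfolding conj_set_def by blast
    qed
    then show "conj_set g ?C \<lhd> G\<lparr>carrier := H\<rparr>"
      using normal_restrict_iff[OF sH] sub_conj[OF g sC] \<open>conj_set g ?C \<subseteq> H\<close> by blast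
  qed
  then have "?C \<lhd> G" unfolding normal_iff normalizes_def using sC unfolding conj_set_def by blast
  then show ?thesis using pi_core_max C by blast
qed

lemma subnormal_pi_core:
  assumes "subnormal G K"
  shows "subgroup K G \<and> pi_core \<sigma> (G\<lparr>carrier := K\<rparr>) \<subseteq> pi_core \<sigma> G"
  using assms
proof (induction rule: subnormal.induct)
  case whole
  then show ?case using subgroup_self by simp
next
  case (step K H)
  then interpret K: finite_group "G\<lparr>carrier := K\<rparr>" using finite_group_sub by blast
  have "subgroup H G" using step normal_restrict_iff by blast
  moreover have "pi_core \<sigma> (G\<lparr>carrier := H\<rparr>) \<subseteq> pi_core \<sigma> (G\<lparr>carrier := K\<rparr>)"
    using K.normal_pi_core_mono[OF step(2)] by simp
  ultimately show ?case using step by blast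
qed

text \<open>\<open>S\<close> is its own \<sigma>-core, and cores only grow along a subnormal chain.
  For \<sigma> = {r} the contrapositive supplies the non-subnormal subgroups to which the assumption
  on normalizers is applied.\<close>

lemma subnormal_pi_le:
  assumes S: "subnormal G S" and pS: "pi_subgroup \<sigma> S G"
  shows "S \<subseteq> pi_core \<sigma> G"
proof -
  have sS: "subgroup S G" using pS pi_subgroup_iff by blast
  interpret S: finite_group "G\<lparr>carrier := S\<rparr>" using finite_group_sub[OF sS] .
  have "S \<subseteq> pi_core \<sigma> (G\<lparr>carrier := S\<rparr>)"
    using S.pi_core_max[of S] S.normal_self pi_subgroup_restrict[OF sS] pS by simp
  then show ?thesis using subnormal_pi_core[OF S] by blast
qed

section \<open>Cores, Sylow subgroups and special groups\<close>

lemma pi_core_le_sylow: "prime p \<Longrightarrow> sylow_subgroup p P G \<Longrightarrow> pi_core {p} G \<subseteq> P"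
  using normal_le_sylow pi_core_pi pi_core_normal by blast

lemma sylow_le_core_normal:
  assumes "prime p" "sylow_subgroup p P G" "P \<subseteq> pi_core {p} G"
  shows "P \<lhd> G"
  using pi_core_le_sylow[OF assms(1,2)] assms(3) pi_core_normal by (metis subset_antisym)

text \<open>A direct product with a varying number of factors becomes one condition for each prime
  of \<pi>, G = O_p O_{p'}, so that later arguments can treat a single prime.\<close>

lemma special_iff_split:
  assumes fin: "finite \<pi>" and pr: "\<forall>p\<in>\<pi>. prime p"
  shows "pi_special \<pi> G \<longleftrightarrow> (\<forall>p\<in>\<pi>. pi_core {p} G <#> pi_core (-{p}) G = carrier G)"
proof
  assume sp: "pi_special \<pi> G"
  show "\<forall>p\<in>\<pi>. pi_core {p} G <#> pi_core (-{p}) G = carrier G"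
  proof
    fix p assume p: "p \<in> \<pi>"
    let ?C = "pi_core {p} G <#> pi_core (-{p}) G"
    have sC: "subgroup ?C G"
      using sub_set_mult pi_core_sub normal_iff pi_core_normal normalizes_mono subgroup.subset by metis
    have "(\<Union>\<sigma>\<in>pi_blocks \<pi>. pi_core \<sigma> G) \<subseteq> ?C"
    proof (rule UN_least)
      fix \<sigma> assume \<sigma>: "\<sigma> \<in> pi_blocks \<pi>"
      show "pi_core \<sigma> G \<subseteq> ?C"
      proof (cases "\<sigma> = {p}")
        case True
        then show ?thesis using set_mult_upper pi_core_sub by blast
      next
        case False
        \<comment> \<open>The blocks are disjoint, so every factor other than O_p is absorbed by
          O_{p'}.\<close>
        then have "\<sigma> \<subseteq> -{p}" using \<sigma> p unfolding pi_blocks_def prime_compl_def by auto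
        then have "pi_core \<sigma> G \<subseteq> pi_core (-{p}) G" by (rule pi_core_mono)
        then show ?thesis using set_mult_upper(2)[OF pi_core_sub pi_core_sub] by blast
      qed
    qed
    then have "generate G (\<Union>\<sigma>\<in>pi_blocks \<pi>. pi_core \<sigma> G) \<subseteq> ?C"
      using generate_subgroup_incl[OF _ sC] by blast
    then have "carrier G \<subseteq> ?C"
      using sp unfolding pi_special_def internal_direct_product_def by simp
    then show "?C = carrier G" using subgroup.subset[OF sC] by blast
  qed
next
  assume split: "\<forall>p\<in>\<pi>. pi_core {p} G <#> pi_core (-{p}) G = carrier G"
  let ?D = "special_core \<pi> G"
  have sD: "subgroup ?D G" using special_core_direct[OF fin_carrier] by blast
  have inD: "pi_core \<sigma> G \<subseteq> ?D" if "\<sigma> \<in> pi_blocks \<pi>" for \<sigma>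
    unfolding special_core_def using that by (auto intro: generate.incl)
  \<comment> \<open>Factors of \<open>x\<close> are split off one prime at a time; what remains lies
    in O_{p'} for every prime p treated so far.\<close>
  have peel: "\<exists>d\<in>?D. \<exists>y\<in>carrier G. x = d \<otimes> y \<and> (\<forall>p\<in>S. y \<in> pi_core (-{p}) G)"
    if "S \<subseteq> \<pi>" "x \<in> carrier G" for S x
    using finite_subset[OF that(1) fin] that
  proof (induction S)
    case empty
    then show ?case using subgroup.one_closed[OF sD] by (intro bexI[of _ \<one>] bexI[of _ x]) auto
  next
    case (insert q S)
    then obtain d y where d: "d \<in> ?D" "y \<in> carrier G" "x = d \<otimes> y" "\<forall>p\<in>S. y \<in> pi_core (-{p}) G"
      by auto
    have "y \<in> pi_core {q} G <#> pi_core (-{q}) G" using split insert d by blast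
    then obtain a b where ab: "a \<in> pi_core {q} G" "b \<in> pi_core (-{q}) G" "y = a \<otimes> b"
      unfolding set_mult_def by blast
    have "{q} \<in> pi_blocks \<pi>" using insert unfolding pi_blocks_def by blast
    then have aD: "a \<in> ?D" using inD ab by blast
    note mem = sub_mem[OF pi_core_sub ab(1)] sub_mem[OF pi_core_sub ab(2)] sub_mem[OF sD d(1)]
    \<comment> \<open>Splitting off \<open>a\<close> does not spoil the earlier primes p, because
      O_q is contained in O_{p'} for q other than p.\<close>
    have "b \<in> pi_core (-{p}) G" if p: "p \<in> S" for p
    proof -
      have "p \<noteq> q" using insert p by blast
      then have "a \<in> pi_core (-{p}) G" using pi_core_mono[of "{q}" "-{p}"] ab by blast
      moreover have "b = inv a \<otimes> y" using ab mem by (simp add: group_word_simps)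
      ultimately show ?thesis
        using d(4) p subgroup.m_closed[OF pi_core_sub] subgroup.m_inv_closed[OF pi_core_sub] by metis
    qed
    moreover have "x = (d \<otimes> a) \<otimes> b" using d ab mem by (simp add: m_assoc)
    moreover have "d \<otimes> a \<in> ?D" using subgroup.m_closed[OF sD] d aD by blast
    ultimately show ?case using ab mem by (intro bexI[of _ "d \<otimes> a"] bexI[of _ b]) auto
  qed
  \<comment> \<open>What is left after all primes of \<pi>: the intersection of the O_{p'} is a
    normal \<pi>'-subgroup and hence part of the last block.\<close>
  let ?I = "{y \<in> carrier G. \<forall>p\<in>\<pi>. y \<in> pi_core (-{p}) G}"
  have sI: "subgroup ?I G"
    by (rule sub_finiteI[of _ \<one>])
      (use subgroup.one_closed[OF pi_core_sub] subgroup.m_closed[OF pi_core_sub] in auto)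
  have "?I \<lhd> G"
    unfolding normal_iff normalizes_def using sI normal_conj[OF pi_core_normal] by simp
  moreover have "pi_subgroup (prime_compl \<pi>) ?I G"
    unfolding pi_subgroup_def prime_compl_def
  proof (intro conjI allI impI sI CollectI notI)
    fix q assume q: "prime q \<and> q dvd card ?I"
    then show "prime q" by blast
    assume "q \<in> \<pi>"
    then have "?I \<subseteq> pi_core (-{q}) G" by blast
    then have "pi_subgroup (-{q}) ?I G" using pi_subgroup_subset[OF pi_core_pi sI] by blast
    then show False using q unfolding pi_subgroup_def by blast
  qed
  ultimately have "?I \<subseteq> pi_core (prime_compl \<pi>) G" by (rule pi_core_max)
  then have I: "?I \<subseteq> ?D" using inD unfolding pi_blocks_def by blast
  have "carrier G \<subseteq> ?D"
  proof
    fix x assume "x \<in> carrier G"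
    from peel[OF subset_refl this] obtain d y where "d \<in> ?D" "y \<in> ?I" "x = d \<otimes> y" by blast
    then show "x \<in> ?D" using I subgroup.m_closed[OF sD] by blast
  qed
  then have "?D = carrier G" using subgroup.subset[OF sD] by blast
  then show "pi_special \<pi> G"
    unfolding pi_special_def using special_core_direct(2)[OF fin_carrier, of \<pi>] by simp
qed

lemma split_coreI:
  assumes "A \<lhd> G" "B \<lhd> G" "pi_subgroup {p} A G" "pi_subgroup (-{p}) B G"
    "carrier G \<subseteq> A <#> B"
  shows "pi_core {p} G <#> pi_core (-{p}) G = carrier G"
proof
  show "carrier G \<subseteq> pi_core {p} G <#> pi_core (-{p}) G"
    using assms(5) mono_set_mult[OF pi_core_max[OF assms(1,3)] pi_core_max[OF assms(2,4)], of G] by blast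
qed (rule setmult_subset_G; rule subgroup.subset[OF pi_core_sub])

text \<open>Here \<open>r\<close> may lie outside \<pi>. At each prime p of \<pi>, one of the two
  factors is \<open>S\<close> and the other is trivial.\<close>

lemma prime_power_special:
  assumes "finite \<pi>" "\<forall>p\<in>\<pi>. prime p" "pi_subgroup {r} S G"
  shows "pi_special \<pi> (G\<lparr>carrier := S\<rparr>)"
proof -
  have sS: "subgroup S G" using assms pi_subgroup_iff by blast
  interpret S: finite_group "G\<lparr>carrier := S\<rparr>" using finite_group_sub[OF sS] .
  have 1: "S \<lhd> G\<lparr>carrier := S\<rparr>" "{\<one>} \<lhd> G\<lparr>carrier := S\<rparr>"
    using S.normal_self S.one_is_normal by auto
  have 2: "pi_subgroup {r} S (G\<lparr>carrier := S\<rparr>)" using assms pi_subgroup_restrict[OF sS] by blast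
  have 3: "pi_subgroup \<sigma> {\<one>} (G\<lparr>carrier := S\<rparr>)" for \<sigma>
    using normal_imp_subgroup[OF 1(2)] S.pi_subgroup_iff[of \<sigma> "{\<one>}"] by simp
  have 4: "S \<subseteq> S <#> {\<one>}" "S \<subseteq> {\<one>} <#> S"
    using set_mult_upper[of S "{\<one>}"] set_mult_upper[of "{\<one>}" S] sS triv_subgroup by auto
  show ?thesis
    unfolding S.special_iff_split[OF assms(1,2)]
  proof
    fix p assume p: "p \<in> \<pi>"
    show "pi_core {p} (G\<lparr>carrier := S\<rparr>) <#>\<^bsub>G\<lparr>carrier := S\<rparr>\<^esub> pi_core (-{p}) (G\<lparr>carrier := S\<rparr>) = carrier (G\<lparr>carrier := S\<rparr>)"
    proof (cases "p = r")
      case True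
      then show ?thesis using S.split_coreI[of S "{\<one>}" p] 1 2 3 4 by simp
    next
      case False
      then have "pi_subgroup (-{p}) S (G\<lparr>carrier := S\<rparr>)" using S.pi_subgroup_mono[OF 2] by auto
      then show ?thesis using S.split_coreI[of "{\<one>}" S p] 1 3 4 by simp
    qed
  qed
qed

text \<open>In G = O_p x O_{p'} the index of either core is the order of the other, hence coprime to
  the order of \<open>S\<close>.\<close>

lemma special_le_cores:
  assumes "finite \<pi>" "\<forall>p\<in>\<pi>. prime p" "pi_special \<pi> G" "p \<in> \<pi>"
  shows "pi_subgroup {p} S G \<Longrightarrow> S \<subseteq> pi_core {p} G"
    and "pi_subgroup (-{p}) S G \<Longrightarrow> S \<subseteq> pi_core (-{p}) G"
proof -
  let ?A = "pi_core {p} G" and ?B = "pi_core (-{p}) G"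
  have "?A <#> ?B = carrier G" using special_iff_split[OF assms(1,2)] assms(3,4) by blast
  moreover have "?A \<inter> ?B = {\<one>}" using pi_Int_trivial[OF pi_core_pi pi_core_pi] by blast
  ultimately have o: "order G = card ?A * card ?B"
    using card_set_mult[OF pi_core_sub[of "{p}"] pi_core_sub[of "-{p}"]] unfolding order_def by simp
  have n: "normalizes (carrier G) (pi_core \<sigma> G)" for \<sigma> using pi_core_normal normal_iff by blast
  note pos = card_sub_pos[OF pi_core_sub]
  have gen: "S \<subseteq> pi_core \<sigma> G" if S: "pi_subgroup \<sigma> S G" and d: "pi_number (-\<sigma>) (order G div card (pi_core \<sigma> G))" for \<sigma>
  proof
    fix s assume s: "s \<in> S"
    have sS: "subgroup S G" using S pi_subgroup_iff by blast
    show "s \<in> pi_core \<sigma> G"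
    proof (rule coprime_index_mem[OF pi_core_sub subgroup_self _ n])
      show "pi_core \<sigma> G \<subseteq> carrier G" using subgroup.subset[OF pi_core_sub] .
      show "s \<in> carrier G" using sub_mem[OF sS s] .
      show "s [^] card S \<in> pi_core \<sigma> G"
        using pow_card_eq_one[OF sS s] subgroup.one_closed[OF pi_core_sub] by simp
      show "coprime (card S) (card (carrier G) div card (pi_core \<sigma> G))"
        using pi_number_coprime[of \<sigma> "card S" "-\<sigma>"] S d unfolding pi_subgroup_iff order_def by auto
    qed
  qed
  show "pi_subgroup {p} S G \<Longrightarrow> S \<subseteq> ?A"
    using gen[of "{p}"] o pos[of "{p}"] pi_core_pi[of "-{p}"] unfolding pi_subgroup_iff by simp
  show "pi_subgroup (-{p}) S G \<Longrightarrow> S \<subseteq> ?B"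
    using gen[of "-{p}"] o pos[of "-{p}"] pi_core_pi[of "{p}"] unfolding pi_subgroup_iff by simp
qed

lemma special_commutes:
  assumes "finite \<pi>" "\<forall>p\<in>\<pi>. prime p" and N: "subgroup N G" "pi_special \<pi> (G\<lparr>carrier := N\<rparr>)"
    and p: "p \<in> \<pi>" and S: "pi_subgroup {p} S G" "S \<subseteq> N" and T: "pi_subgroup (-{p}) T G" "T \<subseteq> N"
  shows "commutes S T"
proof -
  interpret N: finite_group "G\<lparr>carrier := N\<rparr>" using finite_group_sub[OF N(1)] .
  let ?A = "pi_core {p} (G\<lparr>carrier := N\<rparr>)" and ?B = "pi_core (-{p}) (G\<lparr>carrier := N\<rparr>)"
  have 1: "S \<subseteq> ?A" "T \<subseteq> ?B"
    using N.special_le_cores[OF assms(1,2) N(2) p] S T pi_subgroup_restrict[OF N(1)] by blast+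
  have pi: "pi_subgroup {p} ?A G" "pi_subgroup (-{p}) ?B G"
    using N.pi_core_pi pi_subgroup_restrict[OF N(1)] by blast+
  have "normalizes N ?A" "normalizes N ?B" "?A \<subseteq> N" "?B \<subseteq> N"
    using N.pi_core_normal normal_restrict_iff[OF N(1)] by blast+
  then have "commutes ?A ?B"
    using trivial_Int_commutes pi pi_Int_trivial[OF pi] normalizes_mono unfolding pi_subgroup_iff
    by (metis Int_commute Compl_disjoint subset_refl)
  then show ?thesis using commutes_mono 1 by blast
qed

end

section \<open>Transfer\<close>

lemma coprime_pi_number_prime:
  assumes "prime p" "\<not> p dvd k" "pi_number {p} n"
  shows "coprime k n"
proof (rule pi_number_coprime)
  show "pi_number (-{p}) k" unfolding pi_number_compl_iff[OF assms(1)] using assms(2) by (auto intro: Nat.gr0I)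
qed (use assms in auto)

context finite_group
begin

lemma conj_pow:
  assumes "g \<in> carrier G" "x \<in> carrier G"
  shows "(g \<otimes> x \<otimes> inv g) [^] (n::nat) = g \<otimes> x [^] n \<otimes> inv g"
  by (induction n) (use assms in \<open>simp_all add: group_word_simps\<close>)

text \<open>\<open>y [^] u\<close> is a k-th root of \<open>y\<close>: taking powers with an
  exponent coprime to the order is invertible.\<close>

lemma coprime_pow_root:
  assumes "subgroup S G" "y \<in> S" "coprime k (card S)"
  obtains u where "y [^] (k * u :: nat) = y"
proof -
  obtain u where "[k * u = Suc 0] (mod card S)" using cong_solve_coprime_nat assms(3) by blast
  then obtain v w where vw: "k * u + card S * v = Suc 0 + card S * w"
    by (metis cong_iff_lin_nat mult.commute)
  have y: "y \<in> carrier G" using sub_mem assms by blast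
  have "y [^] (k * u) \<otimes> y [^] (card S * v) = y [^] Suc 0 \<otimes> y [^] (card S * w)"
    using vw y by (simp only: nat_pow_mult)
  moreover have "y [^] (card S * n) = \<one>" for n
    using y pow_card_eq_one[OF assms(1,2)] nat_pow_pow[of y "card S" n] by simp
  ultimately have "y [^] (k * u) = y" using y by simp
  then show thesis using that by blast
qed

text \<open>\<open>f\<close> is the transfer for the transversal \<open>t\<close>. With
  \<open>C #> inv g\<close> as translate, \<open>G\<close> acts on the cosets from the left, so the
  factor of \<open>g \<otimes> k\<close> at \<open>C\<close> splits through
  \<open>t (C #> inv k)\<close> into a factor of \<open>g\<close> at the translated coset and one of
  \<open>k\<close> at \<open>C\<close>. Reindexing the first kind gives \<open>f g\<close>.\<close>

lemma transfer_hom: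
  assumes P: "subgroup P G" and A: "comm_group A" and h: "h \<in> hom (G\<lparr>carrier := P\<rparr>) A"
    and t: "\<And>C. C \<in> rcosets P \<Longrightarrow> t C \<in> C"
  defines "f \<equiv> \<lambda>g. finprod A (\<lambda>C. h (t (C #> inv g) \<otimes> g \<otimes> inv (t C))) (rcosets P)"
  shows "f \<in> hom G A"
    and "\<And>C g. C \<in> rcosets P \<Longrightarrow> g \<in> carrier G \<Longrightarrow> t (C #> inv g) \<otimes> g \<otimes> inv (t C) \<in> P"
proof -
  interpret A: comm_group A by fact
  have sub: "P \<subseteq> carrier G" using P subgroup.subset by blast
  have tc: "t C \<in> carrier G" if "C \<in> rcosets P" for C
    using t[OF that] that subgroup.rcosets_carrier[OF P is_group] by blast
  have tr: "C #> g \<in> rcosets P" if "C \<in> rcosets P" "g \<in> carrier G" for C g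
    using that sub by (auto simp: RCOSETS_def coset_mult_assoc)
  have Csub: "C \<subseteq> carrier G" if "C \<in> rcosets P" for C
    using subgroup.rcosets_carrier[OF P is_group that] .
  show inP: "t (C #> inv g) \<otimes> g \<otimes> inv (t C) \<in> P" if C: "C \<in> rcosets P" and g: "g \<in> carrier G" for C g
  proof -
    have "t (C #> inv g) \<otimes> g \<in> (C #> inv g) #> g"
      using rcosI[OF t[OF tr[OF C]] Csub[OF tr[OF C]]] g by simp
    also have "\<dots> = C" using Csub[OF C] g by (simp add: coset_mult_assoc)
    finally show ?thesis using diff_neutralizes[OF P C _ t[OF C]] by blast
  qed
  have hP: "h x \<in> carrier A" if "x \<in> P" for x using h that by (auto simp: hom_def)
  have hm: "h (x \<otimes> y) = h x \<otimes>\<^bsub>A\<^esub> h y" if "x \<in> P" "y \<in> P" for x y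
    using h that by (auto simp: hom_def)
  show "f \<in> hom G A"
  proof (rule homI)
    show "f g \<in> carrier A" if "g \<in> carrier G" for g
      unfolding f_def using inP hP that by (intro A.finprod_closed) auto
    fix g k assume g: "g \<in> carrier G" and k: "k \<in> carrier G"
    let ?F = "\<lambda>g C. h (t (C #> inv g) \<otimes> g \<otimes> inv (t C))"
    have F: "?F g \<in> rcosets P \<rightarrow> carrier A" if "g \<in> carrier G" for g using inP hP that by auto
    have Fk: "(\<lambda>C. ?F g (C #> inv k)) \<in> rcosets P \<rightarrow> carrier A" using F[OF g] tr k by auto
    have bij: "(\<lambda>C. C #> inv k) ` (rcosets P) = rcosets P"
    proof
      show "rcosets P \<subseteq> (\<lambda>C. C #> inv k) ` (rcosets P)"
      proof
        fix C assume C: "C \<in> rcosets P"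
        then have "C = (C #> k) #> inv k" using Csub[OF C] k by (simp add: coset_mult_assoc)
        then show "C \<in> (\<lambda>C. C #> inv k) ` (rcosets P)" using tr C k by blast
      qed
    qed (use tr k in auto)
    have inj: "inj_on (\<lambda>C. C #> inv k) (rcosets P)"
    proof (rule inj_onI)
      fix C D assume CD: "C \<in> rcosets P" "D \<in> rcosets P" "C #> inv k = D #> inv k"
      then have "(C #> inv k) #> k = (D #> inv k) #> k" by simp
      then show "C = D" using Csub[OF CD(1)] Csub[OF CD(2)] k by (simp add: coset_mult_assoc)
    qed
    have "?F (g \<otimes> k) C = ?F g (C #> inv k) \<otimes>\<^bsub>A\<^esub> ?F k C" if C: "C \<in> rcosets P" for C
    proof -
      let ?C = "C #> inv k"
      have e: "C #> inv (g \<otimes> k) = ?C #> inv g"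
        using Csub[OF C] g k by (simp add: coset_mult_assoc inv_mult_group)
      have mem: "t C \<in> carrier G" "t ?C \<in> carrier G" "t (?C #> inv g) \<in> carrier G"
        using tc tr C g k by auto
      have "t (?C #> inv g) \<otimes> (g \<otimes> k) \<otimes> inv (t C)
          = (t (?C #> inv g) \<otimes> g \<otimes> inv (t ?C)) \<otimes> (t ?C \<otimes> k \<otimes> inv (t C))"
        using mem g k by (simp add: group_word_simps)
      then show ?thesis unfolding e using hm inP tr C g k by simp
    qed
    then have "f (g \<otimes> k) = finprod A (\<lambda>C. ?F g (C #> inv k) \<otimes>\<^bsub>A\<^esub> ?F k C) (rcosets P)"
      unfolding f_def using Fk F[OF k] by (intro A.finprod_cong') auto
    also have "\<dots> = finprod A (\<lambda>C. ?F g (C #> inv k)) (rcosets P) \<otimes>\<^bsub>A\<^esub> f k"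
      unfolding f_def by (rule A.finprod_multf[OF Fk F[OF k]])
    also have "finprod A (\<lambda>C. ?F g (C #> inv k)) (rcosets P) = f g"
      unfolding f_def using A.finprod_reindex[of "?F g" "\<lambda>C. C #> inv k" "rcosets P"] F[OF g] bij inj by simp
    finally show "f (g \<otimes> k) = f g \<otimes>\<^bsub>A\<^esub> f k" .
  qed
qed

text \<open>The transversal \<open>t\<close> is chosen such that \<open>t C \<in> r P\<close> with \<open>r\<close> depending only on the double coset of \<open>C\<close>.
  For \<open>x \<in> P\<close> the factors of the transfer are then of the form \<open>r w r\<^sup>-\<^sup>1\<close> with \<open>w \<in> P\<close>, which lies in \<open>V\<close>
  unless \<open>r\<close> normalizes \<open>P\<close>.\<close>
lemma transfer_TI:
  assumes p: "prime p" and P: "sylow_subgroup p P G" and V: "V \<subseteq> P"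
    and Vn: "V \<lhd> G"
    and TI: "\<And>g. g \<in> carrier G \<Longrightarrow> \<not> P \<inter> conj_set g P \<subseteq> V \<Longrightarrow> conj_set g P = P"
    and A: "comm_group A" and h: "h \<in> hom (G\<lparr>carrier := P\<rparr>) A"
    and hV: "\<And>v. v \<in> V \<Longrightarrow> h v = \<one>\<^bsub>A\<^esub>"
    and stable: "\<And>g x. g \<in> carrier G \<Longrightarrow> conj_set g P = P \<Longrightarrow> x \<in> P \<Longrightarrow> h (g \<otimes> x \<otimes> inv g) = h x"
  obtains f k where "f \<in> hom G A" "\<not> p dvd k" "\<forall>x\<in>P. f x = h x [^]\<^bsub>A\<^esub> (k::nat)"
proof -
  interpret A: comm_group A by fact
  have sP: "subgroup P G" using sylowD[OF p P] by blast
  have sub: "P \<subseteq> carrier G" using sP subgroup.subset by blast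
  have Csub: "C \<subseteq> carrier G" if "C \<in> rcosets P" for C
    using subgroup.rcosets_carrier[OF sP is_group that] .
  define r where "r D = (SOME z. z \<in> D)" for D :: "'a set"
  define t where "t C = (SOME z. z \<in> C \<and> (\<exists>y\<in>P. z = r (C <#> P) \<otimes> y))" for C
  have t: "t C \<in> C \<and> (\<exists>y\<in>P. t C = r (C <#> P) \<otimes> y)" and rc: "r (C <#> P) \<in> carrier G"
    if C: "C \<in> rcosets P" for C
  proof -
    obtain g where g: "C = P #> g" "g \<in> carrier G" using C unfolding RCOSETS_def by blast
    have "g \<in> C" using g rcos_self sP by blast
    then have "g \<otimes> \<one> \<in> C <#> P" by (rule prod_mem_set_mult) (rule subgroup.one_closed[OF sP])
    then have "r (C <#> P) \<in> C <#> P" unfolding r_def by (rule someI)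
    then obtain c y where cy: "c \<in> C" "y \<in> P" "r (C <#> P) = c \<otimes> y" unfolding set_mult_def by blast
    then have cyc: "c \<in> carrier G" "y \<in> carrier G" using Csub[OF C] sub by auto
    then show "r (C <#> P) \<in> carrier G" using cy by simp
    have "c = r (C <#> P) \<otimes> inv y" using cy cyc by (simp add: group_word_simps)
    then have "c \<in> C \<and> (\<exists>y\<in>P. c = r (C <#> P) \<otimes> y)" using cy subgroup.m_inv_closed[OF sP] by blast
    then show "t C \<in> C \<and> (\<exists>y\<in>P. t C = r (C <#> P) \<otimes> y)" unfolding t_def by (rule someI)
  qed
  have tc: "t C \<in> carrier G" if "C \<in> rcosets P" for C using t[OF that] Csub[OF that] by blast
  let ?E = "rcosets P"
  have finE: "finite ?E" using fin_carrier rcosets_finite rcosets_part_G[OF sP] finite_UnionD by metis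
  define F where "F g C = h (t (C #> inv g) \<otimes> g \<otimes> inv (t C))" for g C
  define f where "f g = finprod A (F g) ?E" for g
  have fh: "f \<in> hom G A"
    using transfer_hom(1)[OF sP A h, of t] t unfolding f_def F_def by blast
  have inP: "t (C #> inv g) \<otimes> g \<otimes> inv (t C) \<in> P" if "C \<in> ?E" "g \<in> carrier G" for C g
    using transfer_hom(2)[OF sP A h, of t] t that by blast
  let ?N = "normalizer G P"
  have sN: "subgroup ?N G" using sub_normalizer sP by blast
  define E0 where "E0 = {C \<in> ?E. conj_set (t C) P = P}"
  have hP: "h x \<in> carrier A" if "x \<in> P" for x using h that by (auto simp: hom_def)
  have Pt: "C = P #> t C" if "C \<in> ?E" for C
  proof -
    obtain g where g: "C = P #> g" "g \<in> carrier G" using \<open>C \<in> ?E\<close> unfolding RCOSETS_def by blast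
    then show ?thesis using repr_independence[of "t C" P g] t[OF that] sP by simp
  qed
  \<comment> \<open>Since \<open>t C\<close> normalizes \<open>P\<close>, the element
    \<open>x\<close> fixes the coset \<open>C\<close>, and its factor is the conjugate of
    \<open>x\<close> by \<open>t C\<close>.\<close>
  have F0: "F x C = h x" if C: "C \<in> E0" and x: "x \<in> P" for C x
  proof -
    have CE: "C \<in> ?E" and cj: "conj_set (t C) P = P" using C unfolding E0_def by auto
    note tC = tc[OF CE] and xc = sub_mem[OF sP x]
    have "t C \<otimes> inv x \<otimes> inv (t C) \<in> P"
      using cj subgroup.m_inv_closed[OF sP x] unfolding conj_set_def by blast
    then have "t C \<otimes> inv x \<in> P #> t C"
      using subgroup.rcos_module_rev[OF sP is_group tC, of "t C \<otimes> inv x"] tC xc by simp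
    then have "P #> t C = P #> (t C \<otimes> inv x)" using repr_independence tC sP by blast
    then have "C #> inv x = C" using Pt[OF CE] sub tC xc by (metis coset_mult_assoc inv_closed)
    then show ?thesis unfolding F_def using stable[OF tC cj x] by simp
  qed
  have F1: "F x C = \<one>\<^bsub>A\<^esub>" if C: "C \<in> ?E - E0" and x: "x \<in> P" for C x
  proof -
    have CE: "C \<in> ?E" and cj: "conj_set (t C) P \<noteq> P" using C unfolding E0_def by auto
    note tC = tc[OF CE] and xc = sub_mem[OF sP x]
    let ?r = "r (C <#> P)"
    have CE': "C #> inv x \<in> ?E"
      using CE sub xc by (auto simp: RCOSETS_def coset_mult_assoc)
    have "{inv x} <#> P = P" using coset_join3[of "inv x" P] sP subgroup.m_inv_closed[OF sP x] xc
      by (simp add: l_coset_eq_set_mult)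
    then have e: "(C #> inv x) <#> P = C <#> P"
      unfolding r_coset_eq_set_mult using set_mult_assoc[OF Csub[OF CE], of "{inv x}" P] sub xc by simp
    obtain y where y: "y \<in> P" "t C = ?r \<otimes> y" using t[OF CE] by blast
    obtain y' where y': "y' \<in> P" "t (C #> inv x) = ?r \<otimes> y'" using t[OF CE'] e by auto
    note mem = rc[OF CE] sub_mem[OF sP y(1)] sub_mem[OF sP y'(1)] xc
    let ?w = "y' \<otimes> x \<otimes> inv y"
    have w: "?w \<in> P" using y(1) y'(1) x subgroup.m_closed[OF sP] subgroup.m_inv_closed[OF sP] by blast
    have eq: "t (C #> inv x) \<otimes> x \<otimes> inv (t C) = ?r \<otimes> ?w \<otimes> inv ?r"
      using mem y y' by (simp add: group_word_simps)
    \<comment> \<open>\<open>t C\<close> and the representative \<open>?r\<close> differ by an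
      element of \<open>P\<close>. So \<open>?r\<close> does not normalize \<open>P\<close> either,
      and the trivial intersection property applies to it.\<close>
    have "conj_set y P = P" using mem_normalizer_conj[OF sP] le_normalizer[OF sP] y(1) by blast
    then have "conj_set (t C) P = conj_set ?r P" using conj_conj[of ?r y P] mem y(2) sub by simp
    then have V': "P \<inter> conj_set ?r P \<subseteq> V" using TI[OF rc[OF CE]] cj by metis
    have "?r \<otimes> ?w \<otimes> inv ?r \<in> P" using inP[OF CE xc] eq by simp
    then have "?r \<otimes> ?w \<otimes> inv ?r \<in> V" using V' w unfolding conj_set_def by blast
    then show ?thesis unfolding F_def eq by (rule hV)
  qed
  have ev: "f x = h x [^]\<^bsub>A\<^esub> card E0" if x: "x \<in> P" for x
  proof -
    have "f x = finprod A (\<lambda>C. h x) E0"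
      unfolding f_def
    proof (rule A.finprod_mono_neutral_cong_right[OF finE])
      show "F x \<in> ?E \<rightarrow> carrier A" unfolding F_def using inP hP sub_mem[OF sP x] by auto
    qed (use F0[OF _ x] F1[OF _ x] in \<open>auto simp: E0_def\<close>)
    then show ?thesis using A.finprod_const[OF hP[OF x]] by simp
  qed
  \<comment> \<open>The contributing cosets are those inside \<open>normalizer G P\<close>; their
    number divides the index of \<open>P\<close> in \<open>G\<close>, which is prime to p.\<close>
  have "E0 = rcosets\<^bsub>G\<lparr>carrier := ?N\<rparr>\<^esub> P"
  proof
    show "E0 \<subseteq> rcosets\<^bsub>G\<lparr>carrier := ?N\<rparr>\<^esub> P"
    proof
      fix C assume C: "C \<in> E0"
      then have "t C \<in> ?N" using tc mem_normalizer_conj[OF sP] unfolding E0_def by blast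
      then show "C \<in> rcosets\<^bsub>G\<lparr>carrier := ?N\<rparr>\<^esub> P" using Pt C unfolding E0_def RCOSETS_def by auto
    qed
    show "rcosets\<^bsub>G\<lparr>carrier := ?N\<rparr>\<^esub> P \<subseteq> E0"
    proof
      fix C assume "C \<in> rcosets\<^bsub>G\<lparr>carrier := ?N\<rparr>\<^esub> P"
      then obtain n where n: "n \<in> ?N" "C = P #> n" unfolding RCOSETS_def by auto
      then have CE: "C \<in> ?E" using sub_mem[OF sN] unfolding RCOSETS_def by blast
      obtain a where "a \<in> P" "t C = a \<otimes> n" using t[OF CE] n unfolding r_coset_def by auto
      then have "t C \<in> ?N" using subgroup.m_closed[OF sN subsetD[OF le_normalizer[OF sP]] n(1)] by simp
      then show "C \<in> E0" unfolding E0_def using CE mem_normalizer_conj[OF sP] by blast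
    qed
  qed
  moreover have "card (rcosets\<^bsub>G\<lparr>carrier := ?N\<rparr>\<^esub> P) * card P = card ?N"
    using group.lagrange[OF subgroup_imp_group[OF sN] subgroup_incl[OF sP sN le_normalizer[OF sP]]]
    by (simp add: order_def)
  ultimately have "card E0 * card P dvd order G" using card_dvd_order[OF sN] by simp
  then have "card E0 dvd order G div card P"
    using card_sub_pos[OF sP] card_dvd_order[OF sP] by (metis dvd_div_iff_mult less_numeral_extra(3))
  then have "\<not> p dvd card E0" using sylowD(3)[OF p P] dvd_trans by blast
  then show thesis using that fh ev by blast
qed

end

text \<open>\<open>P / V\<close> is a trivial intersection subgroup of \<open>G / V\<close>, and \<open>N(P) = P C\<close> for a set \<open>C\<close> of
  \<open>p'\<close>-elements centralizing \<open>P\<close>.\<close>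
definition TI_mod :: "('a, 'b) monoid_scheme \<Rightarrow> nat \<Rightarrow> 'a set \<Rightarrow> 'a set \<Rightarrow> bool" where
  "TI_mod G p P V \<longleftrightarrow> prime p \<and> sylow_subgroup p P G \<and> V \<lhd> G \<and> V \<subseteq> P \<and>
    (\<forall>g\<in>carrier G. \<not> P \<inter> group.conj_set G g P \<subseteq> V \<longrightarrow> group.conj_set G g P = P) \<and>
    (\<forall>t\<in>carrier G. group.conj_set G t P = P \<longrightarrow>
      (\<exists>u\<in>P. \<exists>c\<in>carrier G. \<exists>m::nat. t = u \<otimes>\<^bsub>G\<^esub> c \<and> (\<forall>x\<in>P. c \<otimes>\<^bsub>G\<^esub> x = x \<otimes>\<^bsub>G\<^esub> c) \<and>
        c [^]\<^bsub>G\<^esub> m = \<one>\<^bsub>G\<^esub> \<and> \<not> p dvd m))"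

section \<open>Normal complements modulo \<open>V\<close> from iterated transfer\<close>

context finite_group
begin

text \<open>One step of an induction on \<open>card P\<close> in which the group changes too, hence
  the induction hypothesis as an assumption. The new group is the kernel of the transfer: it has
  \<open>W\<close> as a Sylow p-subgroup, and if \<open>W\<close> is not yet \<open>V\<close>, it
  inherits \<open>TI_mod\<close>.\<close>

lemma TI_normal_complement_step:
  assumes cfg: "TI_mod G p P V"
    and IH: "\<And>K W. subgroup K G \<Longrightarrow> card W < card P \<Longrightarrow> TI_mod (G\<lparr>carrier := K\<rparr>) p W V \<Longrightarrow>
      \<exists>L. L \<lhd> G\<lparr>carrier := K\<rparr> \<and> V \<subseteq> L \<and> card L * card W = card K * card V"
  shows "\<exists>L. L \<lhd> G \<and> V \<subseteq> L \<and> card L * card P = order G * card V"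
proof -
  have p: "prime p" and P: "sylow_subgroup p P G" and Vn: "V \<lhd> G" and VP: "V \<subseteq> P"
    using cfg unfolding TI_mod_def by blast+
  have TI: "\<And>g. g \<in> carrier G \<Longrightarrow> \<not> P \<inter> conj_set g P \<subseteq> V \<Longrightarrow> conj_set g P = P"
    using cfg unfolding TI_mod_def by blast
  have cent: "\<And>t. t \<in> carrier G \<Longrightarrow> conj_set t P = P \<Longrightarrow>
      \<exists>u\<in>P. \<exists>c\<in>carrier G. \<exists>m::nat. t = u \<otimes> c \<and> (\<forall>x\<in>P. c \<otimes> x = x \<otimes> c) \<and> c [^] m = \<one> \<and> \<not> p dvd m"
    using cfg unfolding TI_mod_def by blast
  have sP: "subgroup P G" and pP: "pi_subgroup {p} P G" using sylowD[OF p P] by blast+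
  have sV: "subgroup V G" using Vn normal_imp_subgroup by blast
  show ?thesis
  proof (cases "V = P")
    case True
    then show ?thesis using normal_self VP subgroup.subset[OF sP]
      by (intro exI[of _ "carrier G"]) (simp add: order_def)
  next
    case False
    then have VsP: "V \<subset> P" using VP by blast
    obtain W where W: "subgroup W G" "V \<subseteq> W" "W \<subset> P" "normalizes P W"
      and comm: "\<forall>x\<in>P. \<forall>y\<in>P. x \<otimes> y \<otimes> inv x \<otimes> inv y \<in> W"
      by (rule abelian_quotient_above[OF p pP sV VsP]) blast
    note sW = W(1)
    note memP = sub_mem[OF sP]
    let ?P = "G\<lparr>carrier := P\<rparr>"
    let ?A = "?P Mod W"
    let ?h = "\<lambda>x. W #> x"
    interpret P: finite_group ?P using finite_group_sub[OF sP] .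
    interpret W: normal W ?P using W normal_restrict_iff[OF sP] by blast
    interpret A: group ?A by (rule W.factorgroup_is_group)
    have h: "?h \<in> hom ?P ?A" using W.r_coset_hom_Mod by simp
    have hP: "?h x \<in> carrier ?A" if "x \<in> P" for x using h that by (auto simp: hom_def)
    have hm: "?h (x \<otimes> y) = ?h x \<otimes>\<^bsub>?A\<^esub> ?h y" if "x \<in> P" "y \<in> P" for x y
      using h that unfolding hom_def by simp
    have hpow: "?h (x [^] n) = ?h x [^]\<^bsub>?A\<^esub> (n::nat)" if "x \<in> P" for x n
      using W.FactGroup_pow[of x n] that by (simp add: nat_pow_consistent[symmetric])
    have hW: "?h x = W \<longleftrightarrow> x \<in> W" if "x \<in> P" for x
      using coset_join1[OF _ memP[OF that] sW] coset_join2[OF memP[OF that] sW] by blast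
    have surj: "\<exists>y\<in>P. a = ?h y" if "a \<in> carrier ?A" for a
      using that by (auto simp: carrier_FactGroup)
    have hcomm: "?h (x \<otimes> y) = ?h (y \<otimes> x)" if xy: "x \<in> P" "y \<in> P" for x y
    proof -
      have "x \<otimes> y \<otimes> inv (y \<otimes> x) \<in> W"
        using comm memP xy by (simp add: group_word_simps)
      then have "x \<otimes> y \<in> W #> (y \<otimes> x)"
        using subgroup.rcos_module_rev[OF sW is_group] memP xy by simp
      then show ?thesis using repr_independence sW memP xy by (metis m_closed)
    qed
    have commA: "comm_group ?A"
    proof (rule A.group_comm_groupI)
      fix a b assume "a \<in> carrier ?A" "b \<in> carrier ?A"
      then obtain x y where "x \<in> P" "y \<in> P" "a = ?h x" "b = ?h y" using surj by blast
      then show "a \<otimes>\<^bsub>?A\<^esub> b = b \<otimes>\<^bsub>?A\<^esub> a" using hm hcomm by metis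
    qed
    have hV: "?h v = \<one>\<^bsub>?A\<^esub>" if "v \<in> V" for v using hW W that by auto
    \<comment> \<open>\<open>c\<close> centralizes \<open>P\<close>, and conjugation by
      \<open>u\<close> in \<open>P\<close> is trivial on the abelian quotient
      \<open>P / W\<close>.\<close>
    have stable: "?h (g \<otimes> x \<otimes> inv g) = ?h x"
      if g: "g \<in> carrier G" "conj_set g P = P" and x: "x \<in> P" for g x
    proof -
      obtain u c where uc: "u \<in> P" "c \<in> carrier G" "g = u \<otimes> c" "c \<otimes> x = x \<otimes> c"
        using cent[OF g] x by blast
      have "g \<otimes> x \<otimes> inv g = u \<otimes> (c \<otimes> x) \<otimes> inv c \<otimes> inv u"
        unfolding uc(3) using uc(1,2) x memP by (simp add: group_word_simps)
      also have "\<dots> = u \<otimes> x \<otimes> inv u"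
        unfolding uc(4) using uc(1,2) x memP by (simp add: group_word_simps)
      finally have e: "g \<otimes> x \<otimes> inv g = u \<otimes> x \<otimes> inv u" .
      have ux: "u \<otimes> x \<in> P" "inv u \<in> P"
        using uc x subgroup.m_closed[OF sP] subgroup.m_inv_closed[OF sP] by auto
      have "?h (u \<otimes> x \<otimes> inv u) = ?h (inv u \<otimes> (u \<otimes> x))" by (rule hcomm[OF ux])
      then show ?thesis unfolding e using uc(1) x memP by (simp add: group_word_simps)
    qed
    obtain f k where f: "f \<in> hom G ?A" and k: "\<not> p dvd k"
      and fP: "\<forall>x\<in>P. f x = ?h x [^]\<^bsub>?A\<^esub> (k::nat)"
      by (rule transfer_TI[OF p P VP Vn TI commA h hV stable]) blast
    have fP': "f x = ?h (x [^] k)" if "x \<in> P" for x using fP hpow that by simp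
    interpret f: group_hom G ?A f using f A.group_axioms is_group by (simp add: group_hom_def group_hom_axioms_def)
    let ?K = "kernel G ?A f"
    have nK: "?K \<lhd> G" by (rule f.normal_kernel)
    have sK: "subgroup ?K G" using nK normal_imp_subgroup by blast
    have cop: "coprime k (card P)"
      using coprime_pi_number_prime[OF p k] pP unfolding pi_subgroup_iff by blast
    have inK: "x \<in> ?K \<longleftrightarrow> x \<in> carrier G \<and> f x = W" for x unfolding kernel_def by simp
    have KP: "?K \<inter> P = W"
    proof
      show "W \<subseteq> ?K \<inter> P"
      proof
        fix w assume w: "w \<in> W"
        then have wP: "w \<in> P" using W by blast
        have "f w = W" using fP'[OF wP] hW[OF pow_sub[OF sP wP]] pow_sub[OF sW w] by simp
        then show "w \<in> ?K \<inter> P" using inK memP[OF wP] wP by simp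
      qed
      show "?K \<inter> P \<subseteq> W"
      proof
        fix x assume x: "x \<in> ?K \<inter> P"
        then have xP: "x \<in> P" and "f x = W" using inK[of x] by auto
        then have 1: "x [^] k \<in> W" using fP'[OF xP] hW[OF pow_sub[OF sP xP]] by simp
        have 2: "x [^] card P \<in> W" using pow_card_eq_one[OF sP xP] subgroup.one_closed[OF sW] by simp
        show "x \<in> W" by (rule pow_coprime_mem[OF sW memP[OF xP] 1 2 cop])
      qed
    qed
    have "carrier G \<subseteq> ?K <#> P"
    proof
      fix g assume g: "g \<in> carrier G"
      then obtain y where y: "y \<in> P" "f g = ?h y" using surj f.hom_closed by blast
      obtain u where u: "y [^] (k * u) = y" using coprime_pow_root[OF sP y(1) cop] by blast
      have x: "y [^] u \<in> P" using pow_sub[OF sP y(1)] .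
      have "f (y [^] u) = ?h y"
        using fP'[OF x] u memP[OF y(1)] nat_pow_pow[of y u k] by (simp add: mult.commute)
      then have "f (g \<otimes> inv (y [^] u)) = \<one>\<^bsub>?A\<^esub>"
        using y g memP[OF x] A.r_inv[OF hP[OF y(1)]]
        by (simp add: f.hom_mult f.hom_inv del: mult_FactGroup one_FactGroup)
      then have "g \<otimes> inv (y [^] u) \<in> ?K" using inK g memP[OF x] by simp
      moreover have "g = (g \<otimes> inv (y [^] u)) \<otimes> y [^] u" using g memP[OF x] by (simp add: m_assoc)
      ultimately show "g \<in> ?K <#> P" using prod_mem_set_mult x by metis
    qed
    then have "?K <#> P = carrier G"
      using setmult_subset_G[OF subgroup.subset[OF sK] subgroup.subset[OF sP]] by blast
    then have ordK: "order G * card W = card ?K * card P"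
      using card_set_mult[OF sK sP] KP unfolding order_def by simp
    have WK: "W \<subseteq> ?K" using KP by blast
    note memK = sub_mem[OF sK]
    have "\<exists>L. L \<lhd> G\<lparr>carrier := ?K\<rparr> \<and> V \<subseteq> L \<and> card L * card W = card ?K * card V"
    proof (cases "W = V")
      case True
      interpret K: finite_group "G\<lparr>carrier := ?K\<rparr>" using finite_group_sub[OF sK] .
      show ?thesis using K.normal_self WK True by (intro exI[of _ ?K]) simp
    next
      case False
      interpret K: finite_group "G\<lparr>carrier := ?K\<rparr>" using finite_group_sub[OF sK] .
      have cjK: "K.conj_set g D = conj_set g D" if "g \<in> ?K" for g D
        unfolding K.conj_set_def conj_set_def using that m_inv_consistent[OF sK] by simp
      \<comment> \<open>An element of the kernel for which \<open>W\<close> and its conjugate meet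
        outside \<open>V\<close> normalizes \<open>P\<close>. As the kernel is normal and meets
        \<open>P\<close> in \<open>W\<close>, it then normalizes \<open>W\<close> as well.\<close>
      have liftTI: "conj_set g P = P" if g: "g \<in> ?K" and "\<not> W \<inter> conj_set g W \<subseteq> V" for g
      proof (rule TI[OF memK[OF g]])
        show "\<not> P \<inter> conj_set g P \<subseteq> V" using that W conj_mono[of W P g] by blast
      qed
      have cW: "conj_set g W = W" if g: "g \<in> ?K" and "conj_set g P = P" for g
      proof (rule conj_sub_eq[OF memK[OF g]])
        have "conj_set g W \<subseteq> ?K" using normal_conj[OF nK memK[OF g]] WK unfolding conj_set_def by blast
        moreover have "conj_set g W \<subseteq> P" using conj_mono[of W P g] W that by blast
        ultimately show "conj_set g W \<subseteq> W" using KP by blast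
      qed (use subgroup.subset[OF sW] in auto)
      show ?thesis
      proof (rule IH[OF sK])
        show "card W < card P" using W finite_sub[OF sP] psubset_card_mono by blast
        have "card ?K div card W = order G div card P"
          using ordK card_sub_dvd[OF sW sK WK] card_dvd_order[OF sP] card_sub_pos[OF sW] card_sub_pos[OF sP]
          by (metis div_mult_mult2 dvd_div_mult_self less_numeral_extra(3) mult.commute nonzero_mult_div_cancel_left)
        then have syl: "sylow_subgroup p W (G\<lparr>carrier := ?K\<rparr>)"
          using K.sylow_iff[OF p] sub_restrict_iff[OF sK] sW WK sylowD[OF p P]
            pi_subgroup_subset[OF pP sW] W unfolding pi_subgroup_iff by (auto simp: order_def)
        have Vn': "V \<lhd> G\<lparr>carrier := ?K\<rparr>" using normal_restrict_supergroup[OF sK Vn] W WK by blast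
        have TI': "K.conj_set g W = W" if g: "g \<in> ?K" and "\<not> W \<inter> K.conj_set g W \<subseteq> V" for g
          using cW[OF g] liftTI[OF g] cjK[OF g] that by simp
        have "\<exists>u\<in>W. \<exists>c\<in>?K. \<exists>m::nat. t = u \<otimes> c \<and> (\<forall>x\<in>W. c \<otimes> x = x \<otimes> c) \<and> c [^] m = \<one> \<and> \<not> p dvd m"
          if t: "t \<in> ?K" and tW: "K.conj_set t W = W" for t
        proof -
          \<comment> \<open>\<open>W\<close> is not contained in \<open>V\<close>, so an element of
            the kernel normalizing \<open>W\<close> also normalizes \<open>P\<close>.\<close>
          have "conj_set t P = P" using liftTI[OF t] cjK[OF t] False W tW by simp
          from cent[OF memK[OF t] this] obtain u c m where uc: "u \<in> P" "c \<in> carrier G" "t = u \<otimes> c"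
            "\<forall>x\<in>P. c \<otimes> x = x \<otimes> c" "c [^] (m::nat) = \<one>" "\<not> p dvd m" by blast
          \<comment> \<open>The order of \<open>c\<close> is prime to p and the target of the
            transfer is a p-group, so \<open>c\<close> lies in the kernel; hence so does
            \<open>u\<close>.\<close>
          have "f c = \<one>\<^bsub>?A\<^esub>"
          proof -
            obtain y where y: "y \<in> P" "f c = ?h y" using surj f.hom_closed uc(2) by blast
            have "f (c [^] m) = f c [^]\<^bsub>?A\<^esub> m" using f.hom_nat_pow[OF uc(2)] .
            then have "?h (y [^] m) = W" using hpow y uc(5) f.hom_one by simp
            then have 1: "y [^] m \<in> W" using hW pow_sub[OF sP y(1)] by blast
            have 2: "y [^] card P \<in> W" using pow_card_eq_one[OF sP y(1)] subgroup.one_closed[OF sW] by simp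
            have "coprime m (card P)"
              using coprime_pi_number_prime[OF p uc(6)] pP unfolding pi_subgroup_iff by blast
            then have "y \<in> W" using pow_coprime_mem[OF sW memP[OF y(1)] 1 2] by blast
            then show ?thesis using y hW by simp
          qed
          then have cK: "c \<in> ?K" using inK uc(2) by simp
          have "u = t \<otimes> inv c" using uc(1-3) memP by (simp add: group_word_simps)
          then have "u \<in> ?K" using subgroup.m_closed[OF sK t subgroup.m_inv_closed[OF sK cK]] by simp
          then have "u \<in> W" using uc(1) KP by blast
          then show ?thesis using uc cK W(3) by blast
        qed
        then show "TI_mod (G\<lparr>carrier := ?K\<rparr>) p W V"
          unfolding TI_mod_def using p syl Vn' W(2) TI' by (simp add: nat_pow_consistent[symmetric])
      qed
    qed
    then obtain L where L: "L \<lhd> G\<lparr>carrier := ?K\<rparr>" "V \<subseteq> L" "card L * card W = card ?K * card V" by blast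
    have sL: "subgroup L G" and LK: "L \<subseteq> ?K" and nL: "normalizes ?K L"
      using L normal_restrict_iff[OF sK] by blast+
    note pos = card_sub_pos[OF sL] card_sub_pos[OF sW] card_sub_pos[OF sP] card_sub_pos[OF sV] card_sub_pos[OF sK]
    have "card L * card P * card W = order G * card V * card W"
      using L(3) ordK by (metis (no_types, lifting) mult.assoc mult.commute)
    then have ordL: "card L * card P = order G * card V" using pos by simp
    \<comment> \<open>\<open>L / V\<close> is a normal p'-subgroup of \<open>?K / V\<close> with
      p-power index. So it consists of all elements of order prime to p, a set that conjugation by
      \<open>G\<close> preserves.\<close>
    have "L \<lhd> G"
      unfolding normal_iff normalizes_def
    proof (intro conjI ballI sL)
      fix g l assume g: "g \<in> carrier G" and l: "l \<in> L"
      have lc: "l \<in> carrier G" using sub_mem[OF sL l] .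
      have "l [^] (card L div card V) \<in> V"
        by (rule pow_index_mem[OF sV sL L(2) _ l])
          (use Vn normal_iff normalizes_mono subgroup.subset[OF sL] in blast)
      then have "(g \<otimes> l \<otimes> inv g) [^] (card L div card V) \<in> L"
        unfolding conj_pow[OF g lc] using normal_conj[OF Vn g] L(2) by blast
      moreover have "g \<otimes> l \<otimes> inv g \<in> ?K" using normal_conj[OF nK g] l LK by blast
      moreover have "coprime (card L div card V) (card ?K div card L)"
      proof -
        obtain a where a: "card L = card V * a" using card_sub_dvd[OF sV sL L(2)] by (metis dvdE)
        obtain b where b: "card ?K = card L * b" using card_sub_dvd[OF sL sK LK] by (metis dvdE)
        obtain c where c: "order G = card P * c" using card_dvd_order[OF sP] by (metis dvdE)
        have "a = c" using ordL a c pos by simp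
        moreover have "c = order G div card P" using c pos by simp
        ultimately have na: "\<not> p dvd a" using sylowD(3)[OF p P] by simp
        have "card W = card V * b" using L(3) b pos by simp
        then have "pi_number {p} b"
          using pi_subgroup_subset[OF pP sW] W unfolding pi_subgroup_iff
          by (metis dvd_triv_right pi_number_dvd psubset_imp_subset)
        then have "coprime a b" using coprime_pi_number_prime[OF p na] by blast
        then show ?thesis using a b pos by simp
      qed
      ultimately show "g \<otimes> l \<otimes> inv g \<in> L"
        using coprime_index_mem[OF sL sK LK nL] by blast
    qed
    then show ?thesis using L(2) ordL by blast
  qed
qed

end

text \<open>The equation gives \<open>L / V\<close> the order of the index of \<open>P\<close> in
  \<open>G\<close>, so \<open>L / V\<close> is a normal p-complement of
  \<open>G / V\<close>.\<close>

theorem TI_normal_complement: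
  assumes "finite_group G" "TI_mod G p P V"
  shows "\<exists>L. L \<lhd> G \<and> V \<subseteq> L \<and> card L * card P = order G * card V"
  using assms
proof (induction "card P" arbitrary: G P rule: less_induct)
  case less
  show ?case
  proof (rule finite_group.TI_normal_complement_step[OF less.prems])
    fix K W assume "subgroup K G" "card W < card P" "TI_mod (G\<lparr>carrier := K\<rparr>) p W V"
    then show "\<exists>L. L \<lhd> G\<lparr>carrier := K\<rparr> \<and> V \<subseteq> L \<and> card L * card W = card K * card V"
      using less.hyps finite_group.finite_group_sub[OF less.prems(1)] by (fastforce simp: order_def)
  qed
qed

section \<open>Schur-Zassenhaus for nilpotent normal Hall subgroups\<close>

text \<open>One \<open>v\<close> works for all \<open>c\<close>: hence if the product of the \<open>h (a i)\<close> is trivial, it stays trivial when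
  all \<open>a i\<close> are conjugated by the same element.\<close>
lemma (in comm_group) finprod_mult_eq_hom:
  assumes "finite E" and V: "subgroup V H" "group H" and h: "h \<in> hom (H\<lparr>carrier := V\<rparr>) G"
    and a: "\<And>i. i \<in> E \<Longrightarrow> a i \<in> V"
  shows "\<exists>v\<in>V. \<forall>c. (\<forall>x\<in>V. c x \<in> V) \<and> (\<forall>x\<in>V. \<forall>y\<in>V. c (x \<otimes>\<^bsub>H\<^esub> y) = c x \<otimes>\<^bsub>H\<^esub> c y) \<longrightarrow>
    finprod G (\<lambda>i. h (c (a i))) E = h (c v)"
  using \<open>finite E\<close> a
proof (induction E)
  case empty
  have one: "h \<one>\<^bsub>H\<^esub> = \<one>"
    using hom_one[OF h group.subgroup_imp_group[OF V(2,1)] is_group] by simp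
  have c1: "c \<one>\<^bsub>H\<^esub> = \<one>\<^bsub>H\<^esub>" if c: "\<forall>x\<in>V. c x \<in> V" "\<forall>x\<in>V. \<forall>y\<in>V. c (x \<otimes>\<^bsub>H\<^esub> y) = c x \<otimes>\<^bsub>H\<^esub> c y" for c
  proof -
    have 1: "\<one>\<^bsub>H\<^esub> \<in> V" using subgroup.one_closed[OF V(1)] .
    interpret H: group H by fact
    have m: "c \<one>\<^bsub>H\<^esub> \<in> carrier H" using c(1) 1 subgroup.mem_carrier[OF V(1)] by blast
    have "c (\<one>\<^bsub>H\<^esub> \<otimes>\<^bsub>H\<^esub> \<one>\<^bsub>H\<^esub>) = c \<one>\<^bsub>H\<^esub> \<otimes>\<^bsub>H\<^esub> c \<one>\<^bsub>H\<^esub>" using c(2) 1 by blast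
    then show ?thesis using m by (simp add: H.l_cancel_one')
  qed
  show ?case
  proof (intro bexI[of _ "\<one>\<^bsub>H\<^esub>"] allI impI)
    fix c assume "(\<forall>x\<in>V. c x \<in> V) \<and> (\<forall>x\<in>V. \<forall>y\<in>V. c (x \<otimes>\<^bsub>H\<^esub> y) = c x \<otimes>\<^bsub>H\<^esub> c y)"
    then have "c \<one>\<^bsub>H\<^esub> = \<one>\<^bsub>H\<^esub>" using c1[of c] by blast
    then show "finprod G (\<lambda>i. h (c (a i))) {} = h (c \<one>\<^bsub>H\<^esub>)" using one by simp
  qed (rule subgroup.one_closed[OF V(1)])
next
  case (insert i E)
  then obtain v where v: "v \<in> V" and IH: "\<forall>c. (\<forall>x\<in>V. c x \<in> V) \<and> (\<forall>x\<in>V. \<forall>y\<in>V. c (x \<otimes>\<^bsub>H\<^esub> y) = c x \<otimes>\<^bsub>H\<^esub> c y) \<longrightarrow>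
    finprod G (\<lambda>i. h (c (a i))) E = h (c v)" by auto
  have ai: "a i \<in> V" using insert by simp
  have hV: "h x \<in> carrier G" if "x \<in> V" for x using h that by (auto simp: hom_def)
  have hm: "h (x \<otimes>\<^bsub>H\<^esub> y) = h x \<otimes> h y" if "x \<in> V" "y \<in> V" for x y using h that by (auto simp: hom_def)
  show ?case
  proof (intro bexI[of _ "a i \<otimes>\<^bsub>H\<^esub> v"] allI impI)
    fix c assume c: "(\<forall>x\<in>V. c x \<in> V) \<and> (\<forall>x\<in>V. \<forall>y\<in>V. c (x \<otimes>\<^bsub>H\<^esub> y) = c x \<otimes>\<^bsub>H\<^esub> c y)"
    have "finprod G (\<lambda>i. h (c (a i))) (insert i E) = h (c (a i)) \<otimes> finprod G (\<lambda>i. h (c (a i))) E"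
      using insert(1,2) hV c insert.prems by (intro finprod_insert) auto
    also have "\<dots> = h (c (a i)) \<otimes> h (c v)" using IH c by simp
    also have "\<dots> = h (c (a i \<otimes>\<^bsub>H\<^esub> v))" using hm c ai v by simp
    finally show "finprod G (\<lambda>i. h (c (a i))) (insert i E) = h (c (a i \<otimes>\<^bsub>H\<^esub> v))" .
  qed (rule subgroup.m_closed[OF V(1) ai v])
qed

section \<open>Complements of a normal Sylow subgroup modulo its derived subgroup\<close>

context finite_group
begin

text \<open>\<open>K\<close> is the stabilizer of the class of a transversal \<open>t\<close> of \<open>V\<close>, where two transversals are
  identified if the product of their quotients vanishes in \<open>V / V'\<close> (Wielandt).\<close>
lemma complement_modulo_derived:
  assumes p: "prime p" and P: "sylow_subgroup p V G" and Vn: "V \<lhd> G"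
  obtains K where "subgroup K G" "V \<inter> K = derived G V" "order G * card (derived G V) = card V * card K"
proof -
  let ?D = "derived G V"
  have sV: "subgroup V G" and pV: "pi_subgroup {p} V G" using sylowD[OF p P] by blast+
  have sub: "V \<subseteq> carrier G" using sV subgroup.subset by blast
  have nD: "?D \<lhd> G" using derived_is_normal[OF Vn] .
  have sD: "subgroup ?D G" using nD normal_imp_subgroup by blast
  have DV: "?D \<subseteq> V" using derived_incl[OF subset_refl sV] .
  let ?V = "G\<lparr>carrier := V\<rparr>"
  let ?A = "?V Mod ?D"
  let ?h = "\<lambda>x. ?D #> x"
  interpret V: finite_group ?V using finite_group_sub[OF sV] .
  interpret D: normal ?D ?V using derived_subgroup_is_normal[OF sV] .
  interpret A: comm_group ?A using derived_quot_of_subgroup_is_comm_group[OF sV] .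
  note memV = sub_mem[OF sV]
  have h: "?h \<in> hom ?V ?A" using D.r_coset_hom_Mod by simp
  have hV: "?h x \<in> carrier ?A" if "x \<in> V" for x using h that by (auto simp: hom_def)
  have hm: "?h (x \<otimes> y) = ?h x \<otimes>\<^bsub>?A\<^esub> ?h y" if "x \<in> V" "y \<in> V" for x y
    using h that unfolding hom_def by simp
  have hpow: "?h (x [^] n) = ?h x [^]\<^bsub>?A\<^esub> (n::nat)" if "x \<in> V" for x n
    using D.FactGroup_pow[of x n] that by (simp add: nat_pow_consistent[symmetric])
  have hD: "?h x = ?D \<longleftrightarrow> x \<in> ?D" if "x \<in> V" for x
    using coset_join1[OF _ memV[OF that] sD] coset_join2[OF memV[OF that] sD] by blast
  have surj: "\<exists>y\<in>V. a = ?h y" if "a \<in> carrier ?A" for a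
    using that by (auto simp: carrier_FactGroup)
  let ?E = "rcosets V"
  have finE: "finite ?E" using fin_carrier rcosets_finite rcosets_part_G[OF sV] finite_UnionD by metis
  have Csub: "C \<subseteq> carrier G" if "C \<in> ?E" for C
    using subgroup.rcosets_carrier[OF sV is_group that] .
  \<comment> \<open>Left translations permute the right cosets because \<open>V\<close> is
    normal.\<close>
  have lE: "g <# C \<in> ?E" if cg: "C \<in> ?E" "g \<in> carrier G" for C g
  proof -
    obtain k where k: "C = V #> k" "k \<in> carrier G" using cg(1) unfolding RCOSETS_def by blast
    have "g <# C = (g <# V) #> k" unfolding k(1) using coset_assoc[OF that(2) k(2) sub] .
    also have "\<dots> = (V #> g) #> k" using normal.coset_eq[OF Vn] that(2) by simp
    also have "\<dots> = V #> (g \<otimes> k)" using coset_mult_assoc sub that(2) k(2) by blast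
    finally show ?thesis using rcosetsI[OF sub] that(2) k(2) by simp
  qed
  have lV: "v <# C = C" if cv: "C \<in> ?E" "v \<in> V" for C v
  proof -
    obtain k where k: "C = V #> k" "k \<in> carrier G" using cv(1) unfolding RCOSETS_def by blast
    show ?thesis unfolding k(1) using coset_assoc[OF memV[OF that(2)] k(2) sub]
      coset_join3[OF memV[OF that(2)] sV that(2)] by simp
  qed
  define T where "T = {s. \<forall>C\<in>?E. s C \<in> C}"
  define act where "act g s C = g \<otimes> s (inv g <# C)" for g and s :: "'a set \<Rightarrow> 'a" and C
  define d where "d s r = finprod ?A (\<lambda>C. ?h (s C \<otimes> inv (r C))) ?E" for s r :: "'a set \<Rightarrow> 'a"
  have Tc: "s C \<in> carrier G" if "s \<in> T" "C \<in> ?E" for s C using that Csub unfolding T_def by blast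
  have TV: "s C \<otimes> inv (r C) \<in> V" if "s \<in> T" "r \<in> T" "C \<in> ?E" for s r C
    using diff_neutralizes[OF sV that(3)] that unfolding T_def by blast
  have lcos_back: "g <# (inv g <# C) = C" "inv g <# (g <# C) = C" if "C \<in> ?E" "g \<in> carrier G" for C g
    using Csub[OF that(1)] that(2) by (simp_all add: lcos_m_assoc lcos_mult_one)
  have actT: "act g s \<in> T" if "s \<in> T" "g \<in> carrier G" for g s
    unfolding T_def
  proof (intro CollectI ballI)
    fix C assume C: "C \<in> ?E"
    have "s (inv g <# C) \<in> inv g <# C" using that(1) lE[OF C] that(2) unfolding T_def by simp
    then have "g \<otimes> s (inv g <# C) \<in> g <# (inv g <# C)" unfolding l_coset_def by blast
    then show "act g s C \<in> C" unfolding act_def using lcos_back[OF C that(2)] by simp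
  qed
  have dA: "d s r \<in> carrier ?A" if "s \<in> T" "r \<in> T" for s r
    unfolding d_def using hV TV that by (intro A.finprod_closed) blast
  have d_trans: "d s r \<otimes>\<^bsub>?A\<^esub> d r q = d s q" if s: "s \<in> T" and r: "r \<in> T" and q: "q \<in> T" for s r q
  proof -
    have "d s q = finprod ?A (\<lambda>C. ?h (s C \<otimes> inv (r C)) \<otimes>\<^bsub>?A\<^esub> ?h (r C \<otimes> inv (q C))) ?E"
      unfolding d_def
    proof (rule A.finprod_cong')
      fix C assume C: "C \<in> ?E"
      have "s C \<otimes> inv (q C) = (s C \<otimes> inv (r C)) \<otimes> (r C \<otimes> inv (q C))"
        using Tc[OF s C] Tc[OF r C] Tc[OF q C] by (simp add: group_word_simps)
      then show "?h (s C \<otimes> inv (q C)) = ?h (s C \<otimes> inv (r C)) \<otimes>\<^bsub>?A\<^esub> ?h (r C \<otimes> inv (q C))"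
        using hm[OF TV[OF s r C] TV[OF r q C]] by simp
    qed (use hV TV s r q in \<open>auto simp del: mult_FactGroup\<close>)
    also have "\<dots> = d s r \<otimes>\<^bsub>?A\<^esub> d r q"
      unfolding d_def by (rule A.finprod_multf) (use hV TV s r q in auto)
    finally show ?thesis by simp
  qed
  \<comment> \<open>Acting by \<open>g\<close> permutes the cosets and conjugates every quotient of
    \<open>s\<close> and \<open>r\<close>. The single element \<open>v\<close> carries the whole
    product, and it stays in the derived subgroup under conjugation because that is normal in
    \<open>G\<close>.\<close>
  have d_act: "d (act g s) (act g r) = \<one>\<^bsub>?A\<^esub>"
    if g: "g \<in> carrier G" and s: "s \<in> T" and r: "r \<in> T" and 1: "d s r = \<one>\<^bsub>?A\<^esub>" for g s r
  proof -
    let ?a = "\<lambda>C. s C \<otimes> inv (r C)"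
    let ?c = "\<lambda>x. g \<otimes> x \<otimes> inv g"
    obtain v where v: "v \<in> V" and ev: "\<forall>c. (\<forall>x\<in>V. c x \<in> V) \<and> (\<forall>x\<in>V. \<forall>y\<in>V. c (x \<otimes> y) = c x \<otimes> c y) \<longrightarrow>
        finprod ?A (\<lambda>i. ?h (c (?a i))) ?E = ?h (c v)"
      using A.finprod_mult_eq_hom[OF finE sV is_group h, of ?a] TV[OF s r] by blast
    have "?h v = ?D" using ev[rule_format, of "\<lambda>x. x"] 1 unfolding d_def by simp
    then have "?c v \<in> ?D" using hD[OF v] normal_conj[OF nD g] by blast
    then have hcv: "?h (?c v) = ?D" using hD[OF normal_conj[OF Vn g v]] by simp
    have cond: "(\<forall>x\<in>V. ?c x \<in> V) \<and> (\<forall>x\<in>V. \<forall>y\<in>V. ?c (x \<otimes> y) = ?c x \<otimes> ?c y)"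
      using normal_conj[OF Vn g] g memV by (auto simp: group_word_simps)
    have fin1: "finprod ?A (\<lambda>i. ?h (?c (?a i))) ?E = ?D"
      using mp[OF spec[OF ev, of ?c] cond] hcv by simp
    have Pi: "(\<lambda>i. ?h (?c (?a i))) \<in> ?E \<rightarrow> carrier ?A" using hV normal_conj[OF Vn g] TV[OF s r] by blast
    have im: "(\<lambda>C. inv g <# C) ` ?E = ?E"
    proof
      show "?E \<subseteq> (\<lambda>C. inv g <# C) ` ?E"
      proof
        fix C assume "C \<in> ?E"
        then show "C \<in> (\<lambda>C. inv g <# C) ` ?E" using lcos_back(2)[OF _ g] lE[OF _ g] by (metis imageI)
      qed
    qed (use lE g in auto)
    have inj: "inj_on (\<lambda>C. inv g <# C) ?E"
      by (rule inj_onI) (metis lcos_back(1) g)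
    have "d (act g s) (act g r) = finprod ?A (\<lambda>C. ?h (?c (?a (inv g <# C)))) ?E"
      unfolding d_def
    proof (rule A.finprod_cong')
      show "(\<lambda>C. ?h (?c (?a (inv g <# C)))) \<in> ?E \<rightarrow> carrier ?A" using Pi lE g by auto
      fix C assume C: "C \<in> ?E"
      have C': "inv g <# C \<in> ?E" using lE[OF C] g by simp
      have "act g s C \<otimes> inv (act g r C) = ?c (?a (inv g <# C))"
        unfolding act_def using Tc[OF s C'] Tc[OF r C'] g by (simp add: group_word_simps)
      then show "?h (act g s C \<otimes> inv (act g r C)) = ?h (?c (?a (inv g <# C)))" by simp
    qed simp
    also have "\<dots> = finprod ?A (\<lambda>C. ?h (?c (?a C))) ?E"
      using A.finprod_reindex[of "\<lambda>C. ?h (?c (?a C))" "\<lambda>C. inv g <# C" ?E] Pi im inj by simp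
    finally show ?thesis using fin1 by simp
  qed
  \<comment> \<open>An element of \<open>V\<close> fixes every coset and so contributes once for
    each. As the number of cosets is prime to p, only elements of the derived subgroup fix the class
    of \<open>s\<close>, and all classes are reached from it.\<close>
  have d_V: "d (act v s) s = ?h (v [^] card ?E)" if v: "v \<in> V" and s: "s \<in> T" for v s
  proof -
    have "d (act v s) s = finprod ?A (\<lambda>C. ?h v) ?E"
      unfolding d_def
    proof (rule A.finprod_cong')
      fix C assume C: "C \<in> ?E"
      have "act v s C = v \<otimes> s C" unfolding act_def using lV[OF C subgroup.m_inv_closed[OF sV v]] by simp
      then show "?h (act v s C \<otimes> inv (s C)) = ?h v" using Tc[OF s C] memV[OF v] by (simp add: m_assoc)
    qed (use hV v in auto)
    then show ?thesis using A.finprod_const[OF hV[OF v]] hpow[OF v] by simp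
  qed
  have act_mult: "act (g \<otimes> k) s C = act g (act k s) C"
    if "g \<in> carrier G" "k \<in> carrier G" "s \<in> T" "C \<in> ?E" for g k s C
  proof -
    have e: "inv (g \<otimes> k) <# C = inv k <# (inv g <# C)"
      using that Csub[OF that(4)] by (simp add: inv_mult_group lcos_m_assoc)
    have "s (inv k <# (inv g <# C)) \<in> carrier G" using Tc[OF that(3)] lE that by simp
    then show ?thesis unfolding act_def e using that by (simp add: m_assoc)
  qed
  have d_cong: "d s r = d s' r" if "s' \<in> T" "r \<in> T" "\<And>C. C \<in> ?E \<Longrightarrow> s C = s' C" for s s' r
    unfolding d_def by (rule A.finprod_cong') (use hV TV that in auto)
  define t where "t C = (SOME z. z \<in> C)" for C :: "'a set"
  have t: "t \<in> T"
    unfolding T_def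
  proof (intro CollectI ballI)
    fix C assume "C \<in> ?E"
    then have "C \<noteq> {}" using subgroup.rcosets_non_empty[OF sV] by blast
    then show "t C \<in> C" unfolding t_def by (simp add: some_in_eq)
  qed
  let ?K = "{g \<in> carrier G. d (act g t) t = ?D}"
  have VK: "v \<in> ?K \<longleftrightarrow> v [^] card ?E \<in> ?D" if "v \<in> V" for v
    using d_V[OF that t] hD[OF pow_sub[OF sV that]] memV[OF that] by simp
  have sK: "subgroup ?K G"
  proof (rule sub_finiteI)
    show "\<one> \<in> ?K" using VK[OF subgroup.one_closed[OF sV]] subgroup.one_closed[OF sD] by simp
    fix g k assume gk: "g \<in> ?K" "k \<in> ?K"
    then have c: "g \<in> carrier G" "k \<in> carrier G" by auto
    have "d (act (g \<otimes> k) t) t = d (act g (act k t)) t"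
      by (rule d_cong) (use act_mult c t actT in auto)
    also have "\<dots> = d (act g (act k t)) (act g t) \<otimes>\<^bsub>?A\<^esub> d (act g t) t"
      using d_trans[of "act g (act k t)" "act g t" t] actT c t by simp
    also have "d (act g (act k t)) (act g t) = \<one>\<^bsub>?A\<^esub>"
      by (rule d_act) (use actT c t gk in auto)
    also have "d (act g t) t = \<one>\<^bsub>?A\<^esub>" using gk by simp
    finally show "g \<otimes> k \<in> ?K" using c A.l_one[OF A.one_closed] by simp
  qed auto
  have "card ?E * card V = order G" using lagrange[OF sV] .
  then have "\<not> p dvd card ?E"
    using sylowD(3)[OF p P] card_sub_pos[OF sV] by (metis nonzero_mult_div_cancel_right less_numeral_extra(3))
  then have cop: "coprime (card ?E) (card V)"
    using coprime_pi_number_prime[OF p] pV unfolding pi_subgroup_iff by blast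
  have VK_eq: "V \<inter> ?K = ?D"
  proof
    show "?D \<subseteq> V \<inter> ?K"
    proof
      fix x assume x: "x \<in> ?D"
      then have "x \<in> V" using DV by blast
      then show "x \<in> V \<inter> ?K" using VK[of x] pow_sub[OF sD x] by blast
    qed
    show "V \<inter> ?K \<subseteq> ?D"
    proof
      fix x assume "x \<in> V \<inter> ?K"
      then have x: "x \<in> V" and 1: "x [^] card ?E \<in> ?D" using VK by auto
      have 2: "x [^] card V \<in> ?D" using pow_card_eq_one[OF sV x] subgroup.one_closed[OF sD] by simp
      show "x \<in> ?D" by (rule pow_coprime_mem[OF sD memV[OF x] 1 2 cop])
    qed
  qed
  \<comment> \<open>Frattini argument: some element of \<open>V\<close> moves the class of
    \<open>act g t\<close> back to that of \<open>t\<close>.\<close>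
  have "carrier G \<subseteq> V <#> ?K"
  proof
    fix g assume g: "g \<in> carrier G"
    have gt: "act g t \<in> T" using actT[OF t g] .
    obtain y where y: "y \<in> V" "d (act g t) t = ?h y" using surj[OF dA[OF gt t]] by blast
    have iy: "inv y \<in> V" using subgroup.m_inv_closed[OF sV y(1)] .
    obtain u where u: "inv y [^] (card ?E * u) = inv y" using coprime_pow_root[OF sV iy cop] by blast
    let ?v = "inv y [^] u"
    have v: "?v \<in> V" using pow_sub[OF sV iy] .
    have vc: "?v \<in> carrier G" using memV[OF v] .
    have vm: "?v [^] card ?E = inv y" using u memV[OF iy] by (simp add: nat_pow_pow mult.commute)
    have "d (act (?v \<otimes> g) t) t = d (act ?v (act g t)) t"
      by (rule d_cong) (use act_mult g vc t actT in auto)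
    also have "\<dots> = d (act ?v (act g t)) (act g t) \<otimes>\<^bsub>?A\<^esub> d (act g t) t"
      using d_trans[OF actT[OF gt vc] gt t] by simp
    also have "\<dots> = ?h (inv y) \<otimes>\<^bsub>?A\<^esub> ?h y" unfolding d_V[OF v gt] vm y(2) ..
    also have "\<dots> = ?h (inv y \<otimes> y)" using hm[OF iy y(1)] by simp
    also have "\<dots> = ?D" using memV[OF y(1)] subgroup.subset[OF sD] by simp
    finally have "?v \<otimes> g \<in> ?K" using vc g by simp
    then have "inv ?v \<otimes> (?v \<otimes> g) \<in> V <#> ?K"
      by (rule prod_mem_set_mult[OF subgroup.m_inv_closed[OF sV v]])
    then show "g \<in> V <#> ?K" unfolding l_inv_cancel[OF vc g] .
  qed
  then have "V <#> ?K = carrier G"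
    using setmult_subset_G[OF sub subgroup.subset[OF sK]] by blast
  then have "order G * card ?D = card V * card ?K"
    using card_set_mult[OF sV sK] VK_eq unfolding order_def by simp
  then show thesis using that[OF sK VK_eq] by blast
qed

lemma derived_sylow_psubset:
  assumes p: "prime p" and V: "pi_subgroup {p} V G" and "V \<noteq> {\<one>}"
  shows "derived G V \<subset> V"
proof -
  have sV: "subgroup V G" using V pi_subgroup_iff by blast
  have "{\<one>} \<subset> V" using subgroup.one_closed[OF sV] assms(3) by blast
  then obtain W where W: "subgroup W G" "W \<subset> V" "\<forall>x\<in>V. \<forall>y\<in>V. x \<otimes> y \<otimes> inv x \<otimes> inv y \<in> W"
    using abelian_quotient_above[OF p V triv_subgroup] by metis
  have "derived G V \<subseteq> W"
    unfolding derived_def by (rule generate_subgroup_incl[OF _ W(1)]) (use W(3) in auto)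
  then show ?thesis using W(2) by blast
qed

text \<open>The index of \<open>S \<inter> K\<close> in \<open>K\<close> is that of \<open>S\<close>
  in \<open>S <#> K\<close>, hence divides the index of \<open>S\<close> in
  \<open>G\<close>.\<close>

lemma normal_sylow_restrict:
  assumes q: "prime q" and S: "sylow_subgroup q S G" "S \<lhd> G" and K: "subgroup K G"
  shows "sylow_subgroup q (S \<inter> K) (G\<lparr>carrier := K\<rparr>)" "S \<inter> K \<lhd> G\<lparr>carrier := K\<rparr>"
proof -
  interpret K: finite_group "G\<lparr>carrier := K\<rparr>" using finite_group_sub[OF K] .
  have sS: "subgroup S G" and pS: "pi_subgroup {q} S G" and nd: "\<not> q dvd order G div card S"
    using sylowD[OF q S(1)] by blast+
  have nS: "normalizes (carrier G) S" using S(2) normal_iff by blast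
  have sI: "subgroup (S \<inter> K) G" using sub_Int sS K by blast
  have sSK: "subgroup (S <#> K) G"
    using sub_set_mult[OF sS K normalizes_mono[OF nS subgroup.subset[OF K]]] .
  obtain a where a: "card K = card (S \<inter> K) * a" using card_sub_dvd[OF sI K] by (metis Int_lower2 dvdE)
  obtain b where b: "card (S <#> K) = card S * b"
    using card_sub_dvd[OF sS sSK set_mult_upper(1)[OF sS K]] by (metis dvdE)
  note pos = card_sub_pos[OF sI] card_sub_pos[OF sS]
  have "a = b" using card_set_mult[OF sS K] a b pos by simp
  have "card S * b dvd order G" using card_dvd_order[OF sSK] b by simp
  then have "b dvd order G div card S" using pos by (metis dvd_div_iff_mult card_dvd_order[OF sS] less_numeral_extra(3) mult.commute)
  then have "\<not> q dvd a" using nd \<open>a = b\<close> dvd_trans by blast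
  moreover have "card K div card (S \<inter> K) = a" using a pos by simp
  ultimately show "sylow_subgroup q (S \<inter> K) (G\<lparr>carrier := K\<rparr>)"
    using K.sylow_iff[OF q] sub_restrict_iff[OF K] sI pi_subgroup_subset[OF pS sI]
    unfolding pi_subgroup_iff by (simp add: order_def)
  show "S \<inter> K \<lhd> G\<lparr>carrier := K\<rparr>"
    unfolding normal_restrict_iff[OF K] using sI nS sub_mem[OF K] K
    by (auto simp: normalizes_def subgroup.m_closed subgroup.m_inv_closed)
qed

end

text \<open>Passing to a complement modulo the derived subgroup costs an index that is a power of p
  and shrinks the Sylow p-subgroup, while the other normal Sylow subgroups are merely intersected
  with the complement. The descent ends when no prime of \<pi> divides the order.\<close>

theorem schur_zassenhaus_nilpotent:
  fixes G :: "('a, 'b) monoid_scheme"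
  assumes "finite_group G" "\<forall>p\<in>\<pi>. prime p" "\<forall>p\<in>\<pi>. \<exists>S. S \<lhd> G \<and> sylow_subgroup p S G"
  shows "\<exists>H. subgroup H G \<and> (\<forall>p\<in>\<pi>. \<not> p dvd card H) \<and> pi_number \<pi> (order G div card H)"
  using assms
proof (induction "order G" arbitrary: G rule: less_induct)
  case less
  interpret finite_group G by fact
  show ?case
  proof (cases "\<exists>p\<in>\<pi>. p dvd order G")
    case False
    moreover have "order G div order G = 1" using order_pos by (metis div_self less_numeral_extra(3))
    ultimately show ?thesis using subgroup_self
      by (intro exI[of _ "carrier G"]) (simp add: order_def)
  next
    case True
    then obtain p where p\<pi>: "p \<in> \<pi>" and pd: "p dvd order G" by blast
    then have p: "prime p" using less.prems by blast
    obtain V where V: "V \<lhd> G" "sylow_subgroup p V G" using less.prems p\<pi> by blast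
    have sV: "subgroup V G" and pV: "pi_subgroup {p} V G" using sylowD[OF p V(2)] by blast+
    have "V \<noteq> {\<one>\<^bsub>G\<^esub>}"
    proof
      assume "V = {\<one>\<^bsub>G\<^esub>}"
      then show False using sylowD(3)[OF p V(2)] pd by simp
    qed
    then have DV: "derived G V \<subset> V" using derived_sylow_psubset[OF p pV] by blast
    obtain K where K: "subgroup K G" "V \<inter> K = derived G V"
      "order G * card (derived G V) = card V * card K"
      using complement_modulo_derived[OF p V(2,1)] by blast
    interpret K: finite_group "G\<lparr>carrier := K\<rparr>" using finite_group_sub[OF K(1)] .
    have sD: "subgroup (derived G V) G" using K(1,2) sub_Int sV by metis
    note pos = card_sub_pos[OF sV] card_sub_pos[OF sD] card_sub_pos[OF K(1)]
    obtain a where a: "card V = card (derived G V) * a" using card_sub_dvd[OF sD sV] DV by (metis dvdE psubset_imp_subset)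
    have oa: "order G = a * card K" using K(3) a pos by simp
    have "a \<noteq> 1" using a psubset_card_mono[OF finite_sub[OF sV] DV] by auto
    then have "card K < order G" using oa order_pos pos by (metis One_nat_def Suc_lessI mult.commute mult_eq_0_iff n_less_m_mult_n neq0_conv)
    moreover have "\<forall>q\<in>\<pi>. \<exists>S. S \<lhd> G\<lparr>carrier := K\<rparr> \<and> sylow_subgroup q S (G\<lparr>carrier := K\<rparr>)"
      using normal_sylow_restrict[OF _ _ _ K(1)] less.prems(2,3) by meson
    ultimately obtain H where H: "subgroup H (G\<lparr>carrier := K\<rparr>)" "\<forall>p\<in>\<pi>. \<not> p dvd card H"
      "pi_number \<pi> (card K div card H)"
      using less.hyps[of "G\<lparr>carrier := K\<rparr>"] K.finite_group_axioms less.prems(2) by (auto simp: order_def)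
    have sH: "subgroup H G" "H \<subseteq> K" using H(1) sub_restrict_iff[OF K(1)] by blast+
    have "order G div card H = a * (card K div card H)"
      using oa div_mult_swap[OF card_sub_dvd[OF sH(1) K(1) sH(2)]] by simp
    moreover have "pi_number \<pi> a"
      using pV a p\<pi> unfolding pi_subgroup_iff
      by (metis dvd_triv_right empty_subsetI insert_subset pi_number_dvd pi_number_mono)
    ultimately show ?thesis using sH(1) H(2,3) pi_number_mult by metis
  qed
qed

section \<open>Sylow subgroups and normality\<close>

definition (in group) centralizer :: "'a set \<Rightarrow> 'a set" where
  "centralizer A = {x \<in> carrier G. \<forall>a\<in>A. x \<otimes> a = a \<otimes> x}"

text \<open>\<open>A\<close> is a conjugation-invariant set rather than a subgroup, because it will
  also be a union of several cores.\<close>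

lemma (in finite_group) centralizer_normal:
  assumes A: "A \<subseteq> carrier G" and cA: "\<And>g a. g \<in> carrier G \<Longrightarrow> a \<in> A \<Longrightarrow> g \<otimes> a \<otimes> inv g \<in> A"
  shows "centralizer A \<lhd> G"
proof -
  have "subgroup (centralizer A) G"
  proof (rule sub_finiteI)
    show "centralizer A \<subseteq> carrier G" unfolding centralizer_def by blast
    show "\<one> \<in> centralizer A" using A unfolding centralizer_def by auto
    fix x y assume x: "x \<in> centralizer A" and y: "y \<in> centralizer A"
    have "x \<otimes> y \<otimes> a = a \<otimes> (x \<otimes> y)" if a: "a \<in> A" for a
    proof -
      have m: "x \<in> carrier G" "y \<in> carrier G" "a \<in> carrier G" using x y a A unfolding centralizer_def by auto
      have "x \<otimes> y \<otimes> a = x \<otimes> (y \<otimes> a)" using m by (simp add: m_assoc)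
      also have "y \<otimes> a = a \<otimes> y" using y a unfolding centralizer_def by blast
      also have "x \<otimes> (a \<otimes> y) = (x \<otimes> a) \<otimes> y" using m by (simp add: m_assoc)
      also have "x \<otimes> a = a \<otimes> x" using x a unfolding centralizer_def by blast
      finally show ?thesis using m by (simp add: m_assoc)
    qed
    then show "x \<otimes> y \<in> centralizer A" using x y unfolding centralizer_def by simp
  qed
  moreover have "g \<otimes> x \<otimes> inv g \<in> centralizer A" if g: "g \<in> carrier G" and x: "x \<in> centralizer A" for g x
  proof -
    have xc: "x \<in> carrier G" using x unfolding centralizer_def by blast
    have "g \<otimes> x \<otimes> inv g \<otimes> a = a \<otimes> (g \<otimes> x \<otimes> inv g)" if a: "a \<in> A" for a
    proof -
      have ac: "a \<in> carrier G" using A a by blast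
      have "inv g \<otimes> a \<otimes> g \<in> A" using cA[of "inv g" a] g a by simp
      then have e: "x \<otimes> (inv g \<otimes> a \<otimes> g) = (inv g \<otimes> a \<otimes> g) \<otimes> x" using x unfolding centralizer_def by blast
      have "g \<otimes> x \<otimes> inv g \<otimes> a = g \<otimes> (x \<otimes> (inv g \<otimes> a \<otimes> g)) \<otimes> inv g"
        using g xc ac by (simp add: group_word_simps)
      also have "\<dots> = a \<otimes> (g \<otimes> x \<otimes> inv g)" unfolding e using g xc ac by (simp add: group_word_simps)
      finally show ?thesis .
    qed
    then show ?thesis using g xc unfolding centralizer_def by simp
  qed
  ultimately show ?thesis unfolding normal_iff normalizes_def by blast
qed

context finite_group
begin

lemma commutes_conj:
  assumes g: "g \<in> carrier G" and A: "A \<subseteq> carrier G" and B: "B \<subseteq> carrier G" and c: "commutes A B"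
  shows "commutes (conj_set g A) (conj_set g B)"
  unfolding commutes_def conj_set_def
proof (intro ballI, clarify)
  fix a b assume ab: "a \<in> A" "b \<in> B"
  then have m: "a \<in> carrier G" "b \<in> carrier G" and e: "a \<otimes> b = b \<otimes> a" using A B c unfolding commutes_def by auto
  have "(g \<otimes> a \<otimes> inv g) \<otimes> (g \<otimes> b \<otimes> inv g) = g \<otimes> (a \<otimes> b) \<otimes> inv g"
    using m g by (simp add: group_word_simps)
  also have "\<dots> = (g \<otimes> b \<otimes> inv g) \<otimes> (g \<otimes> a \<otimes> inv g)"
    unfolding e using m g by (simp add: group_word_simps)
  finally show "(g \<otimes> a \<otimes> inv g) \<otimes> (g \<otimes> b \<otimes> inv g) = (g \<otimes> b \<otimes> inv g) \<otimes> (g \<otimes> a \<otimes> inv g)" .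
qed

lemma commutes_le_normalizer:
  assumes "subgroup A G" "B \<subseteq> carrier G" "commutes A B"
  shows "B \<subseteq> normalizer G A"
  using normalizes_le_normalizer[OF assms(1,2)] commutes_normalizes[OF commutes_sym[OF assms(3)]]
    assms subgroup.subset by blast

lemma normalizes_set_mult:
  assumes N: "N \<lhd> G" and Q: "subgroup Q G" and R: "subgroup R G" and c: "commutes Q R"
  shows "normalizes R (N <#> Q)"
  unfolding normalizes_def
proof (intro ballI)
  fix x y assume x: "x \<in> R" and "y \<in> N <#> Q"
  then obtain v q where vq: "v \<in> N" "q \<in> Q" "y = v \<otimes> q" unfolding set_mult_def by blast
  have m: "x \<in> carrier G" "v \<in> carrier G" "q \<in> carrier G"
    using sub_mem[OF R x] sub_mem[OF normal_imp_subgroup[OF N] vq(1)] sub_mem[OF Q vq(2)] by auto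
  have e: "x \<otimes> q = q \<otimes> x" using commutes_sym[OF c] x vq(2) unfolding commutes_def by blast
  have "x \<otimes> y \<otimes> inv x = (x \<otimes> v \<otimes> inv x) \<otimes> ((x \<otimes> q) \<otimes> inv x)"
    unfolding vq(3) using m by (simp add: group_word_simps)
  also have "\<dots> = (x \<otimes> v \<otimes> inv x) \<otimes> q" unfolding e using m by (simp add: group_word_simps)
  finally have e2: "x \<otimes> y \<otimes> inv x = (x \<otimes> v \<otimes> inv x) \<otimes> q" .
  show "x \<otimes> y \<otimes> inv x \<in> N <#> Q"
    unfolding e2 by (rule prod_mem_set_mult[OF normal_conj[OF N m(1) vq(1)] vq(2)])
qed

section \<open>Indices, coprime orders and Hall subgroups\<close>

lemma sylow_maximal:
  assumes p: "prime p" and P: "sylow_subgroup p P G" and S: "pi_subgroup {p} S G" "P \<subseteq> S"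
  shows "S = P"
proof -
  obtain R where R: "sylow_subgroup p R G" "S \<subseteq> R" using sylow_above[OF p S(1)] by blast
  have "P = R" using sub_eqI[OF sylowD(1)[OF p P] sylowD(1)[OF p R(1)]] card_sylow[OF P R(1)] S(2) R(2) by blast
  then show ?thesis using S(2) R(2) by blast
qed

lemma index_dvd:
  assumes "subgroup A G" "subgroup B G" "A \<subseteq> B"
  shows "order G div card B dvd order G div card A"
proof -
  obtain a where a: "card B = card A * a" using card_sub_dvd[OF assms] by (metis dvdE)
  obtain b where b: "order G = card B * b" using card_dvd_order[OF assms(2)] by (metis dvdE)
  show ?thesis using a b card_sub_pos[OF assms(1)] card_sub_pos[OF assms(2)] by simp
qed

lemma index_pos: "subgroup A G \<Longrightarrow> order G div card A > 0"
  using card_dvd_order[of A] card_sub_pos[of A] order_pos by (metis dvd_imp_le div_greater_zero_iff)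

text \<open>A prime r does not divide the index of a subgroup containing a Sylow r-subgroup. Applied
  to normalizers and centralizers, this turns facts about one Sylow subgroup for each prime into
  facts about the whole group.\<close>

lemma contains_sylows_pi_index:
  assumes N: "subgroup N G"
    and syl: "\<And>r. prime r \<Longrightarrow> r \<notin> \<sigma> \<Longrightarrow> \<exists>R. sylow_subgroup r R G \<and> R \<subseteq> N"
  shows "pi_number \<sigma> (order G div card N)"
  unfolding pi_number_def
proof (intro conjI allI impI)
  fix r assume r: "prime r \<and> r dvd order G div card N"
  show "r \<in> \<sigma>"
  proof (rule ccontr)
    assume "r \<notin> \<sigma>"
    then obtain R where R: "sylow_subgroup r R G" "R \<subseteq> N" using syl r by blast
    have rp: "prime r" using r by blast
    have "r dvd order G div card R"
      using dvd_trans[OF conjunct2[OF r] index_dvd[OF sylowD(1)[OF rp R(1)] N R(2)]] .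
    then show False using sylowD(3)[OF rp R(1)] by blast
  qed
qed (rule index_pos[OF N])

lemma contains_sylows_eq_carrier:
  assumes N: "subgroup N G"
    and syl: "\<And>r. prime r \<Longrightarrow> \<exists>R. sylow_subgroup r R G \<and> R \<subseteq> N"
  shows "N = carrier G"
proof -
  have "pi_number {} (order G div card N)" by (rule contains_sylows_pi_index[OF N syl])
  then have "order G div card N = 1" using pi_number_both by blast
  then have "card N = card (carrier G)" using card_dvd_order[OF N] unfolding order_def
    by (metis dvd_div_mult_self mult_1)
  then show ?thesis using sub_eqI[OF N subgroup_self subgroup.subset[OF N]] by blast
qed

lemma pi_subgroup_mem:
  assumes N: "subgroup N G" and S: "subgroup S G" "N \<subseteq> S" "normalizes S N"
    and i: "pi_number \<sigma> (card S div card N)" and T: "pi_subgroup \<tau> T G" "T \<subseteq> S" and d: "\<sigma> \<inter> \<tau> = {}"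
  shows "T \<subseteq> N"
proof
  fix x assume x: "x \<in> T"
  have sT: "subgroup T G" using T pi_subgroup_iff by blast
  have 1: "x [^] card T \<in> N" using pow_card_eq_one[OF sT x] subgroup.one_closed[OF N] by simp
  have "coprime (card T) (card S div card N)"
    using pi_number_coprime[of \<tau> "card T" \<sigma>] T(1) i d unfolding pi_subgroup_iff by blast
  then show "x \<in> N" using coprime_index_mem[OF N S _ 1] x T(2) by blast
qed

lemma pi_subgroup_mem_normal:
  assumes N: "N \<lhd> G" and i: "pi_number \<sigma> (order G div card N)" and T: "pi_subgroup \<tau> T G" and d: "\<sigma> \<inter> \<tau> = {}"
  shows "T \<subseteq> N"
proof (rule pi_subgroup_mem[OF normal_imp_subgroup[OF N] subgroup_self])
  show "N \<subseteq> carrier G" by (rule subgroup.subset[OF normal_imp_subgroup[OF N]])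
  show "normalizes (carrier G) N" using N normal_iff by blast
  show "pi_number \<sigma> (card (carrier G) div card N)" using i unfolding order_def .
  show "pi_subgroup \<tau> T G" by fact
  show "T \<subseteq> carrier G" using T subgroup.subset unfolding pi_subgroup_iff by blast
qed (rule d)

text \<open>A Sylow q-subgroup for q outside \<sigma> would have order coprime to the exponent and
  so be trivial. For images in a quotient this avoids determining their orders.\<close>

lemma pi_subgroup_exponentI:
  assumes A: "subgroup A G" and m: "pi_number \<sigma> m" and "\<And>x. x \<in> A \<Longrightarrow> x [^] (m::nat) = \<one>"
  shows "pi_subgroup \<sigma> A G"
  unfolding pi_subgroup_def
proof (intro conjI A allI impI)
  fix q assume q: "prime q \<and> q dvd card A"
  interpret A: finite_group "G\<lparr>carrier := A\<rparr>" using finite_group_sub[OF A] .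
  obtain Q where Q: "sylow_subgroup q Q (G\<lparr>carrier := A\<rparr>)" using A.sylow_exists q by blast
  have qp: "prime q" using q by blast
  have sQ: "subgroup Q G" "Q \<subseteq> A" using A.sylowD(1)[OF qp Q] sub_restrict_iff[OF A] by blast+
  have nd: "\<not> q dvd card A div card Q" using A.sylowD(3)[OF qp Q] by (simp add: order_def)
  have pQ: "pi_number {q} (card Q)" using A.sylowD(2)[OF qp Q] unfolding A.pi_subgroup_iff by blast
  show "q \<in> \<sigma>"
  proof (rule ccontr)
    assume "q \<notin> \<sigma>"
    then have cop: "coprime m (card Q)" using pi_number_coprime[OF m pQ] by blast
    have "Q \<subseteq> {\<one>}"
    proof
      fix x assume x: "x \<in> Q"
      have "x \<in> {\<one>}"
        by (rule pow_coprime_mem[OF triv_subgroup sub_mem[OF sQ(1) x] _ _ cop])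
          (use assms(3) sQ(2) x pow_card_eq_one[OF sQ(1) x] in auto)
      then show "x \<in> {\<one>}" .
    qed
    then have "Q = {\<one>}" using subgroup.one_closed[OF sQ(1)] by blast
    then show False using nd q by simp
  qed
qed

text \<open>The index of \<open>A \<inter> B\<close> in \<open>A\<close> is that of \<open>B\<close>
  in \<open>A <#> B\<close>.\<close>

lemma index_Int:
  assumes A: "A \<lhd> G" and B: "B \<lhd> G"
    and "pi_number \<sigma> (order G div card A)" "pi_number \<sigma> (order G div card B)"
  shows "pi_number \<sigma> (order G div card (A \<inter> B))"
proof -
  have sA: "subgroup A G" and sB: "subgroup B G" using A B normal_imp_subgroup by blast+
  have sI: "subgroup (A \<inter> B) G" using sub_Int sA sB by blast
  have sAB: "subgroup (A <#> B) G"
    using sub_set_mult[OF sA sB] normalizes_mono A subgroup.subset[OF sB] unfolding normal_iff by blast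
  obtain a where a: "card A = card (A \<inter> B) * a" using card_sub_dvd[OF sI sA] by (metis Int_lower1 dvdE)
  obtain b where b: "card (A <#> B) = card B * b"
    using card_sub_dvd[OF sB sAB set_mult_upper(2)[OF sA sB]] by (metis dvdE)
  obtain c where c: "order G = card A * c" using card_dvd_order[OF sA] by (metis dvdE)
  obtain e where e: "order G = card (A <#> B) * e" using card_dvd_order[OF sAB] by (metis dvdE)
  note pos = card_sub_pos[OF sI] card_sub_pos[OF sA] card_sub_pos[OF sB]
  have "a = b" using card_set_mult[OF sA sB] a b pos by simp
  have "order G div card B = b * e" using e b pos by simp
  then have "pi_number \<sigma> a" using assms(4) \<open>a = b\<close> pi_number_dvd by (metis dvd_triv_left)
  moreover have "pi_number \<sigma> c" using assms(3) c pos by simp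
  moreover have "order G div card (A \<inter> B) = a * c" using a c pos by simp
  ultimately show ?thesis using pi_number_mult by simp
qed

text \<open>The normalizer of \<open>H\<close> in \<open>C\<close> has \<pi>-index because it
  contains \<open>H\<close>, and \<pi>'-index because it contains a Sylow subgroup for each prime of
  \<pi>; so \<open>H\<close> is normal in \<open>C\<close>. Then \<open>H\<close> contains all
  \<pi>'-subgroups of \<open>C\<close>, among them its own conjugates under
  \<open>G\<close>.\<close>

lemma hall_normal:
  assumes C: "C \<lhd> G" and H: "subgroup H G" "H \<subseteq> C" "\<forall>p\<in>\<pi>. \<not> p dvd card H"
    "pi_number \<pi> (card C div card H)" and pr: "\<forall>p\<in>\<pi>. prime p"
    and W: "\<And>p. p \<in> \<pi> \<Longrightarrow> \<exists>W. sylow_subgroup p W (G\<lparr>carrier := C\<rparr>) \<and> commutes H W"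
  shows "H \<lhd> G"
proof -
  have sC: "subgroup C G" using C normal_imp_subgroup by blast
  interpret C: finite_group "G\<lparr>carrier := C\<rparr>" using finite_group_sub[OF sC] .
  let ?N = "normalizer G H \<inter> C"
  have sN: "subgroup ?N G" using sub_Int sub_normalizer[OF H(1)] sC by blast
  have sN': "subgroup ?N (G\<lparr>carrier := C\<rparr>)" and sH': "subgroup H (G\<lparr>carrier := C\<rparr>)"
    using sub_restrict_iff[OF sC] sN H by auto
  have HN: "H \<subseteq> ?N" using le_normalizer[OF H(1)] H(2) by blast
  have "?N = C"
  proof -
    have "pi_number \<pi> (card C div card ?N)"
      using pi_number_dvd[OF H(4)] C.index_dvd[OF sH' sN' HN] by (simp add: order_def)
    moreover have "pi_number (-\<pi>) (order (G\<lparr>carrier := C\<rparr>) div card ?N)"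
    proof (rule C.contains_sylows_pi_index[OF sN'])
      fix r assume r: "prime r" "r \<notin> -\<pi>"
      then obtain R where R: "sylow_subgroup r R (G\<lparr>carrier := C\<rparr>)" "commutes H R" using W by blast
      have "R \<subseteq> C" "R \<subseteq> carrier G" using C.sylowD(1)[OF r(1) R(1)] sub_restrict_iff[OF sC] subgroup.subset by blast+
      then have "R \<subseteq> ?N" using commutes_le_normalizer[OF H(1) _ R(2)] by blast
      then show "\<exists>R. sylow_subgroup r R (G\<lparr>carrier := C\<rparr>) \<and> R \<subseteq> ?N" using R by blast
    qed
    ultimately have "card C div card ?N = 1" using pi_number_both[of \<pi>] by (simp add: order_def)
    moreover have "card ?N dvd card C" using card_sub_dvd[OF sN sC] by blast
    ultimately have "card ?N = card C" by (metis dvd_div_mult_self mult_1)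
    then show ?thesis using sub_eqI[OF sN sC] by blast
  qed
  then have nCH: "normalizes C H" using normalizer_normalizes[OF H(1)] normalizes_mono by blast
  have "pi_number (-\<pi>) (card H)" using H(3) card_sub_pos[OF H(1)] unfolding pi_number_def by blast
  then have pH: "pi_subgroup (-\<pi>) H G" using pi_subgroup_iff H(1) by blast
  have "conj_set g H \<subseteq> H" if g: "g \<in> carrier G" for g
  proof (rule pi_subgroup_mem[OF H(1) sC H(2) nCH H(4) pi_sub_conj[OF g pH]])
    show "conj_set g H \<subseteq> C" using normal_conj[OF C g] H(2) unfolding conj_set_def by blast
  qed auto
  then show ?thesis unfolding normal_iff normalizes_def conj_set_def using H(1) by blast
qed

section \<open>Nilpotency of p-groups and the Fitting subgroup\<close>

lemma nontrivial_center:
  assumes p: "prime p" and o: "pi_number {p} (order G)" and "order G \<noteq> 1"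
  obtains z where "z \<in> carrier G" "z \<noteq> \<one>" "\<forall>y\<in>carrier G. z \<otimes> y = y \<otimes> z"
proof -
  let ?\<phi> = "\<lambda>g. \<lambda>h\<in>carrier G. g \<otimes> h \<otimes> inv g"
  interpret act: group_action G "carrier G" ?\<phi> by (rule action_by_conjugation)
  let ?Z = "{z \<in> carrier G. \<forall>y\<in>carrier G. z \<otimes> y = y \<otimes> z}"
  let ?orb = "orbit G ?\<phi>"
  let ?NZ = "carrier G - ?Z"
  have orb_sub: "?orb x \<subseteq> ?NZ" if x: "x \<in> ?NZ" for x
  proof
    fix y assume y: "y \<in> ?orb x"
    then obtain g where g: "g \<in> carrier G" "y = g \<otimes> x \<otimes> inv g" using x unfolding orbit_def by auto
    have yc: "y \<in> carrier G" using g x by simp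
    have "y \<notin> ?Z"
    proof
      assume "y \<in> ?Z"
      then have c: "y \<otimes> g = g \<otimes> y" using g by blast
      have "x = inv g \<otimes> (y \<otimes> g)" using g x by (simp add: group_word_simps)
      also have "\<dots> = y" unfolding c using g(1) yc by (simp add: group_word_simps)
      finally show False using \<open>y \<in> ?Z\<close> x by simp
    qed
    then show "y \<in> ?NZ" using yc by blast
  qed
  \<comment> \<open>Class equation: a non-central conjugacy class has order a power of p other than
    1.\<close>
  have "p dvd card (\<Union>(?orb ` ?NZ))"
  proof (rule dvd_partition)
    show "finite (\<Union>(?orb ` ?NZ))" by (rule finite_subset[OF UN_least[OF orb_sub]]) auto
    show "\<forall>c\<in>?orb ` ?NZ. p dvd card c"
    proof
      fix c assume "c \<in> ?orb ` ?NZ"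
      then obtain x where x: "x \<in> ?NZ" "c = ?orb x" by blast
      have "x \<in> carrier G" using x(1) by simp
      from act.orbit_stabilizer_theorem[OF this, symmetric] have "card c dvd order G"
        unfolding x(2) by (rule dvdI)
      then have pc: "pi_number {p} (card c)" using pi_number_dvd[OF o] by blast
      have "card c \<noteq> 1"
      proof
        assume "card c = 1"
        moreover have "x \<in> c" using act.orbit_refl x by blast
        ultimately have cx: "c = {x}" by (metis card_1_singletonE singletonD)
        have "x \<otimes> y = y \<otimes> x" if y: "y \<in> carrier G" for y
        proof -
          have "y \<otimes> x \<otimes> inv y \<in> c" unfolding x(2) orbit_def using x y by force
          then have "y \<otimes> x \<otimes> inv y = x" using cx by blast
          then show ?thesis using x(1) y inv_solve_right'[of x "y \<otimes> x" y] by simp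
        qed
        then show False using x by blast
      qed
      then show "p dvd card c" using pc prime_factor_nat unfolding pi_number_def by blast
    qed
    show "\<forall>c1\<in>?orb ` ?NZ. \<forall>c2\<in>?orb ` ?NZ. c1 \<noteq> c2 \<longrightarrow> c1 \<inter> c2 = {}"
    proof (intro ballI impI)
      fix c1 c2 assume c: "c1 \<in> ?orb ` ?NZ" "c2 \<in> ?orb ` ?NZ" and ne: "c1 \<noteq> c2"
      have "c1 \<in> orbits G (carrier G) ?\<phi>" "c2 \<in> orbits G (carrier G) ?\<phi>"
        using c unfolding orbits_def by blast+
      then show "c1 \<inter> c2 = {}" using act.disjoint_union ne by blast
    qed
  qed
  moreover have "\<Union>(?orb ` ?NZ) = ?NZ"
    using orb_sub act.orbit_refl by (intro subset_antisym UN_least subsetI UN_I) auto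
  ultimately have 1: "p dvd card ?NZ" by simp
  have 2: "p dvd order G" using assms(3) o prime_factor_nat unfolding pi_number_def by blast
  have "order G = card ?Z + card ?NZ"
    unfolding order_def using card_Diff_subset[of ?Z "carrier G"] card_mono[of "carrier G" ?Z] by fastforce
  then have "card ?Z = order G - card ?NZ" by simp
  then have "p dvd card ?Z" using dvd_diff_nat[OF 2 1] by simp
  then have "card ?Z \<noteq> 1" using p not_prime_1 by auto
  moreover have "\<one> \<in> ?Z" by simp
  ultimately have "?Z \<noteq> {\<one>}" by (metis is_singletonI is_singleton_altdef)
  then obtain z where "z \<in> ?Z" "z \<noteq> \<one>" using \<open>\<one> \<in> ?Z\<close> by blast
  then show thesis using that by blast
qed

text \<open>The trivial subgroup is generalized to any normal subgroup \<open>W\<close>, and the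
  induction runs from the whole group downwards: if a term of the lower central series lies in the
  preimage of the centre of \<open>G / W\<close>, the next term lies in \<open>W\<close>.\<close>

lemma p_group_nilpotent:
  assumes p: "prime p" and o: "pi_number {p} (order G)"
  shows "nilpotent_group G"
proof -
  have "\<exists>n. lower_central G n \<subseteq> W" if "W \<lhd> G" for W
    using that
  proof (induction "order G - card W" arbitrary: W rule: less_induct)
    case less
    note nW = less.prems
    have sW: "subgroup W G" using nW normal_imp_subgroup by blast
    interpret W: normal W G by (rule nW)
    show ?case
    proof (cases "W = carrier G")
      case True
      then show ?thesis by (intro exI[of _ 0]) simp
    next
      case False
      let ?Q = "G Mod W"
      have finQ: "finite (carrier ?Q)" by (simp add: carrier_FactGroup)
      interpret Q: finite_group ?Q
        using W.factorgroup_is_group finQ by (simp add: finite_group_def finite_group_axioms_def)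
      have oQ: "order ?Q * card W = order G" using lagrange[OF sW] by (simp add: order_def FactGroup_def)
      then have pQ: "pi_number {p} (order ?Q)" using pi_number_dvd[OF o] by (metis dvd_triv_left)
      have "order ?Q \<noteq> 1"
      proof
        assume "order ?Q = 1"
        then have "card W = card (carrier G)" using oQ unfolding order_def by simp
        then show False using sub_eqI[OF sW subgroup_self subgroup.subset[OF sW]] False by blast
      qed
      then obtain z where z: "z \<in> carrier ?Q" "z \<noteq> \<one>\<^bsub>?Q\<^esub>" "\<forall>y\<in>carrier ?Q. z \<otimes>\<^bsub>?Q\<^esub> y = y \<otimes>\<^bsub>?Q\<^esub> z"
        using Q.nontrivial_center[OF p pQ] by metis
      obtain x where x: "x \<in> carrier G" "z = W #> x" using z(1) by (auto simp: carrier_FactGroup)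
      \<comment> \<open>The preimage of the centre of \<open>G / W\<close>, larger than
        \<open>W\<close> because that centre is nontrivial.\<close>
      let ?W = "{w \<in> carrier G. \<forall>y\<in>carrier G. w \<otimes> y \<otimes> inv w \<otimes> inv y \<in> W}"
      have xW: "x \<in> ?W"
      proof (intro CollectI conjI ballI x(1))
        fix y assume y: "y \<in> carrier G"
        then have "W #> y \<in> carrier ?Q" by (auto simp: carrier_FactGroup)
        then have "(W #> x) <#> (W #> y) = (W #> y) <#> (W #> x)" using z(3) x(2) by simp
        then have "W #> (x \<otimes> y) = W #> (y \<otimes> x)" using W.rcos_sum x(1) y by simp
        then have "x \<otimes> y \<in> W #> (y \<otimes> x)" using rcos_self[of "x \<otimes> y" W] sW x(1) y by simp
        then have "x \<otimes> y \<otimes> inv (y \<otimes> x) \<in> W" using W.rcos_module_imp[OF is_group] x(1) y by simp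
        then show "x \<otimes> y \<otimes> inv x \<otimes> inv y \<in> W" using x(1) y by (simp add: group_word_simps)
      qed
      have xnW: "x \<notin> W" using z(2) x coset_join2[OF x(1) sW] by auto
      have "?W \<lhd> G"
      proof -
        have "subgroup ?W G"
        proof (rule sub_finiteI)
          show "\<one> \<in> ?W" using subgroup.one_closed[OF sW] by simp
          fix w v assume wv: "w \<in> ?W" "v \<in> ?W"
          show "w \<otimes> v \<in> ?W"
          proof (intro CollectI conjI ballI)
            show "w \<otimes> v \<in> carrier G" using wv by simp
            fix y assume y: "y \<in> carrier G"
            have "w \<otimes> (v \<otimes> y \<otimes> inv v \<otimes> inv y) \<otimes> inv w \<in> W" using normal_conj[OF nW, of w] wv y by blast
            moreover have "w \<otimes> y \<otimes> inv w \<otimes> inv y \<in> W" using wv y by blast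
            ultimately have "(w \<otimes> (v \<otimes> y \<otimes> inv v \<otimes> inv y) \<otimes> inv w) \<otimes> (w \<otimes> y \<otimes> inv w \<otimes> inv y) \<in> W"
              by (rule subgroup.m_closed[OF sW])
            then show "w \<otimes> v \<otimes> y \<otimes> inv (w \<otimes> v) \<otimes> inv y \<in> W" using wv y by (simp add: group_word_simps)
          qed
        qed auto
        moreover have "g \<otimes> w \<otimes> inv g \<in> ?W" if g: "g \<in> carrier G" and w: "w \<in> ?W" for g w
        proof (intro CollectI conjI ballI)
          show "g \<otimes> w \<otimes> inv g \<in> carrier G" using g w by simp
          fix y assume y: "y \<in> carrier G"
          have "w \<otimes> (inv g \<otimes> y \<otimes> g) \<otimes> inv w \<otimes> inv (inv g \<otimes> y \<otimes> g) \<in> W" using w g y by simp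
          then have "g \<otimes> (w \<otimes> (inv g \<otimes> y \<otimes> g) \<otimes> inv w \<otimes> inv (inv g \<otimes> y \<otimes> g)) \<otimes> inv g \<in> W"
            by (rule normal_conj[OF nW g])
          then show "g \<otimes> w \<otimes> inv g \<otimes> y \<otimes> inv (g \<otimes> w \<otimes> inv g) \<otimes> inv y \<in> W"
            using g w y by (simp add: group_word_simps)
        qed
        ultimately show ?thesis unfolding normal_iff normalizes_def by blast
      qed
      have WW: "W \<subset> ?W"
      proof -
        have "w \<otimes> y \<otimes> inv w \<otimes> inv y \<in> W" if w: "w \<in> W" and y: "y \<in> carrier G" for w y
        proof -
          have "y \<otimes> inv w \<otimes> inv y \<in> W" using normal_conj[OF nW y subgroup.m_inv_closed[OF sW w]] .
          then have "w \<otimes> (y \<otimes> inv w \<otimes> inv y) \<in> W" by (rule subgroup.m_closed[OF sW w])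
          then show ?thesis using sub_mem[OF sW w] y by (simp add: m_assoc)
        qed
        then have "W \<subseteq> ?W" using sub_mem[OF sW] by blast
        then show ?thesis using xW xnW by blast
      qed
      have "card W < card ?W" by (rule psubset_card_mono[OF _ WW]) simp
      moreover have "card ?W \<le> order G" unfolding order_def by (rule card_mono) auto
      ultimately have "order G - card ?W < order G - card W" by simp
      from less.hyps[OF this \<open>?W \<lhd> G\<close>] obtain n where n: "lower_central G n \<subseteq> ?W" by blast
      have "lower_central G (Suc n) \<subseteq> W"
        unfolding lower_central.simps by (rule generate_subgroup_incl[OF _ sW]) (use n in blast)
      then show ?thesis by blast
    qed
  qed
  then obtain n where n: "lower_central G n \<subseteq> {\<one>}" using one_is_normal by blast
  moreover have "\<one> \<in> lower_central G n" by (cases n) (auto intro: generate.one)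
  ultimately show ?thesis unfolding nilpotent_group_def using is_group by blast
qed

lemma fitting_normal: "fitting G \<lhd> G"
  unfolding fitting_def
proof (rule normal_generateI)
  show "\<Union>{N. N \<lhd> G \<and> nilpotent_group (G\<lparr>carrier := N\<rparr>)} \<subseteq> carrier G"
    using subgroup.subset[OF normal_imp_subgroup] by blast
qed (use normal_conj in blast)

lemma normal_p_le_fitting:
  assumes p: "prime p" and N: "N \<lhd> G" "pi_subgroup {p} N G"
  shows "N \<subseteq> fitting G"
proof -
  have sN: "subgroup N G" using N normal_imp_subgroup by blast
  interpret N: finite_group "G\<lparr>carrier := N\<rparr>" using finite_group_sub[OF sN] .
  have "nilpotent_group (G\<lparr>carrier := N\<rparr>)"
    using N.p_group_nilpotent[OF p] N(2) unfolding pi_subgroup_iff by (simp add: order_def)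
  then show ?thesis unfolding fitting_def using N(1) by (auto intro: generate.incl)
qed

end

section \<open>Groups in which normalizers of non-subnormal special subgroups are special\<close>

locale special_normalizers = finite_group +
  fixes \<pi> :: "nat set"
  assumes finite_pi: "finite \<pi>" and primes: "\<forall>p\<in>\<pi>. prime p"
    and special_normalizer: "\<And>K. subgroup K G \<Longrightarrow> pi_special \<pi> (G\<lparr>carrier := K\<rparr>) \<Longrightarrow> \<not> subnormal G K \<Longrightarrow>
      pi_special \<pi> (G\<lparr>carrier := normalizer G K\<rparr>)"
begin

text \<open>The only place where the assumption on normalizers is used.\<close>

lemma prime_power_normalizer_special:
  assumes "pi_subgroup {r} Q G" "\<not> Q \<subseteq> pi_core {r} G"
  shows "pi_special \<pi> (G\<lparr>carrier := normalizer G Q\<rparr>)"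
  using special_normalizer prime_power_special[OF finite_pi primes assms(1)] subnormal_pi_le[OF _ assms(1)] assms
  unfolding pi_subgroup_iff by blast

lemma normalizer_commutes:
  assumes "pi_subgroup {r} Q G" "\<not> Q \<subseteq> pi_core {r} G" "p \<in> \<pi>"
    and "pi_subgroup {p} S G" "S \<subseteq> normalizer G Q" "pi_subgroup (-{p}) T G" "T \<subseteq> normalizer G Q"
  shows "commutes S T"
  by (rule special_commutes[OF finite_pi primes _ prime_power_normalizer_special[OF assms(1,2)] assms(3-7)])
    (use assms(1) sub_normalizer pi_subgroup_iff in blast)

lemma sylow_Int:
  assumes p: "p \<in> \<pi>" and "sylow_subgroup p P G" "sylow_subgroup p P' G" "\<not> P \<inter> P' \<subseteq> pi_core {p} G"
  shows "P = P'"
  using assms(2-4)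
proof (induction "order G - card (P \<inter> P')" arbitrary: P P' rule: less_induct)
  case less
  have pp: "prime p" using p primes by blast
  let ?Q = "P \<inter> P'"
  let ?N = "normalizer G ?Q"
  have sP: "subgroup P G" "pi_subgroup {p} P G" and sP': "subgroup P' G" "pi_subgroup {p} P' G"
    using sylowD[OF pp less.prems(1)] sylowD[OF pp less.prems(2)] by blast+
  have sQ: "subgroup ?Q G" using sub_Int sP sP' by blast
  have pQ: "pi_subgroup {p} ?Q G" using pi_subgroup_subset[OF sP(2) sQ] by blast
  have sN: "subgroup ?N G" using sub_normalizer[OF sQ] .
  interpret N: finite_group "G\<lparr>carrier := ?N\<rparr>" using finite_group_sub[OF sN] .
  have spN: "pi_special \<pi> (G\<lparr>carrier := ?N\<rparr>)"
    using prime_power_normalizer_special[OF pQ] less.prems(3) by blast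
  let ?S = "pi_core {p} (G\<lparr>carrier := ?N\<rparr>)"
  have S: "pi_subgroup {p} ?S G" using N.pi_core_pi pi_subgroup_restrict[OF sN] by blast
  obtain R where R: "sylow_subgroup p R G" "?S \<subseteq> R" using sylow_above[OF pp S] by blast
  show ?case
  proof (rule ccontr)
    assume ne: "P \<noteq> P'"
    \<comment> \<open>\<open>R\<close> is a Sylow subgroup above O_p of the special group
      \<open>?N\<close>. A Sylow subgroup \<open>A\<close> properly containing \<open>?Q\<close>
      meets \<open>R\<close> in more than \<open>?Q\<close>, so induction identifies the two; both
      \<open>P\<close> and \<open>P'\<close> qualify as \<open>A\<close>.\<close>
    have step: "A = R" if A: "sylow_subgroup p A G" "?Q \<subset> A" for A
    proof -
      have sA: "subgroup A G" "pi_subgroup {p} A G" using sylowD[OF pp A(1)] by blast+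
      have grow: "?Q \<subset> A \<inter> ?N" using normalizer_grows[OF pp sA(2) sQ A(2)] .
      have "pi_subgroup {p} (A \<inter> ?N) (G\<lparr>carrier := ?N\<rparr>)"
        using pi_subgroup_subset[OF sA(2) sub_Int[OF sA(1) sN]] pi_subgroup_restrict[OF sN] by blast
      then have "A \<inter> ?N \<subseteq> ?S" using N.special_le_cores(1)[OF finite_pi primes spN p] by blast
      then have sub: "?Q \<subset> A \<inter> R" using grow R(2) by blast
      have sAR: "subgroup (A \<inter> R) G" using sub_Int[OF sA(1) sylowD(1)[OF pp R(1)]] .
      have "card ?Q < card (A \<inter> R)" using psubset_card_mono[OF finite_sub[OF sAR] sub] .
      moreover have "card (A \<inter> R) \<le> order G" using dvd_imp_le[OF card_dvd_order[OF sAR]] by simp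
      ultimately have "order G - card (A \<inter> R) < order G - card ?Q" by simp
      then show ?thesis using less.hyps[OF _ A(1) R(1)] sub less.prems(3) by blast
    qed
    have "?Q \<noteq> P"
      using sub_eqI[OF sP(1) sP'(1)] card_sylow[OF less.prems(1,2)] ne by blast
    moreover have "?Q \<noteq> P'"
      using sub_eqI[OF sP'(1) sP(1)] card_sylow[OF less.prems(1,2)] ne by (metis Int_lower1)
    ultimately have "P = R" "P' = R" using step[OF less.prems(1)] step[OF less.prems(2)] by blast+
    then show False using ne by simp
  qed
qed

section \<open>Normal complements modulo O_p, and Sylow subgroups for other primes\<close>

lemma ex_normal_complement:
  assumes p: "p \<in> \<pi>"
  obtains L where "L \<lhd> G" "pi_core {p} G \<subseteq> L"
    "\<And>P. sylow_subgroup p P G \<Longrightarrow> card L * card P = order G * card (pi_core {p} G)"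
    "pi_number {p} (order G div card L)" "pi_number (-{p}) (card L div card (pi_core {p} G))"
proof -
  let ?V = "pi_core {p} G"
  have pp: "prime p" using p primes by blast
  obtain P where P: "sylow_subgroup p P G" using sylow_exists[OF pp] by blast
  have sP: "subgroup P G" "pi_subgroup {p} P G" using sylowD[OF pp P] by blast+
  have VP: "?V \<subseteq> P" using pi_core_le_sylow[OF pp P] .
  have "\<exists>L. L \<lhd> G \<and> ?V \<subseteq> L \<and> card L * card P = order G * card ?V"
  proof (cases "P \<subseteq> ?V")
    case True
    then have "P = ?V" using VP by blast
    then show ?thesis using normal_self subgroup.subset[OF pi_core_sub]
      by (intro exI[of _ "carrier G"]) (simp add: order_def)
  next
    case False
    let ?N = "normalizer G P"
    have sN: "subgroup ?N G" using sub_normalizer[OF sP(1)] .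
    interpret N: finite_group "G\<lparr>carrier := ?N\<rparr>" using finite_group_sub[OF sN] .
    have spN: "pi_special \<pi> (G\<lparr>carrier := ?N\<rparr>)" using prime_power_normalizer_special[OF sP(2) False] .
    let ?A = "pi_core {p} (G\<lparr>carrier := ?N\<rparr>)" and ?B = "pi_core (-{p}) (G\<lparr>carrier := ?N\<rparr>)"
    have A: "pi_subgroup {p} ?A G" and B: "pi_subgroup (-{p}) ?B G" "?B \<subseteq> ?N"
      using N.pi_core_pi pi_subgroup_restrict[OF sN] by blast+
    have "P \<subseteq> ?A"
      using N.special_le_cores(1)[OF finite_pi primes spN p] pi_subgroup_restrict[OF sN] sP(2) le_normalizer[OF sP(1)]
      by blast
    then have AP: "?A = P" using sylow_maximal[OF pp P A] by blast
    have cPB: "commutes P ?B"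
      using normalizer_commutes[OF sP(2) False p sP(2) le_normalizer[OF sP(1)] B] .
    have sB: "subgroup ?B G" using B pi_subgroup_iff by blast
    have split: "?A <#> ?B = ?N"
      using N.special_iff_split[OF finite_pi primes] spN p by auto
    \<comment> \<open>The factor O_{p'} of the special group N(P) provides the elements
      \<open>c\<close>, and its order the exponent \<open>m\<close>.\<close>
    have "TI_mod G p P ?V"
      unfolding TI_mod_def
    proof (intro conjI ballI impI pp P pi_core_normal VP)
      fix g assume "g \<in> carrier G" "\<not> P \<inter> conj_set g P \<subseteq> ?V"
      then show "conj_set g P = P" using sylow_Int[OF p P sylow_conj[OF _ P]] by blast
    next
      fix t assume "t \<in> carrier G" "conj_set t P = P"
      then have "t \<in> ?N" using mem_normalizer_conj[OF sP(1)] by blast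
      then obtain u c where uc: "u \<in> P" "c \<in> ?B" "t = u \<otimes> c" using split AP unfolding set_mult_def by blast
      have "c [^] card ?B = \<one>" using pow_card_eq_one[OF sB uc(2)] .
      moreover have "\<not> p dvd card ?B" using B(1) pp unfolding pi_subgroup_def by blast
      moreover have "\<forall>x\<in>P. c \<otimes> x = x \<otimes> c" using commutes_sym[OF cPB] uc(2) unfolding commutes_def by blast
      ultimately show "\<exists>u\<in>P. \<exists>c\<in>carrier G. \<exists>m::nat. t = u \<otimes> c \<and> (\<forall>x\<in>P. c \<otimes> x = x \<otimes> c) \<and>
          c [^] m = \<one> \<and> \<not> p dvd m"
        using uc sub_mem[OF sB uc(2)] by blast
    qed
    then show ?thesis using TI_normal_complement[OF finite_group_axioms] by blast
  qed
  then obtain L where L: "L \<lhd> G" "?V \<subseteq> L" "card L * card P = order G * card ?V" by blast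
  have sL: "subgroup L G" using L(1) normal_imp_subgroup by blast
  obtain i where i: "order G = card L * i" using card_dvd_order[OF sL] by (metis dvdE)
  obtain j where j: "card L = card ?V * j" using card_sub_dvd[OF pi_core_sub sL L(2)] by (metis dvdE)
  note pos = card_sub_pos[OF sL] card_sub_pos[OF sP(1)] card_sub_pos[OF pi_core_sub[of "{p}"]]
  have ci: "card P = card ?V * i" using L(3) i pos by simp
  have "pi_number {p} i" using sP(2) ci pi_number_dvd unfolding pi_subgroup_iff by (metis dvd_triv_right)
  then have 1: "pi_number {p} (order G div card L)" using i pos by simp
  have "order G div card P = j" using i j ci pos by (simp add: mult.assoc mult.commute[of j])
  then have "\<not> p dvd j" using sylowD(3)[OF pp P] by simp
  moreover have "j > 0" using j pos by (metis gr0I mult_0_right less_numeral_extra(3))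
  ultimately have 2: "pi_number (-{p}) (card L div card ?V)"
    using j pos pi_number_compl_iff[OF pp] by simp
  show thesis
  proof (rule that[OF L(1,2) _ 1 2])
    fix P' assume "sylow_subgroup p P' G"
    then show "card L * card P' = order G * card ?V" using card_sylow[OF P] L(3) by simp
  qed
qed

lemma sylow_le_complement:
  assumes p: "p \<in> \<pi>" and r: "prime r" "r \<noteq> p" and L: "L \<lhd> G" "pi_number {p} (order G div card L)"
    and R: "pi_subgroup {r} R G"
  shows "R \<subseteq> L"
  using pi_subgroup_mem_normal[OF L R] r by blast

lemma sylow_normal_or_commutes:
  assumes p: "p \<in> \<pi>" and P: "sylow_subgroup p P G" "\<not> P \<subseteq> pi_core {p} G" and r: "prime r" "r \<noteq> p"
  obtains R where "sylow_subgroup r R G" "R \<lhd> G" | R where "sylow_subgroup r R G" "commutes P R"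
proof -
  let ?V = "pi_core {p} G"
  have pp: "prime p" using p primes by blast
  have sP: "subgroup P G" "pi_subgroup {p} P G" using sylowD[OF pp P(1)] by blast+
  obtain L where L: "L \<lhd> G" "?V \<subseteq> L" "card L * card P = order G * card ?V"
    "pi_number {p} (order G div card L)" "pi_number (-{p}) (card L div card ?V)"
    using ex_normal_complement[OF p] P(1) by metis
  have sL: "subgroup L G" using L(1) normal_imp_subgroup by blast
  obtain R where R: "sylow_subgroup r R G" using sylow_exists[OF r(1)] by blast
  have sR: "subgroup R G" "pi_subgroup {r} R G" using sylowD[OF r(1) R] by blast+
  show thesis
  proof (cases "R \<subseteq> pi_core {r} G")
    case True
    then show thesis using that(1) R sylow_le_core_normal[OF r(1) R] by blast
  next
    case nR: False
    have RL: "R \<subseteq> L" using sylow_le_complement[OF p r L(1,4) sR(2)] .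
    let ?N = "normalizer G R"
    have sN: "subgroup ?N G" using sub_normalizer[OF sR(1)] .
    interpret L: finite_group "G\<lparr>carrier := L\<rparr>" using finite_group_sub[OF sL] .
    interpret N: finite_group "G\<lparr>carrier := ?N\<rparr>" using finite_group_sub[OF sN] .
    have spN: "pi_special \<pi> (G\<lparr>carrier := ?N\<rparr>)" using prime_power_normalizer_special[OF sR(2) nR] .
    have sylL: "sylow_subgroup r A (G\<lparr>carrier := L\<rparr>)" if A: "sylow_subgroup r A G" "A \<subseteq> L" for A
    proof -
      have sA: "subgroup A G" "pi_number {r} (card A)" "\<not> r dvd order G div card A"
        using sylowD[OF r(1) A(1)] unfolding pi_subgroup_iff by blast+
      obtain a where a: "card L = card A * a" using card_sub_dvd[OF sA(1) sL A(2)] by (metis dvdE)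
      obtain b where b: "order G = card L * b" using card_dvd_order[OF sL] by (metis dvdE)
      have "order G div card A = a * b" using a b card_sub_pos[OF sA(1)] by simp
      then have "\<not> r dvd a" using sA(3) by (metis dvd_mult2)
      moreover have "card L div card A = a" using a card_sub_pos[OF sA(1)] by simp
      ultimately show ?thesis
        using L.sylow_iff[OF r(1)] sub_restrict_iff[OF sL] sA A(2) by (simp add: order_def)
    qed
    let ?Q = "pi_core {p} (G\<lparr>carrier := ?N\<rparr>)" and ?B = "pi_core (-{p}) (G\<lparr>carrier := ?N\<rparr>)"
    have Q: "pi_subgroup {p} ?Q G" "?Q \<subseteq> ?N" and B: "pi_subgroup (-{p}) ?B G" "?B \<subseteq> ?N"
      using N.pi_core_pi pi_subgroup_restrict[OF sN] by blast+
    have sQ: "subgroup ?Q G" using Q pi_subgroup_iff by blast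
    have split: "?Q <#> ?B = ?N"
      using N.special_iff_split[OF finite_pi primes] spN p by auto
    have BL: "?B \<subseteq> L" using pi_subgroup_mem_normal[OF L(1,4) B(1)] by blast
    \<comment> \<open>Frattini argument: \<open>L\<close> contains \<open>R\<close>, so
      \<open>G\<close> is the product of \<open>L\<close> and N(R). Of the two factors of N(R),
      \<open>?B\<close> lies in \<open>L\<close>, which leaves \<open>?Q\<close>.\<close>
    have "carrier G \<subseteq> L <#> ?Q"
    proof
      fix g assume g: "g \<in> carrier G"
      let ?R = "conj_set g R"
      have "?R \<subseteq> L" using normal_conj[OF L(1) g] RL unfolding conj_set_def by blast
      then obtain l where l: "l \<in> L" "L.conj_set l ?R = R"
        using L.sylow_conjugate[OF r(1) sylL[OF R RL] sylL[OF sylow_conj[OF g R]]] by auto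
      have lc: "l \<in> carrier G" using sub_mem[OF sL l(1)] .
      have "conj_set l ?R = R" using l unfolding L.conj_set_def conj_set_def using m_inv_consistent[OF sL l(1)] by simp
      then have "conj_set (l \<otimes> g) R = R" using conj_conj[OF lc g subgroup.subset[OF sR(1)]] by simp
      then have "l \<otimes> g \<in> ?N" using mem_normalizer_conj[OF sR(1)] lc g by simp
      then obtain q b where qb: "q \<in> ?Q" "b \<in> ?B" "l \<otimes> g = q \<otimes> b" using split unfolding set_mult_def by blast
      have m: "q \<in> carrier G" "b \<in> carrier G" using sub_mem[OF sQ qb(1)] BL qb(2) sub_mem[OF sL] by blast+
      have "g = inv l \<otimes> (l \<otimes> g)" using lc g by (simp add: l_inv_cancel)
      also have "\<dots> = (inv l \<otimes> (q \<otimes> b \<otimes> inv q)) \<otimes> q"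
        unfolding qb(3) using lc m by (simp add: group_word_simps)
      finally have e: "g = (inv l \<otimes> (q \<otimes> b \<otimes> inv q)) \<otimes> q" .
      have "q \<otimes> b \<otimes> inv q \<in> L" using normal_conj[OF L(1) m(1)] BL qb(2) by blast
      then have "inv l \<otimes> (q \<otimes> b \<otimes> inv q) \<in> L"
        by (rule subgroup.m_closed[OF sL subgroup.m_inv_closed[OF sL l(1)]])
      then have "(inv l \<otimes> (q \<otimes> b \<otimes> inv q)) \<otimes> q \<in> L <#> ?Q" using qb(1) by (rule prod_mem_set_mult)
      then show "g \<in> L <#> ?Q" using e by simp
    qed
    then have LQ: "L <#> ?Q = carrier G"
      using setmult_subset_G[OF subgroup.subset[OF sL] subgroup.subset[OF sQ]] by blast
    \<comment> \<open>\<open>?Q\<close> need not contain O_p. Adding O_p gives the order of a Sylow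
      subgroup, by comparing the order of \<open>L <#> ?Q\<close> with the order equation for
      \<open>L\<close>.\<close>
    let ?Y = "?V <#> ?Q"
    have nV: "normalizes (carrier G) ?V" using pi_core_normal normal_iff by blast
    have sY: "subgroup ?Y G"
      using sub_set_mult[OF pi_core_sub sQ normalizes_mono[OF nV subgroup.subset[OF sQ]]] .
    have i: "L \<inter> ?Q = ?V \<inter> ?Q"
    proof
      have sLQ: "subgroup (L \<inter> ?Q) G" using sub_Int[OF sL sQ] .
      have "L \<inter> ?Q \<subseteq> ?V"
        by (rule pi_subgroup_mem[OF pi_core_sub sL L(2) normalizes_mono[OF nV subgroup.subset[OF sL]] L(5)
              pi_subgroup_subset[OF Q(1) sLQ]]) auto
      then show "L \<inter> ?Q \<subseteq> ?V \<inter> ?Q" by blast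
    qed (use L(2) in blast)
    have c1: "order G * card (?V \<inter> ?Q) = card L * card ?Q"
      using card_set_mult[OF sL sQ] LQ i unfolding order_def by simp
    have c2: "card ?Y * card (?V \<inter> ?Q) = card ?V * card ?Q" using card_set_mult[OF pi_core_sub sQ] .
    have "card ?Y * card L * card (?V \<inter> ?Q) = card P * card L * card (?V \<inter> ?Q)"
    proof -
      have "card ?Y * card L * card (?V \<inter> ?Q) = card ?V * (card L * card ?Q)" using c2 by (simp add: algebra_simps)
      also have "\<dots> = (order G * card ?V) * card (?V \<inter> ?Q)" unfolding c1[symmetric] by (simp add: algebra_simps)
      also have "\<dots> = card P * card L * card (?V \<inter> ?Q)" unfolding L(3)[symmetric] by (simp add: algebra_simps)
      finally show ?thesis .
    qed
    then have cY: "card ?Y = card P"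
      using card_sub_pos[OF sL] card_sub_pos[OF sub_Int[OF pi_core_sub sQ, of "{p}"]] by simp
    then have sylY: "sylow_subgroup p ?Y G" using P(1) sY unfolding sylow_subgroup_def by simp
    have pY: "pi_subgroup {p} ?Y G" using sylowD(2)[OF pp sylY] .
    have nY: "\<not> ?Y \<subseteq> ?V"
    proof
      assume "?Y \<subseteq> ?V"
      then have "card P \<le> card ?V" using cY card_mono[OF finite_sub[OF pi_core_sub]] by metis
      then have "P = ?V"
        using pi_core_le_sylow[OF pp P(1)] card_seteq[OF finite_sub[OF sP(1)]] by blast
      then show False using P(2) by blast
    qed
    have pR: "pi_subgroup (-{p}) R G" by (rule pi_subgroup_mono[OF sR(2)]) (use r in auto)
    have cQR: "commutes ?Q R"
      using normalizer_commutes[OF sR(2) nR p Q pR le_normalizer[OF sR(1)]] .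
    \<comment> \<open>\<open>R\<close> centralizes \<open>?Q\<close> but so far only normalizes O_p.
      Since \<open>?Y\<close> is not contained in O_p, its normalizer is special, and there
      normalizing turns into centralizing.\<close>
    have "normalizes R ?Y" by (rule normalizes_set_mult[OF pi_core_normal sQ sR(1) cQR])
    then have "R \<subseteq> normalizer G ?Y" using normalizes_le_normalizer[OF sY subgroup.subset[OF sR(1)]] by blast
    then have cYR: "commutes ?Y R"
      using normalizer_commutes[OF pY nY p pY le_normalizer[OF sY] pR] by blast
    obtain g where g: "g \<in> carrier G" "conj_set g ?Y = P" using sylow_conjugate[OF pp P(1) sylY] by blast
    have "commutes P (conj_set g R)"
      using commutes_conj[OF g(1) subgroup.subset[OF sY] subgroup.subset[OF sR(1)] cYR] g(2) by simp
    then show thesis using that(2) sylow_conj[OF g(1) R] by blast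
  qed
qed

text \<open>Otherwise N(P) would contain a Sylow r-subgroup for every r: for r other than p, a
  normal one lies in O_r and centralizes \<open>P\<close> by assumption, and without a normal one
  the dichotomy provides one that centralizes \<open>P\<close>.\<close>

lemma sylow_le_coreI:
  assumes p: "p \<in> \<pi>" and P: "sylow_subgroup p P G"
    and c: "\<And>r. prime r \<Longrightarrow> r \<noteq> p \<Longrightarrow> commutes P (pi_core {r} G)"
  shows "P \<subseteq> pi_core {p} G"
proof (rule ccontr)
  assume n: "\<not> ?thesis"
  have pp: "prime p" using p primes by blast
  have sP: "subgroup P G" "pi_subgroup {p} P G" using sylowD[OF pp P] by blast+
  have "normalizer G P = carrier G"
  proof (rule contains_sylows_eq_carrier[OF sub_normalizer[OF sP(1)]])
    fix r :: nat assume r: "prime r"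
    show "\<exists>R. sylow_subgroup r R G \<and> R \<subseteq> normalizer G P"
    proof (cases "r = p")
      case True
      then show ?thesis using P le_normalizer[OF sP(1)] by blast
    next
      case False
      obtain R where R: "sylow_subgroup r R G" "commutes P R"
      proof (rule sylow_normal_or_commutes[OF p P n r False])
        fix R assume R: "sylow_subgroup r R G" "R \<lhd> G"
        then have "R \<subseteq> pi_core {r} G" using pi_core_max sylowD(2)[OF r] by blast
        then show thesis using that R commutes_mono[OF c[OF r False] subset_refl] by blast
      qed (use that in blast)
      then show ?thesis
        using commutes_le_normalizer[OF sP(1)] subgroup.subset[OF sylowD(1)[OF r R(1)]] by blast
    qed
  qed
  then have "P \<lhd> G" using normal_iff_normalizer[OF sP(1)] by blast
  then show False using pi_core_max sP(2) n by blast
qed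

text \<open>The index of O_p in \<open>L p\<close> is prime to p, so O_p is a normal Sylow subgroup
  of \<open>L p\<close>, and its intersection with the smaller group \<open>M\<close> is one of
  \<open>M\<close>.\<close>

lemma ex_normal_pi_index:
  obtains M where "M \<lhd> G" "pi_number \<pi> (order G div card M)"
    "\<And>p. p \<in> \<pi> \<Longrightarrow> sylow_subgroup p (pi_core {p} G \<inter> M) (G\<lparr>carrier := M\<rparr>)"
    "\<And>p. p \<in> \<pi> \<Longrightarrow> pi_core {p} G \<inter> M \<lhd> G\<lparr>carrier := M\<rparr>"
proof -
  have "\<forall>p\<in>\<pi>. \<exists>L. L \<lhd> G \<and> pi_core {p} G \<subseteq> L \<and> pi_number {p} (order G div card L) \<and>
      pi_number (-{p}) (card L div card (pi_core {p} G))"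
    using ex_normal_complement by metis
  then obtain L where L: "\<forall>p\<in>\<pi>. L p \<lhd> G \<and> pi_core {p} G \<subseteq> L p \<and> pi_number {p} (order G div card (L p)) \<and>
      pi_number (-{p}) (card (L p) div card (pi_core {p} G))"
    by (metis bchoice)
  have "\<exists>M. M \<lhd> G \<and> pi_number \<pi> (order G div card M) \<and> (\<forall>p\<in>S. M \<subseteq> L p)" if "S \<subseteq> \<pi>" for S
    using finite_subset[OF that finite_pi] that
  proof (induction S)
    case empty
    have "order G div card (carrier G) = 1"
      using order_pos unfolding order_def by (metis div_self less_numeral_extra(3))
    then show ?case using normal_self by (intro exI[of _ "carrier G"]) simp
  next
    case (insert q S)
    then obtain M where M: "M \<lhd> G" "pi_number \<pi> (order G div card M)" "\<forall>p\<in>S. M \<subseteq> L p" by auto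
    have q: "q \<in> \<pi>" using insert by blast
    then have "pi_number \<pi> (order G div card (L q))" using L pi_number_mono by blast
    then have "pi_number \<pi> (order G div card (M \<inter> L q))" using index_Int M(1,2) L q by blast
    moreover have "M \<inter> L q \<lhd> G" using normal_subgroup_intersect M(1) L q by blast
    ultimately show ?case using M(3) by (intro exI[of _ "M \<inter> L q"]) blast
  qed
  from this[OF subset_refl] obtain M where M: "M \<lhd> G" "pi_number \<pi> (order G div card M)" "\<forall>p\<in>\<pi>. M \<subseteq> L p"
    by blast
  have sM: "subgroup M G" using M(1) normal_imp_subgroup by blast
  have "sylow_subgroup p (pi_core {p} G \<inter> M) (G\<lparr>carrier := M\<rparr>) \<and> pi_core {p} G \<inter> M \<lhd> G\<lparr>carrier := M\<rparr>"
    if p: "p \<in> \<pi>" for p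
  proof -
    have pp: "prime p" using p primes by blast
    have sL: "subgroup (L p) G" using L p normal_imp_subgroup by blast
    interpret L: finite_group "G\<lparr>carrier := L p\<rparr>" using finite_group_sub[OF sL] .
    have VL: "pi_core {p} G \<subseteq> L p" using L p by blast
    have "\<not> p dvd card (L p) div card (pi_core {p} G)" using L p pi_number_compl_iff[OF pp] by blast
    then have 1: "sylow_subgroup p (pi_core {p} G) (G\<lparr>carrier := L p\<rparr>)"
      using L.sylow_iff[OF pp] sub_restrict_iff[OF sL] VL pi_core_pi[of "{p}"] unfolding pi_subgroup_iff
      by (simp add: order_def)
    have 2: "pi_core {p} G \<lhd> G\<lparr>carrier := L p\<rparr>"
      using normal_restrict_supergroup[OF sL pi_core_normal VL] .
    have 3: "subgroup M (G\<lparr>carrier := L p\<rparr>)" using sub_restrict_iff[OF sL] sM M(3) p by blast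
    show ?thesis using L.normal_sylow_restrict[OF pp 1 2 3] by simp
  qed
  then show thesis using that M(1,2) by blast
qed

section \<open>Maximality of the product of the cores\<close>

lemma special_core_maximal: "maximal_pi_special \<pi> (special_core \<pi> G) G"
proof -
  let ?D = "special_core \<pi> G"
  have sD: "subgroup ?D G" using special_core_direct[OF fin_carrier] by blast
  interpret D: finite_group "G\<lparr>carrier := ?D\<rparr>" using finite_group_sub[OF sD] .
  have inD: "pi_core \<sigma> G \<subseteq> ?D" if "\<sigma> \<in> pi_blocks \<pi>" for \<sigma>
    unfolding special_core_def using that by (auto intro: generate.incl)
  have coreD: "pi_core {p} (G\<lparr>carrier := ?D\<rparr>) <#> pi_core (-{p}) (G\<lparr>carrier := ?D\<rparr>) = ?D" if p: "p \<in> \<pi>" for p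
  proof -
    let ?A = "pi_core {p} G" and ?B = "pi_core (-{p}) G \<inter> ?D"
    have pb: "{p} \<in> pi_blocks \<pi>" using p unfolding pi_blocks_def by blast
    have sB: "subgroup ?B G" using sub_Int[OF pi_core_sub sD] .
    have nA: "?A \<lhd> G\<lparr>carrier := ?D\<rparr>" using normal_restrict_supergroup[OF sD pi_core_normal inD[OF pb]] .
    have nB: "?B \<lhd> G\<lparr>carrier := ?D\<rparr>"
      by (rule normal_Int_subgroup[OF sD pi_core_normal])
    have pA: "pi_subgroup {p} ?A (G\<lparr>carrier := ?D\<rparr>)" using pi_core_pi inD[OF pb] pi_subgroup_restrict[OF sD] by blast
    have pB: "pi_subgroup (-{p}) ?B (G\<lparr>carrier := ?D\<rparr>)"
      using pi_subgroup_subset[OF pi_core_pi sB] pi_subgroup_restrict[OF sD] by blast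
    have "normalizes ?B ?A"
      using pi_core_normal[of "{p}"] normalizes_mono subgroup.subset[OF sB] unfolding normal_iff by blast
    then have sAB: "subgroup (?A <#> ?B) G" using sub_set_mult[OF pi_core_sub sB] by blast
    have "pi_core \<sigma> G \<subseteq> ?A <#> ?B" if \<sigma>: "\<sigma> \<in> pi_blocks \<pi>" for \<sigma>
    proof (cases "\<sigma> = {p}")
      case True
      then show ?thesis using set_mult_upper(1)[OF pi_core_sub sB] by blast
    next
      case False
      then have "\<sigma> \<subseteq> -{p}" using \<sigma> p unfolding pi_blocks_def prime_compl_def by auto
      then have "pi_core \<sigma> G \<subseteq> ?B" using pi_core_mono inD[OF \<sigma>] by blast
      then show ?thesis using set_mult_upper(2)[OF pi_core_sub sB] by blast
    qed
    then have "(\<Union>\<sigma>\<in>pi_blocks \<pi>. pi_core \<sigma> G) \<subseteq> ?A <#> ?B" by (rule UN_least)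
    from generate_subgroup_incl[OF this sAB] have "?D \<subseteq> ?A <#> ?B"
      unfolding special_core_def[symmetric] .
    then show ?thesis using D.split_coreI[OF nA nB pA pB] by simp
  qed
  have spD: "pi_special \<pi> (G\<lparr>carrier := ?D\<rparr>)"
    unfolding D.special_iff_split[OF finite_pi primes] using coreD by simp
  \<comment> \<open>\<open>K\<close> is generated by its own cores, so it suffices to move each of
    them into the corresponding core of \<open>G\<close>.\<close>
  have "K \<subseteq> ?D" if K: "subgroup K G" "pi_special \<pi> (G\<lparr>carrier := K\<rparr>)" "?D \<subseteq> K" for K
  proof -
    interpret K: finite_group "G\<lparr>carrier := K\<rparr>" using finite_group_sub[OF K(1)] .
    have coreK: "pi_subgroup \<sigma> (pi_core \<sigma> (G\<lparr>carrier := K\<rparr>)) G" "pi_core \<sigma> (G\<lparr>carrier := K\<rparr>) \<subseteq> K" for \<sigma>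
      using K.pi_core_pi pi_subgroup_restrict[OF K(1)] by blast+
    have core_p: "pi_core {p} (G\<lparr>carrier := K\<rparr>) \<subseteq> pi_core {p} G" if p: "p \<in> \<pi>" for p
    proof (rule ccontr)
      let ?Y = "pi_core {p} (G\<lparr>carrier := K\<rparr>)"
      assume n: "\<not> ?thesis"
      have pp: "prime p" using p primes by blast
      \<comment> \<open>p-subgroups above O_p(K) centralizing every O_r with r other than p. A
        maximal one, \<open>S\<close>, is not contained in O_p, so N(S) is special; it contains
        these O_r, hence the normalizer of \<open>S\<close> inside a Sylow subgroup is again in the
        family. As normalizers grow, \<open>S\<close> is a Sylow subgroup.\<close>
      define fam where "fam = {S. pi_subgroup {p} S G \<and> ?Y \<subseteq> S \<and>
        (\<forall>r. prime r \<and> r \<noteq> p \<longrightarrow> commutes S (pi_core {r} G))}"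
      have "commutes ?Y (pi_core {r} G)" if r: "prime r" "r \<noteq> p" for r
      proof (rule special_commutes[OF finite_pi primes K(1,2) p coreK(1) coreK(2)])
        show "pi_subgroup (-{p}) (pi_core {r} G) G" by (rule pi_subgroup_mono[OF pi_core_pi]) (use r in auto)
        \<comment> \<open>For r outside \<pi>, O_r is part of the block of \<pi>'.\<close>
        have "pi_core {r} G \<subseteq> ?D"
        proof (cases "r \<in> \<pi>")
          case True
          then show ?thesis using inD[of "{r}"] unfolding pi_blocks_def by blast
        next
          case False
          then have "pi_core {r} G \<subseteq> pi_core (prime_compl \<pi>) G"
            using r by (intro pi_core_mono) (auto simp: prime_compl_def)
          then show ?thesis using inD[of "prime_compl \<pi>"] unfolding pi_blocks_def by blast
        qed
        then show "pi_core {r} G \<subseteq> K" using K(3) by blast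
      qed
      then have "?Y \<in> fam" unfolding fam_def using coreK(1) by blast
      moreover have "finite fam"
      proof (rule finite_subset)
        show "fam \<subseteq> Pow (carrier G)" unfolding fam_def pi_subgroup_iff using subgroup.subset by blast
      qed simp
      ultimately obtain S where S: "S \<in> fam" and max: "\<forall>T\<in>fam. S \<subseteq> T \<longrightarrow> S = T"
        using finite_has_maximal[of fam] by (metis empty_iff)
      have pS: "pi_subgroup {p} S G" and YS: "?Y \<subseteq> S"
        and cS: "\<And>r. prime r \<Longrightarrow> r \<noteq> p \<Longrightarrow> commutes S (pi_core {r} G)"
        using S unfolding fam_def by blast+
      have sS: "subgroup S G" using pS pi_subgroup_iff by blast
      have nS: "\<not> S \<subseteq> pi_core {p} G" using n YS by blast
      obtain P where P: "sylow_subgroup p P G" "S \<subseteq> P" using sylow_above[OF pp pS] by blast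
      have sP: "subgroup P G" "pi_subgroup {p} P G" using sylowD[OF pp P(1)] by blast+
      have "S = P"
      proof (rule ccontr)
        assume "S \<noteq> P"
        let ?T = "P \<inter> normalizer G S"
        have grow: "S \<subset> ?T" using normalizer_grows[OF pp sP(2) sS] P(2) \<open>S \<noteq> P\<close> by blast
        have pT: "pi_subgroup {p} ?T G"
          using pi_subgroup_subset[OF sP(2) sub_Int[OF sP(1) sub_normalizer[OF sS]]] by blast
        have "commutes ?T (pi_core {r} G)" if r: "prime r" "r \<noteq> p" for r
        proof (rule normalizer_commutes[OF pS nS p pT])
          show "pi_subgroup (-{p}) (pi_core {r} G) G" by (rule pi_subgroup_mono[OF pi_core_pi]) (use r in auto)
          show "pi_core {r} G \<subseteq> normalizer G S"
            using commutes_le_normalizer[OF sS subgroup.subset[OF pi_core_sub] cS[OF r]] .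
        qed blast
        then have "?T \<in> fam" unfolding fam_def using pT YS grow by blast
        then show False using max grow by blast
      qed
      then have "S \<subseteq> pi_core {p} G" using sylow_le_coreI[OF p P(1)] cS by blast
      then show False using nS by blast
    qed
    have core_compl: "pi_core (prime_compl \<pi>) (G\<lparr>carrier := K\<rparr>) \<subseteq> pi_core (prime_compl \<pi>) G"
    proof -
      let ?Y = "pi_core (prime_compl \<pi>) (G\<lparr>carrier := K\<rparr>)"
      have sY: "subgroup ?Y G" using coreK(1) pi_subgroup_iff by blast
      have disj: "\<pi> \<inter> prime_compl \<pi> = {}" unfolding prime_compl_def by blast
      obtain M where M: "M \<lhd> G" "pi_number \<pi> (order G div card M)"
        and Ms: "\<And>p. p \<in> \<pi> \<Longrightarrow> sylow_subgroup p (pi_core {p} G \<inter> M) (G\<lparr>carrier := M\<rparr>)"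
        and Mn: "\<And>p. p \<in> \<pi> \<Longrightarrow> pi_core {p} G \<inter> M \<lhd> G\<lparr>carrier := M\<rparr>"
        by (rule ex_normal_pi_index) blast
      have sM: "subgroup M G" using M(1) normal_imp_subgroup by blast
      interpret M: finite_group "G\<lparr>carrier := M\<rparr>" using finite_group_sub[OF sM] .
      \<comment> \<open>\<open>K\<close> is special and contains every O_p with p in \<pi>, so
        O_{\<pi>'}(K) centralizes them and lies in \<open>?C\<close>. In \<open>?C\<close> the Sylow
        subgroups for \<pi> sit inside the O_p, so a Hall \<pi>'-subgroup centralizes them and is
        normal in \<open>G\<close>; being normal, it contains O_{\<pi>'}(K).\<close>
      let ?C = "M \<inter> centralizer (\<Union>p\<in>\<pi>. pi_core {p} G)"
      have "centralizer (\<Union>p\<in>\<pi>. pi_core {p} G) \<lhd> G"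
      proof (rule centralizer_normal)
        show "(\<Union>p\<in>\<pi>. pi_core {p} G) \<subseteq> carrier G" by (rule UN_least) (rule subgroup.subset[OF pi_core_sub])
        fix g a assume "g \<in> carrier G" "a \<in> (\<Union>p\<in>\<pi>. pi_core {p} G)"
        then show "g \<otimes> a \<otimes> inv g \<in> (\<Union>p\<in>\<pi>. pi_core {p} G)" using normal_conj[OF pi_core_normal] by blast
      qed
      then have nC: "?C \<lhd> G" using normal_subgroup_intersect M(1) by blast
      have sC: "subgroup ?C G" using nC normal_imp_subgroup by blast
      interpret C: finite_group "G\<lparr>carrier := ?C\<rparr>" using finite_group_sub[OF sC] .
      have CM: "?C \<subseteq> M" by blast
      have sCM: "subgroup ?C (G\<lparr>carrier := M\<rparr>)" using sub_restrict_iff[OF sM] sC CM by blast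
      have Cs: "sylow_subgroup p (pi_core {p} G \<inter> ?C) (G\<lparr>carrier := ?C\<rparr>) \<and> pi_core {p} G \<inter> ?C \<lhd> G\<lparr>carrier := ?C\<rparr>"
        if p: "p \<in> \<pi>" for p
      proof -
        have "pi_core {p} G \<inter> M \<inter> ?C = pi_core {p} G \<inter> ?C" by blast
        then show ?thesis using M.normal_sylow_restrict[OF bspec[OF primes p] Ms[OF p] Mn[OF p] sCM] by simp
      qed
      have "\<forall>p\<in>\<pi>. \<exists>S. S \<lhd> G\<lparr>carrier := ?C\<rparr> \<and> sylow_subgroup p S (G\<lparr>carrier := ?C\<rparr>)"
        using Cs by blast
      from schur_zassenhaus_nilpotent[OF C.finite_group_axioms primes this]
      obtain H where H: "subgroup H (G\<lparr>carrier := ?C\<rparr>)" "\<forall>p\<in>\<pi>. \<not> p dvd card H"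
        "pi_number \<pi> (order (G\<lparr>carrier := ?C\<rparr>) div card H)"
        by blast
      have sH: "subgroup H G" and HC: "H \<subseteq> ?C" using H(1) sub_restrict_iff[OF sC] by blast+
      have iH: "pi_number \<pi> (card ?C div card H)" using H(3) by (simp add: order_def)
      have nH: "H \<lhd> G"
      proof (rule hall_normal[OF nC sH HC H(2) iH primes])
        fix p assume p: "p \<in> \<pi>"
        have "commutes H (pi_core {p} G \<inter> ?C)"
          unfolding commutes_def using HC p unfolding centralizer_def by blast
        then show "\<exists>W. sylow_subgroup p W (G\<lparr>carrier := ?C\<rparr>) \<and> commutes H W" using Cs[OF p] by blast
      qed
      have "pi_subgroup (prime_compl \<pi>) H G"
        unfolding pi_subgroup_def prime_compl_def using sH H(2) by blast
      then have Hle: "H \<subseteq> pi_core (prime_compl \<pi>) G" using pi_core_max nH by blast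
      have YM: "?Y \<subseteq> M" using pi_subgroup_mem_normal[OF M coreK(1) disj] .
      have YC: "?Y \<subseteq> ?C"
      proof -
        have "x \<otimes> v = v \<otimes> x" if x: "x \<in> ?Y" and p: "p \<in> \<pi>" and v: "v \<in> pi_core {p} G" for x p v
        proof -
          have "pi_core {p} G \<subseteq> K" using inD[of "{p}"] K(3) p unfolding pi_blocks_def by blast
          moreover have "pi_subgroup (-{p}) ?Y G"
            by (rule pi_subgroup_mono[OF coreK(1)]) (use p in \<open>auto simp: prime_compl_def\<close>)
          ultimately have cm: "commutes (pi_core {p} G) ?Y"
            using special_commutes[OF finite_pi primes K(1,2) p pi_core_pi _ _ coreK(2)] by blast
          show ?thesis using commutes_sym[OF cm] x v unfolding commutes_def by blast
        qed
        then show ?thesis using YM sub_mem[OF sY] unfolding centralizer_def by blast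
      qed
      have "?Y \<subseteq> H"
        by (rule pi_subgroup_mem[OF sH sC HC _ iH coreK(1) YC disj])
          (use nH normal_iff normalizes_mono subgroup.subset[OF sC] in blast)
      then show ?thesis using Hle by blast
    qed
    have "pi_core \<sigma> (G\<lparr>carrier := K\<rparr>) \<subseteq> ?D" if \<sigma>: "\<sigma> \<in> pi_blocks \<pi>" for \<sigma>
      using \<sigma> core_p core_compl inD[OF \<sigma>] unfolding pi_blocks_def by auto
    then have sub: "(\<Union>\<sigma>\<in>pi_blocks \<pi>. pi_core \<sigma> (G\<lparr>carrier := K\<rparr>)) \<subseteq> ?D" by blast
    have "K = generate (G\<lparr>carrier := K\<rparr>) (\<Union>\<sigma>\<in>pi_blocks \<pi>. pi_core \<sigma> (G\<lparr>carrier := K\<rparr>))"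
      using K(2) unfolding pi_special_def internal_direct_product_def by simp
    also have "\<dots> = generate G (\<Union>\<sigma>\<in>pi_blocks \<pi>. pi_core \<sigma> (G\<lparr>carrier := K\<rparr>))"
      by (rule generate_consistent[OF _ K(1)]) (use coreK(2) in blast)
    also have "\<dots> \<subseteq> ?D" by (rule generate_subgroup_incl[OF sub sD])
    finally show ?thesis .
  qed
  then show ?thesis unfolding maximal_pi_special_def using sD spD by blast
qed

text \<open>At each p the quotient splits as the image of \<open>P\<close> times the image of
  \<open>L\<close>. The first is normal because \<open>P F(G)\<close> is; the second is a p'-group
  because O_p lies in \<open>F(G)\<close> and has index prime to p in \<open>L\<close>.\<close>

lemma quotient_fitting_special: "pi_special \<pi> (G Mod fitting G)"
proof -
  let ?F = "fitting G"
  let ?Q = "G Mod ?F"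
  interpret F: normal ?F G by (rule fitting_normal)
  have sF: "subgroup ?F G" by (rule F.subgroup_axioms)
  have finQ: "finite (carrier ?Q)" by (simp add: carrier_FactGroup)
  interpret Q: finite_group ?Q
    using F.factorgroup_is_group finQ by (simp add: finite_group_def finite_group_axioms_def)
  let ?h = "\<lambda>x. ?F #> x"
  interpret h: group_hom G ?Q ?h
    using F.r_coset_hom_Mod Q.is_group is_group by (simp add: group_hom_def group_hom_axioms_def)
  have surj: "?h ` carrier G = carrier ?Q" by (simp add: carrier_FactGroup)
  have hF: "?h x = \<one>\<^bsub>?Q\<^esub>" if "x \<in> ?F" for x using coset_join2[OF sub_mem[OF sF that] sF that] by simp
  have hn: "?h ` N \<lhd> ?Q" if "N \<lhd> G" for N
    using normal.surj_hom_normal_subgroup[OF that h.group_hom_axioms surj] .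
  show ?thesis
    unfolding Q.special_iff_split[OF finite_pi primes]
  proof
    fix p assume p: "p \<in> \<pi>"
    have pp: "prime p" using p primes by blast
    let ?V = "pi_core {p} G"
    obtain P where P: "sylow_subgroup p P G" using sylow_exists[OF pp] by blast
    have sP: "subgroup P G" "pi_subgroup {p} P G" using sylowD[OF pp P] by blast+
    obtain L where L: "L \<lhd> G" "?V \<subseteq> L" "card L * card P = order G * card ?V"
      "pi_number {p} (order G div card L)" "pi_number (-{p}) (card L div card ?V)"
      using ex_normal_complement[OF p] P by metis
    have sL: "subgroup L G" using L(1) normal_imp_subgroup by blast
    have nV: "normalizes L ?V"
      using pi_core_normal normal_iff normalizes_mono subgroup.subset[OF sL] by blast
    have VF: "?V \<subseteq> ?F" using normal_p_le_fitting[OF pp pi_core_normal pi_core_pi] .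
    have FP: "?F <#> P \<lhd> G"
    proof -
      have sFP: "subgroup (?F <#> P) G"
        using sub_set_mult[OF sF sP(1)] normalizes_mono fitting_normal subgroup.subset[OF sP(1)]
        unfolding normal_iff by blast
      show ?thesis
      proof (cases "P \<subseteq> ?V")
        case True
        then have "?F <#> P \<subseteq> ?F" using set_mult_least[OF sF] VF by blast
        then have "?F <#> P = ?F" using set_mult_upper(1)[OF sF sP(1)] by blast
        then show ?thesis using fitting_normal by simp
      next
        case False
        \<comment> \<open>For each r other than p, a normal Sylow r-subgroup lies in
          \<open>?F\<close>; if there is none, some Sylow r-subgroup centralizes \<open>P\<close>
          and thus normalizes the product.\<close>
        have "normalizer G (?F <#> P) = carrier G"
        proof (rule contains_sylows_eq_carrier[OF sub_normalizer[OF sFP]])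
          fix r :: nat assume r: "prime r"
          show "\<exists>R. sylow_subgroup r R G \<and> R \<subseteq> normalizer G (?F <#> P)"
          proof (cases "r = p")
            case True
            then show ?thesis using P set_mult_upper(2)[OF sF sP(1)] le_normalizer[OF sFP] by blast
          next
            case rp: False
            show ?thesis
            proof (rule sylow_normal_or_commutes[OF p P False r rp])
              fix R assume R: "sylow_subgroup r R G" "R \<lhd> G"
              then have "R \<subseteq> ?F" using normal_p_le_fitting[OF r] sylowD(2)[OF r] by blast
              then show ?thesis using R(1) set_mult_upper(1)[OF sF sP(1)] le_normalizer[OF sFP] by blast
            next
              fix R assume R: "sylow_subgroup r R G" "commutes P R"
              have sR: "subgroup R G" using sylowD(1)[OF r R(1)] .
              have "normalizes R (?F <#> P)" by (rule normalizes_set_mult[OF fitting_normal sP(1) sR R(2)])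
              then show ?thesis using R(1) normalizes_le_normalizer[OF sFP subgroup.subset[OF sR]] by blast
            qed
          qed
        qed
        then show ?thesis using normal_iff_normalizer[OF sFP] by blast
      qed
    qed
    have hFP: "?h ` (?F <#> P) = ?h ` P"
    proof
      show "?h ` P \<subseteq> ?h ` (?F <#> P)" using set_mult_upper(2)[OF sF sP(1)] by (rule image_mono)
      show "?h ` (?F <#> P) \<subseteq> ?h ` P"
      proof
        fix z assume "z \<in> ?h ` (?F <#> P)"
        then obtain f q where fq: "f \<in> ?F" "q \<in> P" "z = ?h (f \<otimes> q)" unfolding set_mult_def by blast
        have m: "f \<in> carrier G" "q \<in> carrier G" using sub_mem[OF sF fq(1)] sub_mem[OF sP(1) fq(2)] by auto
        have "z = (?F #> f) #> q" unfolding fq(3) using coset_mult_assoc[OF subgroup.subset[OF sF] m] by simp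
        also have "\<dots> = ?h q" using coset_join2[OF m(1) sF fq(1)] by simp
        finally show "z \<in> ?h ` P" using fq(2) by blast
      qed
    qed
    have A: "?h ` P \<lhd> ?Q" using hn[OF FP] unfolding hFP .
    have B: "?h ` L \<lhd> ?Q" using hn[OF L(1)] .
    have pA: "pi_subgroup {p} (?h ` P) ?Q"
    proof (rule Q.pi_subgroup_exponentI[OF normal_imp_subgroup[OF A]])
      show "pi_number {p} (card P)" using sP(2) pi_subgroup_iff by blast
      fix z assume "z \<in> ?h ` P"
      then obtain x where x: "x \<in> P" "z = ?h x" by blast
      have "z [^]\<^bsub>?Q\<^esub> card P = ?h (x [^] card P)" unfolding x(2) using F.FactGroup_pow[OF sub_mem[OF sP(1) x(1)]] .
      then show "z [^]\<^bsub>?Q\<^esub> card P = \<one>\<^bsub>?Q\<^esub>"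
        using pow_card_eq_one[OF sP(1) x(1)] hF[OF subgroup.one_closed[OF sF]] by simp
    qed
    have pB: "pi_subgroup (-{p}) (?h ` L) ?Q"
    proof (rule Q.pi_subgroup_exponentI[OF normal_imp_subgroup[OF B] L(5)])
      fix z assume "z \<in> ?h ` L"
      then obtain x where x: "x \<in> L" "z = ?h x" by blast
      let ?k = "card L div card ?V"
      have "z [^]\<^bsub>?Q\<^esub> ?k = ?h (x [^] ?k)" unfolding x(2) using F.FactGroup_pow[OF sub_mem[OF sL x(1)]] .
      moreover have "x [^] ?k \<in> ?F" using pow_index_mem[OF pi_core_sub sL L(2) nV x(1)] VF by blast
      ultimately show "z [^]\<^bsub>?Q\<^esub> ?k = \<one>\<^bsub>?Q\<^esub>" using hF by simp
    qed
    \<comment> \<open>With this intersection the order equation for \<open>L\<close> says that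
      \<open>P <#> L\<close> has the order of \<open>G\<close>.\<close>
    have "P \<inter> L = ?V"
    proof
      have sI: "subgroup (P \<inter> L) G" using sub_Int[OF sP(1) sL] .
      show "P \<inter> L \<subseteq> ?V"
        by (rule pi_subgroup_mem[OF pi_core_sub sL L(2) nV L(5) pi_subgroup_subset[OF sP(2) sI]]) auto
      show "?V \<subseteq> P \<inter> L" using pi_core_le_sylow[OF pp P] L(2) by blast
    qed
    then have "card (P <#> L) * card ?V = order G * card ?V"
      using card_set_mult[OF sP(1) sL] L(3) by (simp add: mult.commute)
    then have "card (P <#> L) = card (carrier G)"
      using card_sub_pos[OF pi_core_sub[of "{p}"]] unfolding order_def by simp
    then have PL: "P <#> L = carrier G"
      using card_subset_eq[OF fin_carrier setmult_subset_G[OF subgroup.subset[OF sP(1)] subgroup.subset[OF sL]]] by simp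
    have "carrier ?Q \<subseteq> ?h ` P <#>\<^bsub>?Q\<^esub> ?h ` L"
    proof
      fix z assume "z \<in> carrier ?Q"
      then obtain g where g: "g \<in> carrier G" "z = ?h g" using surj by blast
      then obtain x l where xl: "x \<in> P" "l \<in> L" "g = x \<otimes> l" using PL unfolding set_mult_def by blast
      have "z = ?h x \<otimes>\<^bsub>?Q\<^esub> ?h l"
        unfolding g(2) xl(3) by (rule h.hom_mult[OF sub_mem[OF sP(1) xl(1)] sub_mem[OF sL xl(2)]])
      then show "z \<in> ?h ` P <#>\<^bsub>?Q\<^esub> ?h ` L"
        using Q.prod_mem_set_mult[of "?h x" "?h ` P" "?h l" "?h ` L"] xl by simp
    qed
    then show "pi_core {p} ?Q <#>\<^bsub>?Q\<^esub> pi_core (-{p}) ?Q = carrier ?Q" by (rule Q.split_coreI[OF A B pA pB])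
  qed
qed

lemma ex_hall_normal:
  assumes P: "\<forall>p\<in>\<pi>. sylow_subgroup p (P p) G"
  shows "\<exists>H. hall_subgroup (prime_compl \<pi>) H G \<and> ((\<exists>p\<in>\<pi>. P p \<lhd> G) \<or> H \<lhd> G)"
proof -
  obtain M where M: "M \<lhd> G" "pi_number \<pi> (order G div card M)"
    and Ms: "\<And>p. p \<in> \<pi> \<Longrightarrow> sylow_subgroup p (pi_core {p} G \<inter> M) (G\<lparr>carrier := M\<rparr>)"
    and Mn: "\<And>p. p \<in> \<pi> \<Longrightarrow> pi_core {p} G \<inter> M \<lhd> G\<lparr>carrier := M\<rparr>"
    by (rule ex_normal_pi_index) blast
  have sM: "subgroup M G" using M(1) normal_imp_subgroup by blast
  interpret M: finite_group "G\<lparr>carrier := M\<rparr>" using finite_group_sub[OF sM] .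
  have "\<forall>p\<in>\<pi>. \<exists>S. S \<lhd> G\<lparr>carrier := M\<rparr> \<and> sylow_subgroup p S (G\<lparr>carrier := M\<rparr>)"
    using Ms Mn by blast
  from schur_zassenhaus_nilpotent[OF M.finite_group_axioms primes this]
  obtain H where H: "subgroup H (G\<lparr>carrier := M\<rparr>)" "\<forall>p\<in>\<pi>. \<not> p dvd card H"
    "pi_number \<pi> (order (G\<lparr>carrier := M\<rparr>) div card H)"
    by blast
  have sH: "subgroup H G" and HM: "H \<subseteq> M" using H(1) sub_restrict_iff[OF sM] by blast+
  have iH: "pi_number \<pi> (card M div card H)" using H(3) by (simp add: order_def)
  have pH: "pi_subgroup (prime_compl \<pi>) H G"
    unfolding pi_subgroup_def prime_compl_def using sH H(2) by blast
  obtain a where a: "card M = card H * a" using card_sub_dvd[OF sH sM HM] by (metis dvdE)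
  obtain b where b: "order G = card M * b" using card_dvd_order[OF sM] by (metis dvdE)
  note pos = card_sub_pos[OF sH] card_sub_pos[OF sM]
  have "pi_number \<pi> a" "pi_number \<pi> b" using iH M(2) a b pos by simp_all
  then have ab: "pi_number \<pi> (a * b)" using pi_number_mult by blast
  have "card (rcosets H) * card H = order G" using lagrange[OF sH] .
  then have "card (rcosets H) = a * b" using a b pos by simp
  then have "\<forall>p. prime p \<and> p dvd card (rcosets H) \<longrightarrow> p \<notin> prime_compl \<pi>"
    using ab unfolding pi_number_def prime_compl_def by auto
  then have hall: "hall_subgroup (prime_compl \<pi>) H G" unfolding hall_subgroup_def using pH by blast
  have "H \<lhd> G" if nn: "\<not> (\<exists>p\<in>\<pi>. P p \<lhd> G)"
  proof (rule hall_normal[OF M(1) sH HM H(2) iH primes])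
    fix p assume p: "p \<in> \<pi>"
    have pp: "prime p" using p primes by blast
    let ?V = "pi_core {p} G"
    have Pp: "sylow_subgroup p (P p) G" using P p by blast
    have nP: "\<not> P p \<subseteq> ?V" using sylow_le_core_normal[OF pp Pp] nn p by blast
    let ?C = "centralizer ?V"
    have nC: "?C \<lhd> G"
      by (rule centralizer_normal[OF subgroup.subset[OF pi_core_sub] normal_conj[OF pi_core_normal]])
    have sC: "subgroup ?C G" using nC normal_imp_subgroup by blast
    \<comment> \<open>As \<open>P p\<close> is not normal, for every r other than p some Sylow
      r-subgroup centralizes O_p: a normal one because it meets O_p trivially, otherwise one that
      centralizes \<open>P p\<close>. So the centralizer of O_p has p-power index and contains the
      \<pi>'-group \<open>H\<close>.\<close>
    have "pi_number {p} (order G div card ?C)"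
    proof (rule contains_sylows_pi_index[OF sC])
      fix r :: nat assume r: "prime r" "r \<notin> {p}"
      then have rp: "r \<noteq> p" by blast
      have main: "\<exists>R. sylow_subgroup r R G \<and> R \<subseteq> ?C" if R: "sylow_subgroup r R G" "commutes ?V R" for R
      proof -
        have "R \<subseteq> ?C" using commutes_sym[OF R(2)] sub_mem[OF sylowD(1)[OF r(1) R(1)]]
          unfolding commutes_def centralizer_def by blast
        then show ?thesis using R(1) by blast
      qed
      show "\<exists>R. sylow_subgroup r R G \<and> R \<subseteq> ?C"
      proof (rule sylow_normal_or_commutes[OF p Pp nP r(1) rp])
        fix R assume R: "sylow_subgroup r R G" "R \<lhd> G"
        have sR: "subgroup R G" "pi_subgroup {r} R G" using sylowD[OF r(1) R(1)] by blast+
        have i: "?V \<inter> R \<subseteq> {\<one>}" using pi_Int_trivial[OF pi_core_pi sR(2)] rp by blast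
        have "normalizes ?V R" "normalizes R ?V"
          using R(2) pi_core_normal[of "{p}"] normalizes_mono subgroup.subset[OF sR(1)] subgroup.subset[OF pi_core_sub]
          unfolding normal_iff by blast+
        then have "commutes ?V R" using trivial_Int_commutes[OF pi_core_sub sR(1)] i by blast
        then show ?thesis using main R(1) by blast
      next
        fix R assume R: "sylow_subgroup r R G" "commutes (P p) R"
        then show ?thesis using main commutes_mono[OF R(2) pi_core_le_sylow[OF pp Pp] subset_refl] by blast
      qed
    qed
    then have "H \<subseteq> ?C"
      using pi_subgroup_mem_normal[OF nC _ pH] p unfolding prime_compl_def by blast
    then have "commutes H (?V \<inter> M)" unfolding commutes_def centralizer_def by blast
    then show "\<exists>W. sylow_subgroup p W (G\<lparr>carrier := M\<rparr>) \<and> commutes H W" using Ms[OF p] by blast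
  qed
  then show ?thesis using hall by blast
qed

end

theorem corollary1p10:
  fixes G :: "('a, 'b) monoid_scheme" and \<pi> :: "nat set" and P :: "nat \<Rightarrow> 'a set"
  assumes "group G" and "finite (carrier G)"
    and "finite \<pi>" and "\<forall>p\<in>\<pi>. Factorial_Ring.prime p"
    and "\<forall>p\<in>\<pi>. sylow_subgroup p (P p) G"
    and "\<forall>K. subgroup K G \<and> pi_special \<pi> (G\<lparr>carrier := K\<rparr>) \<and> \<not> subnormal G K
            \<longrightarrow> pi_special \<pi> (G\<lparr>carrier := normalizer G K\<rparr>)"
  shows "(\<exists>H. hall_subgroup (prime_compl \<pi>) H G \<and> ((\<exists>p\<in>\<pi>. P p \<lhd> G) \<or> H \<lhd> G))
    \<and> maximal_pi_special \<pi> (special_core \<pi> G) G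
    \<and> pi_special \<pi> (G Mod fitting G)"
proof -
  interpret special_normalizers G \<pi>
    using assms unfolding special_normalizers_def special_normalizers_axioms_def
      finite_group_def finite_group_axioms_def by blast
  show ?thesis using ex_hall_normal[OF assms(5)] special_core_maximal quotient_fitting_special by blast
qed

end
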